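(* Assume that $\|\hat A\|_{\max}=o(1)$ as $n\to\infty$. For each $n$ let $\lambda=\lambda^{(n)}=(\lambda_1,\dots,\lambda_n)\in\mathbb{R}^n$ be weights and set $\hat\lambda_j:=\lambda_j/w_j$. Assume further that $$\|\hat\lambda\|_{\max}=o(1),\qquad \limsup_{n\to\infty}\|\hat\lambda\|<\infty,\qquad \liminf_{n\to\infty}\|P_{\ker(\hat A)}\hat\lambda\|^2>0,$$ where $P_{\ker(\hat A)}$ is the orthogonal projection onto the kernel of $\hat A$ and $\|\cdot\|$ is the Euclidean norm. Let $\sigma:=\|P_{\ker(\hat A)}\hat\lambda\|$. Then $\sigma^{-1}S_n$, with $S_n:=\sum_{j=1}^n\lambda_j(X_j-\mathbb{E}_{P_n}X_j)$ and $X=(X_1,\dots,X_n)\sim P_n$, converges in distribution to a standard normal random variable as $n\to\infty$. The same holds if the centering $\mathbb{E}_{P_n}X_j$ is replaced by $\mathbb{E}_{P_{n,w}}X_j=1/w_j$. Moreover $\|P_{\ker(\hat A)}\hat\lambda\|^2=\|P_{\ker(\tilde A)}\hat\lambda\|^2=\|\hat\lambda\|^2-\|\hat A\hat\lambda\|^2$.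
   Context: Standing setting: $m\ge 1$ is fixed; for each $n>m$, $A=A^{(n)}$ is a real $m\times n$ matrix of rank $m$ and $b=b^{(n)}\in\mathbb{R}^m$, and $K_n:=\{x\in\mathbb{R}^n: x\ge 0,\ Ax=b\}$ is compact and contains a point all of whose coordinates are strictly positive. $P_n$ is the uniform distribution on $K_n$: $P_n(E)=H^{n-m}(E\cap K_n)/H^{n-m}(K_n)$ for Borel $E$, where $H^{n-m}$ is the $(n-m)$-dimensional Hausdorff measure. For $w\in\mathbb{R}^n$ with all $w_j>0$, $P_{n,w}$ is the probability measure on $\mathbb{R}^n$ with density $(\prod_j w_j)e^{-\sum_j w_jx_j}\mathbf 1_{x\ge 0}$ (independent exponential coordinates with parameters $w_j$). Throughout, $w$ denotes the unique vector with all $w_j>0$, lying in the row span of $A$, such that $\sum_j A_{lj}/w_j=b_l$ for $l=1,\dots,m$. Define $\tilde A_{ij}:=A_{ij}/w_j$, $\hat A:=(\tilde A\tilde A^t)^{-1/2}\tilde A$, $\hat b:=(\tilde A\tilde A^t)^{-1/2}b$ (so $\hat A\hat A^t=I$). $\|M\|_{\max}$ denotes the maximal absolute value of the entries of a matrix or vector $M$. All objects depend on $n$. *)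

theory Defs
  imports "HOL-Probability.Probability"
begin

text \<open>Conventions. m is fixed. For each n, matrices are functions
  nat => nat => real (row index i < m, column index j < n), vectors in R^n are
  functions nat => real of which only the coordinates j < n matter; points of
  K_n are extensional functions on the index set {..<n} (elements of
  PiE {..<n} (%_. UNIV)), i.e. the carrier of the product measure
  PiM {..<n} (%_. lborel) which models R^n.\<close>

definition full_row_rank :: "nat \<Rightarrow> nat \<Rightarrow> (nat \<Rightarrow> nat \<Rightarrow> real) \<Rightarrow> bool" where
  "full_row_rank m n A \<longleftrightarrow>
     (\<forall>c::nat \<Rightarrow> real. (\<forall>j<n. (\<Sum>l<m. c l * A l j) = 0) \<longrightarrow> (\<forall>l<m. c l = 0))"

definition Kset :: "nat \<Rightarrow> nat \<Rightarrow> (nat \<Rightarrow> nat \<Rightarrow> real) \<Rightarrow> (nat \<Rightarrow> real) \<Rightarrow> (nat \<Rightarrow> real) set" where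
  "Kset m n A b = {x \<in> PiE {..<n} (\<lambda>_. UNIV).
      (\<forall>j<n. 0 \<le> x j) \<and> (\<forall>l<m. (\<Sum>j<n. A l j * x j) = b l)}"

text \<open>Standing assumptions for a given n.  Compactness is w.r.t. the product
  topology on functions, which on PiE {..<n} UNIV is the Euclidean topology of R^n.\<close>
definition standing :: "nat \<Rightarrow> nat \<Rightarrow> (nat \<Rightarrow> nat \<Rightarrow> real) \<Rightarrow> (nat \<Rightarrow> real) \<Rightarrow> bool" where
  "standing m n A b \<longleftrightarrow> m < n \<and> full_row_rank m n A \<and> compact (Kset m n A b) \<and>
      (\<exists>x\<in>Kset m n A b. \<forall>j<n. 0 < x j)"

definition wvec :: "nat \<Rightarrow> nat \<Rightarrow> (nat \<Rightarrow> nat \<Rightarrow> real) \<Rightarrow> (nat \<Rightarrow> real) \<Rightarrow> nat \<Rightarrow> real" where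
  "wvec m n A b = (THE w. w \<in> extensional {..<n} \<and> (\<forall>j<n. 0 < w j) \<and>
      (\<exists>c::nat \<Rightarrow> real. \<forall>j<n. w j = (\<Sum>l<m. c l * A l j)) \<and>
      (\<forall>l<m. (\<Sum>j<n. A l j / w j) = b l))"

definition Atil :: "nat \<Rightarrow> nat \<Rightarrow> (nat \<Rightarrow> nat \<Rightarrow> real) \<Rightarrow> (nat \<Rightarrow> real) \<Rightarrow> nat \<Rightarrow> nat \<Rightarrow> real" where
  "Atil m n A b i j = A i j / wvec m n A b j"

definition gram :: "nat \<Rightarrow> (nat \<Rightarrow> nat \<Rightarrow> real) \<Rightarrow> nat \<Rightarrow> nat \<Rightarrow> real" where
  "gram n M i k = (\<Sum>j<n. M i j * M k j)"

definition inv_sqrt :: "nat \<Rightarrow> (nat \<Rightarrow> nat \<Rightarrow> real) \<Rightarrow> nat \<Rightarrow> nat \<Rightarrow> real" where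
  "inv_sqrt m G = (THE R. (\<forall>i k. (m \<le> i \<or> m \<le> k) \<longrightarrow> R i k = 0) \<and>
      (\<forall>i<m. \<forall>k<m. R i k = R k i) \<and>
      (\<forall>c::nat \<Rightarrow> real. (\<exists>i<m. c i \<noteq> 0) \<longrightarrow> 0 < (\<Sum>i<m. \<Sum>k<m. c i * R i k * c k)) \<and>
      (\<forall>i<m. \<forall>k<m. (\<Sum>p<m. \<Sum>q<m. R i p * R p q * G q k) = (if i = k then 1 else 0)))"

definition Ahat :: "nat \<Rightarrow> nat \<Rightarrow> (nat \<Rightarrow> nat \<Rightarrow> real) \<Rightarrow> (nat \<Rightarrow> real) \<Rightarrow> nat \<Rightarrow> nat \<Rightarrow> real" where
  "Ahat m n A b i j = (\<Sum>k<m. inv_sqrt m (gram n (Atil m n A b)) i k * Atil m n A b k j)"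

definition matvec :: "nat \<Rightarrow> (nat \<Rightarrow> nat \<Rightarrow> real) \<Rightarrow> (nat \<Rightarrow> real) \<Rightarrow> nat \<Rightarrow> real" where
  "matvec n M x i = (\<Sum>j<n. M i j * x j)"

definition enorm :: "nat \<Rightarrow> (nat \<Rightarrow> real) \<Rightarrow> real" where
  "enorm n x = sqrt (\<Sum>j<n. (x j)\<^sup>2)"

definition mat_max :: "nat \<Rightarrow> nat \<Rightarrow> (nat \<Rightarrow> nat \<Rightarrow> real) \<Rightarrow> real" where
  "mat_max m n M = Max {\<bar>M i j\<bar> | i j. i < m \<and> j < n}"

definition vec_max :: "nat \<Rightarrow> (nat \<Rightarrow> real) \<Rightarrow> real" where
  "vec_max n v = Max {\<bar>v j\<bar> | j. j < n}"

definition ker_mat :: "nat \<Rightarrow> nat \<Rightarrow> (nat \<Rightarrow> nat \<Rightarrow> real) \<Rightarrow> (nat \<Rightarrow> real) set" where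
  "ker_mat m n M = {x \<in> extensional {..<n}. \<forall>i<m. (\<Sum>j<n. M i j * x j) = 0}"

definition proj :: "nat \<Rightarrow> (nat \<Rightarrow> real) set \<Rightarrow> (nat \<Rightarrow> real) \<Rightarrow> nat \<Rightarrow> real" where
  "proj n V v = (THE p. p \<in> V \<and> (\<forall>y\<in>V. (\<Sum>j<n. (v j - p j) * y j) = 0))"

text \<open>An affine isometric parametrization of the affine plane {x. A x = b} by R^(n-m):
  y |-> x0 + sum_k y_k V_k with A x0 = b and V_0..V_(n-m-1) orthonormal in ker A.\<close>
definition orth_param :: "nat \<Rightarrow> nat \<Rightarrow> (nat \<Rightarrow> nat \<Rightarrow> real) \<Rightarrow> (nat \<Rightarrow> real)
    \<Rightarrow> ((nat \<Rightarrow> real) \<Rightarrow> (nat \<Rightarrow> real)) \<Rightarrow> bool" where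
  "orth_param m n A b \<phi> \<longleftrightarrow> (\<exists>(x0::nat \<Rightarrow> real) (V::nat \<Rightarrow> nat \<Rightarrow> real).
      (\<forall>l<m. (\<Sum>j<n. A l j * x0 j) = b l) \<and>
      (\<forall>k<n-m. \<forall>l<m. (\<Sum>j<n. A l j * V k j) = 0) \<and>
      (\<forall>k<n-m. \<forall>k'<n-m. (\<Sum>j<n. V k j * V k' j) = (if k = k' then 1 else 0)) \<and>
      \<phi> = (\<lambda>y. \<lambda>j\<in>{..<n}. x0 j + (\<Sum>k<n-m. y k * V k j)))"

text \<open>The uniform distribution P_n on K_n (normalized (n-m)-dimensional Hausdorff
  measure), obtained by transporting normalized Lebesgue measure on R^(n-m) along an
  isometric parametrization of the affine hull.\<close>
definition unifK :: "nat \<Rightarrow> nat \<Rightarrow> (nat \<Rightarrow> nat \<Rightarrow> real) \<Rightarrow> (nat \<Rightarrow> real) \<Rightarrow> (nat \<Rightarrow> real) measure" where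
  "unifK m n A b = (let \<phi> = (SOME \<phi>. orth_param m n A b \<phi>);
                        L = PiM {..<n-m} (\<lambda>_. lborel)
     in distr (uniform_measure L {y \<in> space L. \<phi> y \<in> Kset m n A b})
              (PiM {..<n} (\<lambda>_. lborel)) \<phi>)"

definition lamhat :: "nat \<Rightarrow> nat \<Rightarrow> (nat \<Rightarrow> nat \<Rightarrow> real) \<Rightarrow> (nat \<Rightarrow> real) \<Rightarrow> (nat \<Rightarrow> real) \<Rightarrow> nat \<Rightarrow> real" where
  "lamhat m n A b lam j = lam j / wvec m n A b j"

end

theory Submission
  imports Defs
begin

text \<open>Since \<open>w\<close> lies in the row span of \<open>A\<close>, the exponential density of \<open>P_{n,w}\<close> is constant on the
  plane \<open>A x = b\<close>, so \<open>P_n\<close> is \<open>P_{n,w}\<close> conditioned on \<open>A x = b\<close>. In the coordinates \<open>y = w * x - 1\<close>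
  this condition reads \<open>Ahat y = 0\<close>, and on it \<open>S_n / \<sigma> = h \<bullet> y\<close>, where \<open>h\<close> is the normalised projection of
  \<open>lamhat\<close> to the kernel of \<open>Ahat\<close>. Fourier inversion at the origin of \<open>R^m\<close> gives
  \<open>E exp (z * (h \<bullet> y)) = J z / J 0\<close> with \<open>J z = \<integral>t. \<Prod>j. exp (- \<zeta> j) / (1 - \<zeta> j)\<close> and
  \<open>\<zeta> = z * h + \<i> * (Ahat\<^sup>T t)\<close>. As \<open>\<Sum>j. (\<zeta> j)^2 = z^2 - |t|^2\<close> and \<open>max |\<zeta> j|\<close> tends to \<open>0\<close>, the integrand tends
  to \<open>exp ((z^2 - |t|^2) / 2)\<close>; it is dominated because \<open>\<Prod>j. 1 + x j \<ge> (1 + (\<Sum>j. x j) / N)^N\<close> as soon as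
  every \<open>x j\<close> is at most \<open>(\<Sum>j. x j) / N\<close>. Hence \<open>E exp (z * S_n / \<sigma>)\<close> tends to \<open>exp (z^2 / 2)\<close> for every
  complex \<open>z\<close>: imaginary \<open>z\<close> give the limit law by Levy continuity, and real \<open>z\<close> show that the
  means of \<open>S_n / \<sigma>\<close> vanish in the limit, so that the two centerings are equivalent.\<close>

section \<open>Orthonormal systems\<close>

text \<open>The plane \<open>A x = b\<close> is a null set for \<open>P_{n,w}\<close>, so
  conditioning means evaluating a fibre integral over the single point \<open>0\<close> of
  \<open>R^m\<close>. Its integrand jumps at the boundary of the orthant, which is why Fourier
  inversion passes through a Gaussian smoothing. The linear change of variables between parameters
  and \<open>R^n\<close> has a Jacobian that is never computed: translation invariance gives an
  unspecified positive constant, the same for all \<open>h\<close> and \<open>z\<close>, and it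
  cancels in \<open>J z / J 0\<close>. The domination must be uniform in \<open>n\<close> on the
  fixed space \<open>R^m\<close>. A product of \<open>m\<close> Cauchy-type factors is integrable
  there, and since each coordinate contributes a square root to the modulus, the product inequality
  is taken with \<open>N = 2 * m\<close>. Finite positive volume of the polytope is read off from
  \<open>J 0\<close> being nonzero, so the probabilistic facts hold for large \<open>n\<close>,
  which is enough for weak convergence. Since \<open>wvec\<close>, \<open>inv_sqrt\<close> and
  \<open>proj\<close> are definite descriptions, existence and uniqueness of each object come before
  any use of it.\<close>

lemma homogeneous_system_nontrivial:
  fixes a :: "'i \<Rightarrow> 'j \<Rightarrow> real"
  assumes "finite I" "finite J" "card I < card J"
  shows "\<exists>x. (\<exists>j\<in>J. x j \<noteq> 0) \<and> (\<forall>i\<in>I. (\<Sum>j\<in>J. a i j * x j) = 0)"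
  using assms
proof (induction I arbitrary: J a rule: finite_induct)
  case empty
  then have "J \<noteq> {}" by auto
  then show ?case by (intro exI[of _ "\<lambda>_. 1"]) auto
next
  case (insert i I)
  show ?case
  proof (cases "\<forall>j\<in>J. a i j = 0")
    case True
    have "card I < card J" using insert by simp
    from insert.IH[OF insert.prems(1) this, of a] obtain x where
      "\<exists>j\<in>J. x j \<noteq> 0" "\<forall>i\<in>I. (\<Sum>j\<in>J. a i j * x j) = 0" by blast
    with True show ?thesis by (intro exI[of _ x]) auto
  next
    case False
    then obtain p where p: "p \<in> J" "a i p \<noteq> 0" by blast
    define J' where "J' = J - {p}"
    have fJ': "finite J'" and JJ: "J = insert p J'" "p \<notin> J'"
      using p insert.prems by (auto simp: J'_def)
    have "card I < card J'" using insert fJ' JJ by simp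
    \<comment> \<open>Gaussian elimination: equation \<open>i\<close> eliminates the unknown
      \<open>p\<close>, leaving one equation and one unknown fewer. The value of \<open>y\<close> at
      \<open>p\<close> below is then dictated by equation \<open>i\<close>.\<close>
    from insert.IH[OF fJ' this, of "\<lambda>i' j. a i' j - a i' p * a i j / a i p"] obtain x where
      x: "\<exists>j\<in>J'. x j \<noteq> 0" "\<forall>i'\<in>I. (\<Sum>j\<in>J'. (a i' j - a i' p * a i j / a i p) * x j) = 0" by blast
    define y where "y = x(p := - (\<Sum>j\<in>J'. a i j * x j) / a i p)"
    have yJ: "(\<Sum>j\<in>J'. c j * y j) = (\<Sum>j\<in>J'. c j * x j)" for c
      using JJ by (intro sum.cong) (auto simp: y_def)
    have s: "(\<Sum>j\<in>J. c j * y j) = (\<Sum>j\<in>J'. c j * x j) - c p * (\<Sum>j\<in>J'. a i j * x j) / a i p" for c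
      using JJ fJ' yJ[of c] by (simp add: y_def)
    have "(\<Sum>j\<in>J. a i' j * y j) = 0" if "i' \<in> insert i I" for i'
    proof (cases "i' = i")
      case True
      then show ?thesis using s[of "a i"] p by simp
    next
      case False
      with that have "i' \<in> I" by simp
      with x(2) have "(\<Sum>j\<in>J'. a i' j * x j) - (\<Sum>j\<in>J'. a i' p * a i j / a i p * x j) = 0"
        by (simp add: left_diff_distrib sum_subtractf)
      then show ?thesis unfolding s[of "a i'"]
        by (simp add: sum_distrib_left sum_divide_distrib mult.assoc)
    qed
    moreover have "\<exists>j\<in>J. y j \<noteq> 0" using x(1) JJ by (auto simp: y_def)
    ultimately show ?thesis by blast
  qed
qed

definition orthonormal :: "nat \<Rightarrow> nat \<Rightarrow> (nat \<Rightarrow> nat \<Rightarrow> real) \<Rightarrow> bool" where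
  "orthonormal r d V \<longleftrightarrow> (\<forall>i<r. \<forall>k<r. (\<Sum>j<d. V i j * V k j) = (if i = k then 1 else 0))"

lemma sum_lessThan_split:
  fixes f :: "nat \<Rightarrow> 'a::comm_monoid_add"
  assumes "m \<le> n"
  shows "sum f {..<n} = sum f {..<m} + (\<Sum>k<n-m. f (m + k))"
proof -
  have "sum f {..<n} = sum f {0..<m} + sum f {m..<n}"
    using assms by (simp add: sum.atLeastLessThan_concat lessThan_atLeast0)
  also have "sum f {m..<n} = (\<Sum>k<n-m. f (m + k))"
    using sum.shift_bounds_nat_ivl[of f 0 m "n - m"] assms
    by (simp add: lessThan_atLeast0 add.commute)
  finally show ?thesis by (simp add: lessThan_atLeast0)
qed

lemma sum_bilinear_swap:
  fixes Q :: "nat \<Rightarrow> nat \<Rightarrow> real"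
  shows "(\<Sum>j<n. (\<Sum>i<m. c i * Q i j) * y j) = (\<Sum>i<m. c i * (\<Sum>j<n. Q i j * y j))"
  unfolding sum_distrib_right sum_distrib_left by (subst sum.swap) (simp add: mult.assoc)

lemma sum_if_eq_lessThan:
  fixes x :: "nat \<Rightarrow> real"
  assumes "i < r"
  shows "(\<Sum>k<r. x k * (if i = k then 1 else 0)) = x i" "(\<Sum>k<r. (if i = k then 1 else 0) * x k) = x i"
    "(\<Sum>k<r. x k * (if k = i then 1 else 0)) = x i" "(\<Sum>k<r. (if k = i then 1 else 0) * x k) = x i"
  using assms by (auto simp: if_distrib if_distribR sum.delta sum.delta' cong: if_cong)

lemma orthonormal_Parseval:
  assumes "orthonormal r d V"
  shows "(\<Sum>j<d. (\<Sum>i<r. c i * V i j) * (\<Sum>i<r. e i * V i j)) = (\<Sum>i<r. c i * e i)"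
proof -
  have "(\<Sum>j<d. (\<Sum>i<r. c i * V i j) * (\<Sum>i<r. e i * V i j)) =
      (\<Sum>j<d. \<Sum>i<r. \<Sum>k<r. c i * e k * (V i j * V k j))"
    by (simp add: sum_product algebra_simps)
  also have "\<dots> = (\<Sum>i<r. \<Sum>k<r. c i * e k * (\<Sum>j<d. V i j * V k j))"
    by (subst sum.swap, rule sum.cong[OF refl], subst sum.swap, simp add: sum_distrib_left)
  also have "\<dots> = (\<Sum>i<r. \<Sum>k<r. c i * e k * (if i = k then 1 else 0))"
    using assms by (intro sum.cong) (auto simp: orthonormal_def)
  also have "\<dots> = (\<Sum>i<r. c i * e i)"
    by (intro sum.cong) (auto simp: sum_if_eq_lessThan)
  finally show ?thesis .
qed

lemma orthonormal_coeff:
  assumes "orthonormal r d V" "k < r"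
  shows "(\<Sum>j<d. V k j * (\<Sum>i<r. c i * V i j)) = c k"
proof -
  have "(\<Sum>j<d. (\<Sum>i<r. (if i = k then 1 else 0) * V i j) * (\<Sum>i<r. c i * V i j)) = c k"
    unfolding orthonormal_Parseval[OF assms(1)] using assms by (simp add: sum_if_eq_lessThan)
  then show ?thesis using assms by (simp add: sum_if_eq_lessThan)
qed

text \<open>Pythagoras for the projection to the span of the rows. Nonnegativity of the left side is
  Bessel's inequality, and the case of \<open>Ahat\<close> is the norm identity in the
  theorem.\<close>

lemma orthonormal_residual:
  assumes "orthonormal r d V"
  shows "(\<Sum>j<d. (x j - (\<Sum>i<r. (\<Sum>k<d. V i k * x k) * V i j))\<^sup>2) =
    (\<Sum>j<d. (x j)\<^sup>2) - (\<Sum>i<r. (\<Sum>k<d. V i k * x k)\<^sup>2)"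
proof -
  let ?c = "\<lambda>i. \<Sum>k<d. V i k * x k"
  let ?y = "\<lambda>j. \<Sum>i<r. ?c i * V i j"
  have 1: "(\<Sum>j<d. (?y j)\<^sup>2) = (\<Sum>i<r. (?c i)\<^sup>2)"
    using orthonormal_Parseval[OF assms, of ?c ?c] by (simp add: power2_eq_square)
  have "(\<Sum>j<d. x j * ?y j) = (\<Sum>j<d. \<Sum>i<r. ?c i * (V i j * x j))"
    by (simp add: sum_distrib_left algebra_simps)
  also have "\<dots> = (\<Sum>i<r. ?c i * ?c i)"
    by (subst sum.swap) (simp add: sum_distrib_left[symmetric])
  finally have 2: "(\<Sum>j<d. x j * ?y j) = (\<Sum>i<r. (?c i)\<^sup>2)" by (simp add: power2_eq_square)
  have "(\<Sum>j<d. (x j - ?y j)\<^sup>2) = (\<Sum>j<d. (x j)\<^sup>2) - 2 * (\<Sum>j<d. x j * ?y j) + (\<Sum>j<d. (?y j)\<^sup>2)"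
    by (simp add: power2_diff sum.distrib sum_subtractf sum_distrib_left algebra_simps)
  then show ?thesis unfolding 1 2 by simp
qed

text \<open>The squared lengths of the rows and of the columns have the same sum \<open>d\<close>, and by Bessel no
  column is longer than \<open>1\<close>; hence each basis vector has zero residual.\<close>
lemma orthonormal_complete:
  assumes V: "orthonormal d d V" and jk: "j < d" "k < d"
  shows "(\<Sum>i<d. V i j * V i k) = (if j = k then 1 else 0)"
proof -
  let ?res = "\<lambda>k. \<Sum>j<d. ((if j = k then 1 else 0) - (\<Sum>i<d. V i k * V i j))\<^sup>2"
  have coef: "(\<Sum>l<d. V i l * (if l = k then 1 else 0)) = V i k" if "k < d" for i k
    using that by (simp add: sum_if_eq_lessThan)
  have res: "?res k = 1 - (\<Sum>i<d. (V i k)\<^sup>2)" if k: "k < d" for k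
  proof -
    have "(\<Sum>j<d. (if j = k then 1 else 0::real)\<^sup>2) = (\<Sum>j<d. if j = k then 1 else 0)"
      by (intro sum.cong) auto
    also have "\<dots> = 1" using k by simp
    finally have "(\<Sum>j<d. (if j = k then 1 else 0::real)\<^sup>2) = 1" .
    with orthonormal_residual[OF V, of "\<lambda>j. if j = k then 1 else 0"] show ?thesis
      unfolding coef[OF k] by simp
  qed
  have "(\<Sum>k<d. \<Sum>i<d. (V i k)\<^sup>2) = (\<Sum>i<d. \<Sum>k<d. V i k * V i k)"
    by (subst sum.swap) (simp add: power2_eq_square)
  also have "\<dots> = (\<Sum>i<d. 1)" using V by (intro sum.cong) (auto simp: orthonormal_def)
  finally have "(\<Sum>k<d. ?res k) = 0" by (simp add: res sum_subtractf)
  then have "?res k = 0"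
    using jk by (subst (asm) sum_nonneg_eq_0_iff) (auto intro: sum_nonneg)
  then have "(if j = k then 1 else 0) - (\<Sum>i<d. V i k * V i j) = 0"
    using jk by (subst (asm) sum_nonneg_eq_0_iff) auto
  then show ?thesis by (simp add: mult.commute)
qed

lemma orthonormal_expand:
  assumes V: "orthonormal d d V" and j: "j < d"
  shows "x j = (\<Sum>i<d. (\<Sum>k<d. V i k * x k) * V i j)"
proof -
  have "(\<Sum>i<d. (\<Sum>k<d. V i k * x k) * V i j) = (\<Sum>k<d. x k * (\<Sum>i<d. V i k * V i j))"
    unfolding sum_distrib_right sum_distrib_left by (subst sum.swap) (simp add: algebra_simps)
  also have "\<dots> = (\<Sum>k<d. x k * (if k = j then 1 else 0))"
    using orthonormal_complete[OF V] j by (intro sum.cong) auto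
  also have "\<dots> = x j" using j by (simp add: sum_if_eq_lessThan)
  finally show ?thesis by simp
qed

lemma orthonormal_Suc:
  assumes "orthonormal r d V" "\<forall>i<r. (\<Sum>j<d. V i j * x j) = 0" "(\<Sum>j<d. (x j)\<^sup>2) = 1"
  shows "orthonormal (Suc r) d (V(r := x))"
  using assms unfolding orthonormal_def
  by (auto simp: less_Suc_eq power2_eq_square mult.commute)

lemma unit_multiple:
  fixes x :: "nat \<Rightarrow> real"
  assumes "\<exists>j<d. x j \<noteq> 0"
  obtains c where "(\<Sum>j<d. (c * x j)\<^sup>2) = 1"
proof -
  let ?s = "\<Sum>j<d. (x j)\<^sup>2"
  have "?s \<noteq> 0" using assms by (subst sum_nonneg_eq_0_iff) auto
  moreover have "?s \<ge> 0" by (intro sum_nonneg) auto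
  ultimately have "?s > 0" by simp
  then have "(\<Sum>j<d. ((1 / sqrt ?s) * x j)\<^sup>2) = 1"
    by (simp add: power_mult_distrib power_divide sum_divide_distrib[symmetric])
  then show ?thesis by (rule that)
qed

text \<open>The next vector solves the \<open>m\<close> equations of \<open>A\<close> together with
  orthogonality to the \<open>r\<close> vectors already found: \<open>m + r\<close> equations in
  more than \<open>m + r\<close> unknowns.\<close>

lemma orthonormal_kernel_exists:
  assumes "m + r \<le> n"
  shows "\<exists>V. orthonormal r n V \<and> (\<forall>k<r. \<forall>l<m. (\<Sum>j<n. A l j * V k j) = 0)"
  using assms
proof (induction r)
  case 0
  show ?case by (auto simp: orthonormal_def)
next
  case (Suc r)
  then obtain V where V: "orthonormal r n V" "\<forall>k<r. \<forall>l<m. (\<Sum>j<n. A l j * V k j) = 0" by auto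
  define a where "a i = (if i < m then A i else V (i - m))" for i
  have "card {..<m+r} < card {..<n}" using Suc.prems by simp
  from homogeneous_system_nontrivial[OF _ _ this, of a] obtain x where
    x: "\<exists>j<n. x j \<noteq> 0" "\<forall>i<m+r. (\<Sum>j<n. a i j * x j) = 0" by auto
  obtain c where c: "(\<Sum>j<n. (c * x j)\<^sup>2) = 1" using unit_multiple[OF x(1)] .
  have Ax: "(\<Sum>j<n. A l j * (c * x j)) = 0" if "l < m" for l
    using x(2)[rule_format, of l] that
    by (simp add: a_def sum_distrib_left[symmetric] mult.left_commute)
  have Vx: "(\<Sum>j<n. V k j * (c * x j)) = 0" if "k < r" for k
    using x(2)[rule_format, of "m+k"] that
    by (simp add: a_def sum_distrib_left[symmetric] mult.left_commute)
  show ?case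
    using orthonormal_Suc[OF V(1), of "\<lambda>j. c * x j", OF _ c] Ax Vx V(2)
    by (intro exI[of _ "V(r := \<lambda>j. c * x j)"] conjI) (blast, auto simp: less_Suc_eq)
qed

lemma orthonormal_append:
  assumes "orthonormal m n Q" "orthonormal r n V" "\<forall>k<r. \<forall>l<m. (\<Sum>j<n. Q l j * V k j) = 0"
  shows "orthonormal (m + r) n (\<lambda>i. if i < m then Q i else V (i - m))"
  unfolding orthonormal_def
proof (intro allI impI)
  fix i k assume ik: "i < m + r" "k < m + r"
  consider "i < m" "k < m" | "i < m" "k \<ge> m" | "i \<ge> m" "k < m" | "i \<ge> m" "k \<ge> m" by linarith
  then show "(\<Sum>j<n. (if i < m then Q i else V (i - m)) j * (if k < m then Q k else V (k - m)) j) =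
      (if i = k then 1 else 0)"
  proof cases
    case 1 then show ?thesis using assms(1) by (simp add: orthonormal_def)
  next
    case 2 then show ?thesis using assms(3)[rule_format, of "k-m" i] ik by simp
  next
    case 3 then show ?thesis using assms(3)[rule_format, of "i-m" k] ik by (simp add: mult.commute)
  next
    case 4
    then have "(i - m = k - m) = (i = k)" "i - m < r" "k - m < r" using ik by auto
    with 4 assms(2) show ?thesis by (simp add: orthonormal_def)
  qed
qed

lemma orthonormal_split_expand:
  assumes "orthonormal m n Q" "orthonormal (n - m) n V" "\<forall>k<n-m. \<forall>l<m. (\<Sum>j<n. Q l j * V k j) = 0"
    and "m \<le> n" "j < n"
  shows "x j = (\<Sum>i<m. (\<Sum>k<n. Q i k * x k) * Q i j) + (\<Sum>i<n-m. (\<Sum>k<n. V i k * x k) * V i j)"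
proof -
  let ?W = "\<lambda>i. if i < m then Q i else V (i - m)"
  have "orthonormal n n ?W" using orthonormal_append[OF assms(1-3)] assms(4) by simp
  from orthonormal_expand[OF this assms(5), of x] show ?thesis
    unfolding sum_lessThan_split[OF assms(4)] by simp
qed

section \<open>Symmetric matrices\<close>

definition quad :: "nat \<Rightarrow> (nat \<Rightarrow> nat \<Rightarrow> real) \<Rightarrow> (nat \<Rightarrow> real) \<Rightarrow> (nat \<Rightarrow> real) \<Rightarrow> real" where
  "quad m G x y = (\<Sum>i<m. \<Sum>k<m. x i * G i k * y k)"

lemma quad_alt: "quad m G x y = (\<Sum>i<m. x i * (\<Sum>k<m. G i k * y k))"
  by (simp add: quad_def sum_distrib_left mult.assoc)

lemma quad_sym:
  assumes "\<forall>i<m. \<forall>k<m. G i k = G k i"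
  shows "quad m G x y = quad m G y x"
  unfolding quad_def using assms
  by (subst sum.swap) (auto intro!: sum.cong simp: mult_ac)

lemma quad_add: "quad m G (\<lambda>j. x j + s * y j) (\<lambda>j. x j + s * y j) =
  quad m G x x + s * (quad m G x y + quad m G y x) + s\<^sup>2 * quad m G y y"
  by (simp add: quad_def sum.distrib[symmetric] sum_distrib_left algebra_simps power2_eq_square)

text \<open>The first-order condition at a maximum in algebraic form. The test value
  \<open>s = a / (|b| + 1)\<close> turns \<open>a * s\<close> into \<open>(|b| + 1) * s^2\<close>,
  which exceeds \<open>b * s^2\<close> unless \<open>a = 0\<close>.\<close>

lemma linear_coefficient_zero:
  fixes a b :: real
  assumes "\<And>s. a * s \<le> b * s\<^sup>2"
  shows "a = 0"
proof (rule ccontr)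
  assume "a \<noteq> 0"
  define s where "s = a / (\<bar>b\<bar> + 1)"
  have "a * s \<le> b * s\<^sup>2" by fact
  also have "\<dots> \<le> \<bar>b\<bar> * s\<^sup>2" by (intro mult_right_mono) auto
  also have "\<dots> < (\<bar>b\<bar> + 1) * s\<^sup>2" using \<open>a \<noteq> 0\<close> by (intro mult_strict_right_mono) (auto simp: s_def)
  also have "\<dots> = a * s" by (simp add: s_def power2_eq_square)
  finally show False by simp
qed

lemma compact_unit_sphere_PiE:
  fixes m r :: nat
  shows "compact {x \<in> PiE {..<m} (\<lambda>_. UNIV :: real set). (\<Sum>j<m. (x j)\<^sup>2) = 1 \<and>
     (\<forall>i<r. (\<Sum>j<m. v i j * x j) = 0)}" (is "compact ?S")
proof -
  \<comment> \<open>Extensionality pins the coordinates outside \<open>{..<m}\<close> to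
    \<open>undefined\<close>, so the box is a product of compact sets over all of \<open>nat\<close>
    and Tychonoff applies.\<close>
  let ?B = "PiE UNIV (\<lambda>j. if j < m then {-1..1::real} else {undefined})"
  have "compactin (product_topology (\<lambda>_. euclidean) UNIV) ?B"
    by (subst compactin_PiE) (auto simp: compactin_euclidean_iff)
  then have B: "compact ?B" by (simp add: euclidean_product_topology)
  have "?S = ?B \<inter> ({x. (\<Sum>j<m. (x j)\<^sup>2) = 1} \<inter> (\<Inter>i\<in>{..<r}. {x. (\<Sum>j<m. v i j * x j) = 0}))" (is "_ = _ \<inter> ?C")
  proof (intro set_eqI iffI)
    fix x assume x: "x \<in> ?S"
    have "\<bar>x j\<bar> \<le> 1" if "j < m" for j
    proof -
      have "(x j)\<^sup>2 \<le> (\<Sum>j<m. (x j)\<^sup>2)" using that by (auto intro!: member_le_sum)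
      then show ?thesis using x by (simp add: abs_square_le_1)
    qed
    with x show "x \<in> ?B \<inter> ?C" by (auto simp: PiE_iff abs_le_iff extensional_def)
  qed (auto simp: PiE_iff extensional_def split: if_splits)
  moreover have "closed ?C"
    by (intro closed_Int closed_INT ballI closed_Collect_eq continuous_intros continuous_on_product_coordinates)
  ultimately show ?thesis using compact_Int_closed[OF B] by simp
qed

text \<open>A maximiser of the quadratic form on the unit sphere orthogonal to the eigenvectors found so
  far is again an eigenvector.\<close>
lemma orthonormal_eigenvectors:
  assumes sym: "\<forall>i<m. \<forall>k<m. G i k = G k i" and "r \<le> m"
  shows "\<exists>v \<mu>. orthonormal r m v \<and> (\<forall>i<r. \<forall>j<m. (\<Sum>k<m. G j k * v i k) = \<mu> i * v i j)"
  using assms(2)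
proof (induction r)
  case 0
  show ?case by (auto simp: orthonormal_def)
next
  case (Suc r)
  then obtain v \<mu> where v: "orthonormal r m v" "\<forall>i<r. \<forall>j<m. (\<Sum>k<m. G j k * v i k) = \<mu> i * v i j" by auto
  let ?S = "{x \<in> PiE {..<m} (\<lambda>_. UNIV :: real set). (\<Sum>j<m. (x j)\<^sup>2) = 1 \<and>
     (\<forall>i<r. (\<Sum>j<m. v i j * x j) = 0)}"
  have ne: "?S \<noteq> {}"
  proof -
    have "card {..<r} < card {..<m}" using Suc.prems by simp
    from homogeneous_system_nontrivial[OF _ _ this, of v] obtain x where
      x: "\<exists>j<m. x j \<noteq> 0" "\<forall>i<r. (\<Sum>j<m. v i j * x j) = 0" by auto
    obtain c where c: "(\<Sum>j<m. (c * x j)\<^sup>2) = 1" using unit_multiple[OF x(1)] .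
    have "(\<Sum>j<m. v k j * (c * x j)) = 0" if "k < r" for k
      using x(2)[rule_format, of k] that
      by (simp add: sum_distrib_left[symmetric] mult.left_commute)
    with c have "restrict (\<lambda>j. c * x j) {..<m} \<in> ?S" by auto
    then show ?thesis by blast
  qed
  have "continuous_on ?S (\<lambda>x. quad m G x x)"
    unfolding quad_def
    by (rule continuous_on_subset[of UNIV])
       (auto intro!: continuous_intros continuous_on_product_coordinates)
  from continuous_attains_sup[OF compact_unit_sphere_PiE ne this] obtain x where
    x: "x \<in> ?S" and max: "\<And>y. y \<in> ?S \<Longrightarrow> quad m G y y \<le> quad m G x x" by blast
  define M where "M = quad m G x x"
  \<comment> \<open>Homogeneity carries the maximality from the sphere to the whole orthogonal
    complement of the \<open>v i\<close>.\<close>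
  have scale: "quad m G y y \<le> M * (\<Sum>j<m. (y j)\<^sup>2)" if y: "\<forall>i<r. (\<Sum>j<m. v i j * y j) = 0" for y
  proof (cases "\<exists>j<m. y j \<noteq> 0")
    case False
    then show ?thesis by (auto simp: quad_def)
  next
    case True
    then obtain c where c: "(\<Sum>j<m. (c * y j)\<^sup>2) = 1" using unit_multiple by blast
    have "(\<Sum>j<m. v k j * (c * y j)) = 0" if "k < r" for k
      using y[rule_format, of k] that
      by (simp add: sum_distrib_left[symmetric] mult.left_commute)
    with c have "restrict (\<lambda>j. c * y j) {..<m} \<in> ?S" by auto
    from max[OF this] have "c\<^sup>2 * quad m G y y \<le> M"
      by (simp add: quad_def M_def sum_distrib_left power2_eq_square algebra_simps)
    also have "M = M * (c\<^sup>2 * (\<Sum>j<m. (y j)\<^sup>2))" using c by (simp add: power_mult_distrib sum_distrib_left)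
    finally have "c\<^sup>2 * quad m G y y \<le> c\<^sup>2 * (M * (\<Sum>j<m. (y j)\<^sup>2))" by (simp add: algebra_simps)
    moreover have "c \<noteq> 0" using c by auto
    ultimately show ?thesis by simp
  qed
  have x1: "(\<Sum>j<m. (x j)\<^sup>2) = 1" and xv: "\<forall>i<r. (\<Sum>j<m. v i j * x j) = 0" using x by auto
  have orth: "quad m G x y = 0" if y: "\<forall>i<r. (\<Sum>j<m. v i j * y j) = 0" and xy: "(\<Sum>j<m. x j * y j) = 0" for y
  proof -
    \<comment> \<open>Maximality along the line \<open>x + s * y\<close>: the constant terms cancel
      and a linear term in \<open>s\<close> remains below a quadratic one.\<close>
    have "(2 * quad m G x y) * s \<le> (M * (\<Sum>j<m. (y j)\<^sup>2) - quad m G y y) * s\<^sup>2" for s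
    proof -
      have "\<forall>i<r. (\<Sum>j<m. v i j * (x j + s * y j)) = 0"
        using xv y by (simp add: distrib_left sum.distrib mult.left_commute[of _ s] sum_distrib_left[symmetric])
      from scale[OF this] have "M + s * (2 * quad m G x y) + s\<^sup>2 * quad m G y y
         \<le> M * (\<Sum>j<m. (x j + s * y j)\<^sup>2)"
        unfolding quad_add quad_sym[OF sym, of y x] M_def by (simp add: algebra_simps)
      also have "(\<Sum>j<m. (x j + s * y j)\<^sup>2) = (\<Sum>j<m. (x j)\<^sup>2) + 2 * s * (\<Sum>j<m. x j * y j) + s\<^sup>2 * (\<Sum>j<m. (y j)\<^sup>2)"
        by (simp add: power2_sum sum.distrib sum_distrib_left power_mult_distrib algebra_simps)
      finally show ?thesis using x1 xy by (simp add: algebra_simps)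
    qed
    then show ?thesis using linear_coefficient_zero by fastforce
  qed
  define g where "g i = (\<Sum>k<m. G i k * x k)" for i
  \<comment> \<open>\<open>y\<close> is \<open>G x - M x\<close>. It is orthogonal to
    \<open>x\<close> by the choice of \<open>M\<close> and to each \<open>v i\<close> because these
    are eigenvectors, so \<open>orth\<close> applies to it; testing \<open>y\<close> against itself
    then gives \<open>y = 0\<close>.\<close>
  define y where "y i = g i - M * x i" for i
  have qx: "quad m G z x = (\<Sum>i<m. z i * g i)" for z unfolding quad_alt g_def ..
  have xy: "(\<Sum>j<m. x j * y j) = 0"
  proof -
    have "(\<Sum>j<m. x j * y j) = quad m G x x - M * (\<Sum>j<m. (x j)\<^sup>2)"
      unfolding qx y_def by (simp add: right_diff_distrib sum_subtractf sum_distrib_left power2_eq_square algebra_simps)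
    then show ?thesis using x1 by (simp add: M_def)
  qed
  have vy: "(\<Sum>j<m. v i j * y j) = 0" if i: "i < r" for i
  proof -
    have "(\<Sum>j<m. v i j * y j) = quad m G (v i) x - M * (\<Sum>j<m. v i j * x j)"
      unfolding qx y_def by (simp add: right_diff_distrib sum_subtractf sum_distrib_left algebra_simps)
    also have "\<dots> = quad m G x (v i)" using xv i quad_sym[OF sym] by simp
    also have "\<dots> = (\<Sum>j<m. x j * (\<mu> i * v i j))" unfolding quad_alt using v(2) i by simp
    also have "\<dots> = \<mu> i * (\<Sum>j<m. v i j * x j)" by (simp add: sum_distrib_left algebra_simps)
    finally show ?thesis using xv i by simp
  qed
  have "(\<Sum>j<m. (y j)\<^sup>2) = (\<Sum>j<m. y j * g j) - M * (\<Sum>j<m. x j * y j)"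
    by (simp add: power2_eq_square sum_subtractf[symmetric] sum_distrib_left y_def algebra_simps)
  also have "(\<Sum>j<m. y j * g j) = 0" using orth[of y] vy xy quad_sym[OF sym, of y x] by (simp add: qx)
  finally have "(\<Sum>j<m. (y j)\<^sup>2) = 0" using xy by simp
  then have "\<forall>j<m. y j = 0" by (subst (asm) sum_nonneg_eq_0_iff) auto
  then have "\<forall>j<m. (\<Sum>k<m. G j k * x k) = M * x j" by (auto simp: y_def g_def)
  with orthonormal_Suc[OF v(1) xv x1] v(2) show ?case
    by (intro exI[of _ "v(r := x)"] exI[of _ "\<mu>(r := M)"] conjI) (assumption, auto simp: less_Suc_eq)
qed

text \<open>The predicate under the definite description \<open>inv_sqrt\<close>. Entries outside
  the \<open>m\<close> by \<open>m\<close> block are forced to \<open>0\<close>, so that uniqueness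
  is an equality of functions.\<close>

definition is_inv_sqrt :: "nat \<Rightarrow> (nat \<Rightarrow> nat \<Rightarrow> real) \<Rightarrow> (nat \<Rightarrow> nat \<Rightarrow> real) \<Rightarrow> bool" where
  "is_inv_sqrt m G R \<longleftrightarrow> (\<forall>i k. (m \<le> i \<or> m \<le> k) \<longrightarrow> R i k = 0) \<and>
      (\<forall>i<m. \<forall>k<m. R i k = R k i) \<and>
      (\<forall>c::nat \<Rightarrow> real. (\<exists>i<m. c i \<noteq> 0) \<longrightarrow> 0 < (\<Sum>i<m. \<Sum>k<m. c i * R i k * c k)) \<and>
      (\<forall>i<m. \<forall>k<m. (\<Sum>p<m. \<Sum>q<m. R i p * R p q * G q k) = (if i = k then 1 else 0))"

lemma is_inv_sqrt_sym: "is_inv_sqrt m G R \<Longrightarrow> i < m \<Longrightarrow> k < m \<Longrightarrow> R i k = R k i"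
  unfolding is_inv_sqrt_def by blast

lemma is_inv_sqrt_pd: "is_inv_sqrt m G R \<Longrightarrow> \<exists>i<m. c i \<noteq> 0 \<Longrightarrow> 0 < quad m R c c"
  unfolding is_inv_sqrt_def quad_def by blast

text \<open>If \<open>R\<close> and \<open>S\<close> are positive definite with equal squares and \<open>D = R - S\<close>, then
  \<open>R D + D S = 0\<close>; taking the trace against \<open>D\<close> leaves a sum of nonnegative quadratic forms.\<close>
lemma positive_definite_sqrt_unique:
  assumes R: "\<And>c. (\<exists>i<m. c i \<noteq> 0) \<Longrightarrow> 0 < quad m R c c"
    and S: "\<And>c. (\<exists>i<m. c i \<noteq> 0) \<Longrightarrow> 0 < quad m S c c"
    and S_sym: "\<forall>i<m. \<forall>k<m. S i k = S k i"
    and eq: "\<And>i k. i < m \<Longrightarrow> k < m \<Longrightarrow> (\<Sum>p<m. R i p * R p k) = (\<Sum>p<m. S i p * S p k)"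
    and ik: "i < m" "k < m"
  shows "R i k = S i k"
proof (rule ccontr)
  assume neq: "R i k \<noteq> S i k"
  define D where "D i k = R i k - S i k" for i k
  have nonneg: "0 \<le> quad m R c c" "0 \<le> quad m S c c" for c
    using R[of c] S[of c] by (cases "\<exists>i<m. c i \<noteq> 0"; simp add: quad_def)+
  have z: "(\<Sum>p<m. R i p * D p k) + (\<Sum>p<m. D i p * S p k) = 0" if "i < m" "k < m" for i k
    using eq[OF that] by (simp add: D_def algebra_simps sum.distrib sum_subtractf)
  have "0 = (\<Sum>i<m. \<Sum>k<m. D i k * ((\<Sum>p<m. R i p * D p k) + (\<Sum>p<m. D i p * S p k)))"
    using z by simp
  also have "\<dots> = (\<Sum>i<m. \<Sum>k<m. D i k * (\<Sum>p<m. R i p * D p k)) + (\<Sum>i<m. \<Sum>k<m. D i k * (\<Sum>p<m. D i p * S p k))"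
    by (simp add: distrib_left sum.distrib)
  also have "(\<Sum>i<m. \<Sum>k<m. D i k * (\<Sum>p<m. R i p * D p k)) = (\<Sum>k<m. quad m R (\<lambda>i. D i k) (\<lambda>i. D i k))"
    unfolding quad_alt by (rule sum.swap)
  also have "(\<Sum>i<m. \<Sum>k<m. D i k * (\<Sum>p<m. D i p * S p k)) = (\<Sum>i<m. quad m S (D i) (D i))"
  proof -
    have "(\<Sum>p<m. D i p * S p k) = (\<Sum>p<m. S k p * D i p)" if "k < m" for i k
      using S_sym that by (intro sum.cong) (auto simp: mult.commute)
    then show ?thesis unfolding quad_alt by simp
  qed
  finally have "(\<Sum>k<m. quad m R (\<lambda>i. D i k) (\<lambda>i. D i k)) \<le> 0"
    using sum_nonneg[of "{..<m}" "\<lambda>i. quad m S (D i) (D i)"] nonneg by simp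
  moreover have "quad m R (\<lambda>i. D i k) (\<lambda>i. D i k) \<le> (\<Sum>k<m. quad m R (\<lambda>i. D i k) (\<lambda>i. D i k))"
    using ik nonneg by (auto intro!: member_le_sum)
  moreover have "0 < quad m R (\<lambda>i. D i k) (\<lambda>i. D i k)"
    using R[of "\<lambda>i. D i k"] neq ik by (auto simp: D_def)
  ultimately show False by simp
qed

lemma inv_sqrt_exists:
  assumes sym: "\<forall>i<m. \<forall>k<m. G i k = G k i"
    and pd: "\<And>c. (\<exists>i<m. c i \<noteq> 0) \<Longrightarrow> 0 < quad m G c c"
  shows "\<exists>R. is_inv_sqrt m G R \<and> (\<forall>i<m. \<forall>k<m. (\<Sum>p<m. R i p * (\<Sum>q<m. G p q * R q k)) = (if i = k then 1 else 0))
     \<and> (\<forall>S. is_inv_sqrt m G S \<longrightarrow> S = R)"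
proof -
  obtain v \<mu> where v: "orthonormal m m v" and ev: "\<forall>i<m. \<forall>j<m. (\<Sum>k<m. G j k * v i k) = \<mu> i * v i j"
    using orthonormal_eigenvectors[OF sym order_refl] by blast
  \<comment> \<open>Functional calculus of \<open>G\<close>: \<open>spec f\<close> has the
    eigenvectors \<open>v\<close> with eigenvalues \<open>f\<close>. Thus \<open>G\<close> is
    \<open>spec \<mu>\<close> on the block, and matrix products become products of
    functions.\<close>
  define spec where "spec f i k = (if i < m \<and> k < m then \<Sum>a<m. f a * v a i * v a k else 0)" for f :: "nat \<Rightarrow> real" and i k
  have mult: "(\<Sum>p<m. spec f i p * spec g p k) = spec (\<lambda>a. f a * g a) i k" if "i < m" "k < m" for f g i k
    using orthonormal_Parseval[OF v, of "\<lambda>a. f a * v a i" "\<lambda>b. g b * v b k"] that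
    by (simp add: spec_def mult_ac)
  have one: "spec f i k = (if i = k then 1 else 0)" if "i < m" "k < m" "\<And>a. a < m \<Longrightarrow> f a = 1" for f i k
    using orthonormal_complete[OF v that(1,2)] that by (simp add: spec_def)
  have spec_cong: "spec f = spec g" if "\<And>a. a < m \<Longrightarrow> f a = g a" for f g
    using that by (intro ext) (auto simp: spec_def)
  have G: "G i k = spec \<mu> i k" if "i < m" "k < m" for i k
  proof -
    have "spec \<mu> i k = (\<Sum>a<m. (\<Sum>l<m. G i l * v a l) * v a k)" using that ev by (simp add: spec_def)
    also have "\<dots> = (\<Sum>l<m. G i l * (\<Sum>a<m. v a l * v a k))"
      unfolding sum_distrib_left sum_distrib_right by (subst sum.swap) (simp add: mult.assoc)
    also have "\<dots> = (\<Sum>l<m. G i l * (if l = k then 1 else 0))"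
      using that by (intro sum.cong) (auto simp: orthonormal_complete[OF v])
    finally show ?thesis using that by (simp add: sum_if_eq_lessThan)
  qed
  have \<mu>: "\<mu> a > 0" if a: "a < m" for a
  proof -
    have vv: "(\<Sum>j<m. v a j * v a j) = 1" using v a by (simp add: orthonormal_def)
    then have "\<exists>j<m. v a j \<noteq> 0" by (intro ccontr[of "\<exists>j<m. v a j \<noteq> 0"]) simp
    then have "0 < quad m G (v a) (v a)" by (rule pd)
    also have "\<dots> = \<mu> a * (\<Sum>j<m. v a j * v a j)"
      unfolding quad_alt using ev a by (simp add: sum_distrib_left algebra_simps)
    finally show ?thesis using vv by simp
  qed
  define R where "R = spec (\<lambda>a. 1 / sqrt (\<mu> a))"
  define H where "H = spec (\<lambda>a. 1 / \<mu> a)"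
  have R_outside: "\<forall>i k. (m \<le> i \<or> m \<le> k) \<longrightarrow> R i k = 0" by (auto simp: R_def spec_def)
  have R_sym: "\<forall>i<m. \<forall>k<m. R i k = R k i" by (auto simp: R_def spec_def mult_ac)
  have R_pd: "0 < quad m R c c" if c: "\<exists>i<m. c i \<noteq> 0" for c
  proof -
    have "quad m R c c = (\<Sum>i<m. \<Sum>k<m. \<Sum>a<m. (1 / sqrt (\<mu> a)) * ((v a i * c i) * (v a k * c k)))"
      unfolding quad_def by (intro sum.cong refl) (simp add: R_def spec_def sum_distrib_left sum_distrib_right mult_ac)
    also have "\<dots> = (\<Sum>i<m. \<Sum>a<m. \<Sum>k<m. (1 / sqrt (\<mu> a)) * ((v a i * c i) * (v a k * c k)))"
      by (rule sum.cong[OF refl], rule sum.swap)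
    also have "\<dots> = (\<Sum>a<m. \<Sum>i<m. \<Sum>k<m. (1 / sqrt (\<mu> a)) * ((v a i * c i) * (v a k * c k)))"
      by (rule sum.swap)
    also have "\<dots> = (\<Sum>a<m. (1 / sqrt (\<mu> a)) * (\<Sum>i<m. v a i * c i)\<^sup>2)"
    proof -
      have sq: "(sum x A)\<^sup>2 = (\<Sum>i\<in>A. \<Sum>k\<in>A. x i * x k)" for x :: "nat \<Rightarrow> real" and A
        by (simp add: power2_eq_square sum_product)
      show ?thesis unfolding sq sum_distrib_left ..
    qed
    finally have q: "quad m R c c = (\<Sum>a<m. (1 / sqrt (\<mu> a)) * (\<Sum>i<m. v a i * c i)\<^sup>2)" .
    have "\<exists>a<m. (\<Sum>i<m. v a i * c i) \<noteq> 0"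
    proof (rule ccontr)
      assume "\<not> ?thesis"
      then have "c j = 0" if "j < m" for j using orthonormal_expand[OF v that, of c] by simp
      with c show False by auto
    qed
    then obtain a where a: "a < m" "(\<Sum>i<m. v a i * c i) \<noteq> 0" by blast
    show ?thesis unfolding q
      by (rule sum_pos2[of _ a]) (use a \<mu> in \<open>simp_all add: less_imp_le\<close>)
  qed
  \<comment> \<open>A left inverse of \<open>G\<close> must be \<open>H\<close>. Applied to the
    square of a competitor \<open>S\<close>, this shows that \<open>S\<close> and \<open>R\<close>
    have equal squares.\<close>
  have XG: "X i k = H i k" if X: "\<And>i k. i < m \<Longrightarrow> k < m \<Longrightarrow> (\<Sum>q<m. X i q * G q k) = (if i = k then 1 else 0)"
    and ik: "i < m" "k < m" for X i k
  proof -
    have GH: "(\<Sum>p<m. G q p * H p k) = (if q = k then 1 else 0)" if "q < m" for q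
    proof -
      have "(\<Sum>p<m. G q p * H p k) = (\<Sum>p<m. spec \<mu> q p * H p k)" using G that by simp
      also have "\<dots> = spec (\<lambda>a. \<mu> a * (1 / \<mu> a)) q k" unfolding H_def using mult that ik by simp
      also have "\<dots> = (if q = k then 1 else 0)"
        by (rule one) (use that ik \<mu> in \<open>simp_all add: less_imp_neq[symmetric]\<close>)
      finally show ?thesis .
    qed
    have "X i k = (\<Sum>q<m. X i q * (if q = k then 1 else 0))" using ik by (simp add: sum_if_eq_lessThan)
    also have "\<dots> = (\<Sum>q<m. X i q * (\<Sum>p<m. G q p * H p k))" using GH by simp
    also have "\<dots> = (\<Sum>p<m. (\<Sum>q<m. X i q * G q p) * H p k)"
      unfolding sum_distrib_left sum_distrib_right by (subst sum.swap) (simp add: mult.assoc)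
    also have "\<dots> = H i k" using X ik by (simp add: sum_if_eq_lessThan)
    finally show ?thesis .
  qed
  have RR: "(\<Sum>p<m. R i p * R p k) = H i k" if "i < m" "k < m" for i k
  proof -
    have "(\<Sum>p<m. R i p * R p k) = spec (\<lambda>a. (1 / sqrt (\<mu> a)) * (1 / sqrt (\<mu> a))) i k"
      unfolding R_def using mult that by simp
    also have "spec (\<lambda>a. (1 / sqrt (\<mu> a)) * (1 / sqrt (\<mu> a))) = H" unfolding H_def
      by (intro spec_cong) (use \<mu> in \<open>simp add: less_imp_le\<close>)
    finally show ?thesis .
  qed
  have regroup: "(\<Sum>p<m. \<Sum>q<m. S i p * S p q * G q k) = (\<Sum>q<m. (\<Sum>p<m. S i p * S p q) * G q k)" for S i k
    unfolding sum_distrib_right by (rule sum.swap)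
  have HG: "(\<Sum>q<m. H i q * G q k) = (if i = k then 1 else 0)" if "i < m" "k < m" for i k
  proof -
    have "(\<Sum>q<m. H i q * G q k) = (\<Sum>q<m. H i q * spec \<mu> q k)" using G that by simp
    also have "\<dots> = spec (\<lambda>a. (1 / \<mu> a) * \<mu> a) i k" unfolding H_def using mult that by simp
    also have "\<dots> = (if i = k then 1 else 0)"
      by (rule one) (use that \<mu> in \<open>simp_all add: less_imp_neq[symmetric]\<close>)
    finally show ?thesis .
  qed
  have 1: "is_inv_sqrt m G R"
    unfolding is_inv_sqrt_def
  proof (intro conjI R_outside R_sym allI impI)
    fix c :: "nat \<Rightarrow> real" assume "\<exists>i<m. c i \<noteq> 0"
    then show "0 < (\<Sum>i<m. \<Sum>k<m. c i * R i k * c k)" using R_pd by (simp add: quad_def)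
  next
    fix i k assume "i < m" "k < m"
    then show "(\<Sum>p<m. \<Sum>q<m. R i p * R p q * G q k) = (if i = k then 1 else 0)"
      by (simp add: regroup RR HG)
  qed
  \<comment> \<open>The symmetric form \<open>R G R = 1\<close>, in contrast to
    \<open>R R G = 1\<close> in the definition; it is the form that makes the whitened rows
    orthonormal.\<close>
  have 2: "(\<Sum>p<m. R i p * (\<Sum>q<m. G p q * R q k)) = (if i = k then 1 else 0)" if "i < m" "k < m" for i k
  proof -
    have "(\<Sum>p<m. R i p * (\<Sum>q<m. G p q * R q k)) = (\<Sum>p<m. R i p * (\<Sum>q<m. spec \<mu> p q * R q k))"
      using G that by simp
    also have "\<dots> = spec (\<lambda>a. 1 / sqrt (\<mu> a) * (\<mu> a * (1 / sqrt (\<mu> a)))) i k"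
      unfolding R_def using mult that by simp
    also have "\<dots> = (if i = k then 1 else 0)"
    proof (rule one)
      fix a assume "a < m"
      then have "\<mu> a > 0" using \<mu> by simp
      then show "1 / sqrt (\<mu> a) * (\<mu> a * (1 / sqrt (\<mu> a))) = 1" by (simp add: field_simps)
    qed (use that in auto)
    finally show ?thesis .
  qed
  have 3: "S = R" if S: "is_inv_sqrt m G S" for S
  proof (intro ext)
    fix i k
    have SG: "(\<Sum>q<m. (\<Sum>p<m. S i p * S p q) * G q k) = (if i = k then 1 else 0)" if "i < m" "k < m" for i k
    proof -
      have "\<forall>i<m. \<forall>k<m. (\<Sum>p<m. \<Sum>q<m. S i p * S p q * G q k) = (if i = k then 1 else 0)"
        using S unfolding is_inv_sqrt_def by (elim conjE)
      then show ?thesis using that unfolding regroup by blast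
    qed
    have SS: "(\<Sum>p<m. S i p * S p k) = H i k" if "i < m" "k < m" for i k
      by (rule XG[OF SG]) (use that in auto)
    have S_pd: "0 < quad m S c c" if "\<exists>i<m. c i \<noteq> 0" for c
      using is_inv_sqrt_pd[OF S that] .
    show "S i k = R i k"
    proof (cases "i < m \<and> k < m")
      case True
      then show ?thesis
        using positive_definite_sqrt_unique[OF S_pd R_pd R_sym] SS RR by simp
    next
      case False
      then show ?thesis using R_outside S by (auto simp: is_inv_sqrt_def not_less)
    qed
  qed
  show ?thesis
    by (intro exI[of _ R] conjI allI impI) (fact 1, rule 2, assumption+, rule 3, assumption)
qed

lemma inv_sqrt_props:
  assumes "\<forall>i<m. \<forall>k<m. G i k = G k i" "\<And>c. (\<exists>i<m. c i \<noteq> 0) \<Longrightarrow> 0 < quad m G c c"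
  shows "is_inv_sqrt m G (inv_sqrt m G)"
    "i < m \<Longrightarrow> k < m \<Longrightarrow> (\<Sum>p<m. inv_sqrt m G i p * (\<Sum>q<m. G p q * inv_sqrt m G q k)) = (if i = k then 1 else 0)"
proof -
  obtain R where R: "is_inv_sqrt m G R"
      "\<forall>i<m. \<forall>k<m. (\<Sum>p<m. R i p * (\<Sum>q<m. G p q * R q k)) = (if i = k then 1 else 0)"
    and uniq: "\<forall>S. is_inv_sqrt m G S \<longrightarrow> S = R"
  proof -
    have "\<exists>R. is_inv_sqrt m G R \<and>
        (\<forall>i<m. \<forall>k<m. (\<Sum>p<m. R i p * (\<Sum>q<m. G p q * R q k)) = (if i = k then 1 else 0)) \<and>
        (\<forall>S. is_inv_sqrt m G S \<longrightarrow> S = R)"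
      by (rule inv_sqrt_exists[OF assms(1)]) (rule assms(2))
    then show ?thesis using that by (elim exE conjE)
  qed
  have "inv_sqrt m G = (THE R. is_inv_sqrt m G R)" by (simp add: inv_sqrt_def is_inv_sqrt_def)
  also have "\<dots> = R"
    by (rule the_equality[where P = "is_inv_sqrt m G", OF R(1)]) (rule uniq[rule_format])
  finally have eq: "inv_sqrt m G = R" .
  show "is_inv_sqrt m G (inv_sqrt m G)" unfolding eq by (rule R(1))
  show "i < m \<Longrightarrow> k < m \<Longrightarrow> (\<Sum>p<m. inv_sqrt m G i p * (\<Sum>q<m. G p q * inv_sqrt m G q k)) = (if i = k then 1 else 0)"
    unfolding eq using R(2) by simp
qed

section \<open>Orthonormalizing the rows of a matrix of full row rank\<close>

definition whiten :: "nat \<Rightarrow> nat \<Rightarrow> (nat \<Rightarrow> nat \<Rightarrow> real) \<Rightarrow> nat \<Rightarrow> nat \<Rightarrow> real" where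
  "whiten m n M i j = (\<Sum>k<m. inv_sqrt m (gram n M) i k * M k j)"

lemma quad_gram: "quad m (gram n M) c c = (\<Sum>j<n. (\<Sum>l<m. c l * M l j)\<^sup>2)"
proof -
  have "quad m (gram n M) c c = (\<Sum>i<m. \<Sum>k<m. \<Sum>j<n. c i * M i j * (c k * M k j))"
    by (simp add: quad_def gram_def sum_distrib_left sum_distrib_right mult_ac)
  also have "\<dots> = (\<Sum>i<m. \<Sum>j<n. \<Sum>k<m. c i * M i j * (c k * M k j))"
    by (rule sum.cong[OF refl], rule sum.swap)
  also have "\<dots> = (\<Sum>j<n. \<Sum>i<m. \<Sum>k<m. c i * M i j * (c k * M k j))" by (rule sum.swap)
  finally show ?thesis by (simp add: power2_eq_square sum_product)
qed

lemma gram_sym: "gram n M i k = gram n M k i"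
  by (simp add: gram_def mult.commute)

lemma gram_pd:
  assumes "full_row_rank m n M" "\<exists>i<m. c i \<noteq> 0"
  shows "0 < quad m (gram n M) c c"
proof -
  obtain j where j: "j < n" "(\<Sum>l<m. c l * M l j) \<noteq> 0"
    using assms unfolding full_row_rank_def by blast
  then show ?thesis unfolding quad_gram by (intro sum_pos2[of _ j]) auto
qed

context
  fixes m n :: nat and M :: "nat \<Rightarrow> nat \<Rightarrow> real"
  assumes rank: "full_row_rank m n M"
begin

lemma inv_sqrt_gram: "is_inv_sqrt m (gram n M) (inv_sqrt m (gram n M))"
  by (rule inv_sqrt_props(1)) (auto intro: gram_sym gram_pd[OF rank])

text \<open>The Gram matrix of the whitened rows is \<open>R G R\<close>, where \<open>G\<close> is
  the Gram matrix of \<open>M\<close> and \<open>R\<close> its inverse square root.\<close>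

lemma whiten_orthonormal: "orthonormal m n (whiten m n M)"
  unfolding orthonormal_def
proof (intro allI impI)
  fix i k assume ik: "i < m" "k < m"
  let ?R = "inv_sqrt m (gram n M)"
  have "(\<Sum>j<n. whiten m n M i j * whiten m n M k j) = (\<Sum>j<n. \<Sum>p<m. \<Sum>q<m. ?R i p * M p j * (?R k q * M q j))"
    by (simp add: whiten_def sum_product)
  also have "\<dots> = (\<Sum>p<m. \<Sum>j<n. \<Sum>q<m. ?R i p * M p j * (?R k q * M q j))" by (rule sum.swap)
  also have "\<dots> = (\<Sum>p<m. \<Sum>q<m. \<Sum>j<n. ?R i p * M p j * (?R k q * M q j))"
    by (rule sum.cong[OF refl], rule sum.swap)
  also have "\<dots> = (\<Sum>p<m. ?R i p * (\<Sum>q<m. gram n M p q * ?R k q))"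
    by (simp add: gram_def sum_distrib_left sum_distrib_right mult_ac)
  also have "\<dots> = (\<Sum>p<m. ?R i p * (\<Sum>q<m. gram n M p q * ?R q k))"
  proof -
    have "(\<Sum>q<m. gram n M p q * ?R k q) = (\<Sum>q<m. gram n M p q * ?R q k)" for p
      by (rule sum.cong[OF refl]) (use is_inv_sqrt_sym[OF inv_sqrt_gram ik(2)] in auto)
    then show ?thesis by simp
  qed
  also have "\<dots> = (if i = k then 1 else 0)"
    by (rule inv_sqrt_props(2)) (auto intro: gram_sym gram_pd[OF rank] ik)
  finally show "(\<Sum>j<n. whiten m n M i j * whiten m n M k j) = (if i = k then 1 else 0)" .
qed

lemma whiten_mult: "(\<Sum>j<n. whiten m n M i j * x j) = (\<Sum>k<m. inv_sqrt m (gram n M) i k * (\<Sum>j<n. M k j * x j))"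
  unfolding whiten_def sum_distrib_left sum_distrib_right
  by (subst sum.swap) (simp add: mult.assoc)

text \<open>Whitening multiplies \<open>M x\<close> by a positive definite matrix, and the quadratic
  form of that matrix at \<open>M x\<close> can vanish only if \<open>M x = 0\<close>.\<close>

lemma whiten_kernel:
  "(\<forall>i<m. (\<Sum>j<n. whiten m n M i j * x j) = 0) \<longleftrightarrow> (\<forall>i<m. (\<Sum>j<n. M i j * x j) = 0)"
proof
  assume L: "\<forall>i<m. (\<Sum>j<n. whiten m n M i j * x j) = 0"
  define c where "c k = (\<Sum>j<n. M k j * x j)" for k
  have "quad m (inv_sqrt m (gram n M)) c c = 0"
    unfolding quad_alt using L by (simp add: whiten_mult c_def)
  then have "\<not> (\<exists>i<m. c i \<noteq> 0)"
    using is_inv_sqrt_pd[OF inv_sqrt_gram, of c] by auto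
  then show "\<forall>i<m. (\<Sum>j<n. M i j * x j) = 0" by (auto simp: c_def)
qed (simp add: whiten_mult)

text \<open>Expand \<open>y\<close> in the whitened rows and an orthonormal basis of the kernel: the
  kernel coefficients vanish, and whitened rows are combinations of rows of
  \<open>M\<close>.\<close>

lemma kernel_complement_row_span:
  assumes "m \<le> n" and y: "\<And>x. \<forall>l<m. (\<Sum>j<n. M l j * x j) = 0 \<Longrightarrow> (\<Sum>j<n. y j * x j) = 0"
  shows "\<exists>c. \<forall>j<n. y j = (\<Sum>l<m. c l * M l j)"
proof -
  let ?Q = "whiten m n M" and ?R = "inv_sqrt m (gram n M)"
  obtain V where V: "orthonormal (n-m) n V" "\<forall>k<n-m. \<forall>l<m. (\<Sum>j<n. M l j * V k j) = 0"
    using orthonormal_kernel_exists[of m "n-m" n M] assms by auto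
  have QV: "\<forall>k<n-m. \<forall>l<m. (\<Sum>j<n. ?Q l j * V k j) = 0" using V(2) by (simp add: whiten_mult)
  have "y j = (\<Sum>l<m. (\<Sum>i<m. (\<Sum>k<n. ?Q i k * y k) * ?R i l) * M l j)" if j: "j < n" for j
  proof -
    have "(\<Sum>k<n. V i k * y k) = 0" if "i < n - m" for i
      using y[of "V i"] V(2) that by (simp add: mult.commute)
    then have "y j = (\<Sum>i<m. (\<Sum>k<n. ?Q i k * y k) * ?Q i j)"
      using orthonormal_split_expand[OF whiten_orthonormal V(1) QV assms(1) j, of y] by simp
    also have "\<dots> = (\<Sum>i<m. \<Sum>l<m. (\<Sum>k<n. ?Q i k * y k) * (?R i l * M l j))"
      by (subst (2) whiten_def) (simp add: sum_distrib_left)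
    also have "\<dots> = (\<Sum>l<m. \<Sum>i<m. (\<Sum>k<n. ?Q i k * y k) * (?R i l * M l j))" by (rule sum.swap)
    finally show ?thesis by (simp add: sum_distrib_right mult.assoc)
  qed
  then show ?thesis by (intro exI[of _ "\<lambda>l. \<Sum>i<m. (\<Sum>k<n. ?Q i k * y k) * ?R i l"]) auto
qed

lemma kernel_spanned:
  assumes "m \<le> n" "orthonormal (n - m) n V" "\<forall>k<n-m. \<forall>l<m. (\<Sum>j<n. M l j * V k j) = 0"
    and y: "\<forall>l<m. (\<Sum>j<n. M l j * y j) = 0" and j: "j < n"
  shows "y j = (\<Sum>k<n-m. (\<Sum>i<n. V k i * y i) * V k j)"
proof -
  have QV: "\<forall>k<n-m. \<forall>l<m. (\<Sum>j<n. whiten m n M l j * V k j) = 0" using assms(3) by (simp add: whiten_mult)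
  have "(\<Sum>j<n. whiten m n M l j * y j) = 0" for l using y by (simp add: whiten_mult)
  then show ?thesis
    using orthonormal_split_expand[OF whiten_orthonormal assms(2) QV assms(1) j, of y] by simp
qed

end

section \<open>Orthogonal projection to a kernel\<close>

lemma enorm_sq: "(enorm n x)\<^sup>2 = (\<Sum>j<n. (x j)\<^sup>2)"
  by (simp add: enorm_def sum_nonneg)

lemma proj_kernel:
  assumes "orthonormal m n Q"
  defines "p \<equiv> \<lambda>v. \<lambda>j\<in>{..<n}. v j - (\<Sum>i<m. (\<Sum>k<n. Q i k * v k) * Q i j)"
  shows "proj n (ker_mat m n Q) v = p v"
    and "(enorm n (proj n (ker_mat m n Q) v))\<^sup>2 = (enorm n v)\<^sup>2 - (enorm m (matvec n Q v))\<^sup>2"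
    and "p v \<in> ker_mat m n Q"
proof -
  let ?V = "ker_mat m n Q"
  show mem: "p v \<in> ?V"
  proof -
    have "(\<Sum>j<n. Q i j * p v j) = 0" if i: "i < m" for i
      using orthonormal_coeff[OF assms(1) i, of "\<lambda>i. \<Sum>k<n. Q i k * v k"]
      by (simp add: p_def right_diff_distrib sum_subtractf)
    then show ?thesis by (simp add: ker_mat_def) (simp add: p_def)
  qed
  have orth: "(\<Sum>j<n. (v j - p v j) * y j) = 0" if y: "y \<in> ?V" for y
  proof -
    have "(\<Sum>j<n. (v j - p v j) * y j) = (\<Sum>j<n. (\<Sum>i<m. (\<Sum>k<n. Q i k * v k) * Q i j) * y j)"
      by (simp add: p_def)
    also have "\<dots> = (\<Sum>i<m. (\<Sum>k<n. Q i k * v k) * (\<Sum>j<n. Q i j * y j))"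
      by (rule sum_bilinear_swap)
    finally show ?thesis using y by (simp add: ker_mat_def)
  qed
  show eq: "proj n ?V v = p v"
    unfolding proj_def
  proof (rule the_equality)
    show "p v \<in> ?V \<and> (\<forall>y\<in>?V. (\<Sum>j<n. (v j - p v j) * y j) = 0)" using mem orth by blast
  next
    fix q assume q: "q \<in> ?V \<and> (\<forall>y\<in>?V. (\<Sum>j<n. (v j - q j) * y j) = 0)"
    \<comment> \<open>The difference of two candidates lies in the kernel. Testing both
      orthogonality relations against it and subtracting leaves its squared norm.\<close>
    let ?y = "\<lambda>j\<in>{..<n}. q j - p v j"
    have "?y \<in> ?V" using q mem by (auto simp: ker_mat_def right_diff_distrib sum_subtractf)
    then have "(\<Sum>j<n. (v j - q j) * ?y j) = 0" "(\<Sum>j<n. (v j - p v j) * ?y j) = 0"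
      using q orth by blast+
    then have "(\<Sum>j<n. (v j - p v j) * ?y j) - (\<Sum>j<n. (v j - q j) * ?y j) = 0" by linarith
    then have "(\<Sum>j<n. (q j - p v j)\<^sup>2) = 0"
      unfolding sum_subtractf[symmetric] by (simp add: power2_eq_square algebra_simps)
    then have "\<forall>j<n. q j = p v j" by (subst (asm) sum_nonneg_eq_0_iff) auto
    with q mem show "q = p v"
      by (auto intro!: extensionalityI[of _ "{..<n}"] simp: ker_mat_def)
  qed
  show "(enorm n (proj n ?V v))\<^sup>2 = (enorm n v)\<^sup>2 - (enorm m (matvec n Q v))\<^sup>2"
    unfolding eq using orthonormal_residual[OF assms(1), of v]
    by (simp add: enorm_sq matvec_def p_def)
qed

section \<open>The vector w and the standardized coordinates\<close>

definition is_wvec :: "nat \<Rightarrow> nat \<Rightarrow> (nat \<Rightarrow> nat \<Rightarrow> real) \<Rightarrow> (nat \<Rightarrow> real) \<Rightarrow> (nat \<Rightarrow> real) \<Rightarrow> bool" where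
  "is_wvec m n A b w \<longleftrightarrow> w \<in> extensional {..<n} \<and> (\<forall>j<n. 0 < w j) \<and>
      (\<exists>c::nat \<Rightarrow> real. \<forall>j<n. w j = (\<Sum>l<m. c l * A l j)) \<and>
      (\<forall>l<m. (\<Sum>j<n. A l j / w j) = b l)"

text \<open>Both \<open>w\<close> and \<open>w'\<close> are orthogonal to \<open>1 / w - 1 / w'\<close>, a vector of the kernel of \<open>A\<close>; and
  \<open>(w - w') * (1 / w - 1 / w')\<close> is coordinatewise nonpositive.\<close>
lemma is_wvec_unique:
  assumes w: "is_wvec m n A b w" and w': "is_wvec m n A b w'"
  shows "w = w'"
proof -
  have orth: "(\<Sum>j<n. u j * (1 / w j - 1 / w' j)) = 0" if u: "is_wvec m n A b u" for u
  proof -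
    obtain c where c: "\<forall>j<n. u j = (\<Sum>l<m. c l * A l j)" using u by (auto simp: is_wvec_def)
    have "(\<Sum>j<n. u j * (1 / w j - 1 / w' j)) = (\<Sum>j<n. \<Sum>l<m. c l * (A l j / w j - A l j / w' j))"
    proof (intro sum.cong refl)
      fix j assume "j \<in> {..<n}"
      then have "u j = (\<Sum>l<m. c l * A l j)" using c by simp
      then show "u j * (1 / w j - 1 / w' j) = (\<Sum>l<m. c l * (A l j / w j - A l j / w' j))"
        by (simp only: sum_distrib_right) (simp add: algebra_simps)
    qed
    also have "\<dots> = (\<Sum>l<m. c l * ((\<Sum>j<n. A l j / w j) - (\<Sum>j<n. A l j / w' j)))"
      by (subst sum.swap) (simp add: sum_distrib_left sum_subtractf[symmetric])
    also have "\<dots> = 0" using w w' by (simp add: is_wvec_def)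
    finally show ?thesis .
  qed
  have pos: "w j > 0" "w' j > 0" if "j < n" for j using w w' that by (auto simp: is_wvec_def)
  have "(\<Sum>j<n. (w j - w' j)\<^sup>2 / (w j * w' j)) =
      - ((\<Sum>j<n. w j * (1 / w j - 1 / w' j)) - (\<Sum>j<n. w' j * (1 / w j - 1 / w' j)))"
    unfolding sum_subtractf[symmetric] sum_negf[symmetric]
  proof (intro sum.cong refl)
    fix j assume "j \<in> {..<n}"
    then have "w j > 0" "w' j > 0" using pos by auto
    then show "(w j - w' j)\<^sup>2 / (w j * w' j) = - (w j * (1 / w j - 1 / w' j) - w' j * (1 / w j - 1 / w' j))"
      by (simp add: field_simps power2_eq_square)
  qed
  also have "\<dots> = 0" using orth[OF w] orth[OF w'] by simp
  finally have "\<forall>j<n. (w j - w' j)\<^sup>2 / (w j * w' j) = 0"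
    by (subst (asm) sum_nonneg_eq_0_iff) (auto intro!: divide_nonneg_nonneg mult_nonneg_nonneg less_imp_le[OF pos(1)] less_imp_le[OF pos(2)])
  then have "\<forall>j<n. w j = w' j" using pos by (auto dest!: spec simp: less_imp_neq[symmetric])
  with w w' show ?thesis by (auto intro!: extensionalityI[of _ "{..<n}"] simp: is_wvec_def)
qed

text \<open>The logarithm of the product has derivative \<open>\<Sum>j<n. d j / x j\<close> at
  \<open>s = 0\<close>. Maximality is assumed only while all coordinates stay positive, so a
  neighbourhood of \<open>0\<close> with that property is found first.\<close>

lemma prod_critical_point:
  fixes x d :: "nat \<Rightarrow> real"
  assumes x: "\<And>j. j < n \<Longrightarrow> 0 < x j"
    and max: "\<And>s. (\<And>j. j < n \<Longrightarrow> 0 < x j + s * d j) \<Longrightarrow> (\<Prod>j<n. x j + s * d j) \<le> (\<Prod>j<n. x j)"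
  shows "(\<Sum>j<n. d j / x j) = 0"
proof -
  have "\<forall>\<^sub>F s in nhds 0. \<forall>j\<in>{..<n}. 0 < x j + s * d j"
  proof (intro eventually_ball_finite ballI)
    fix j assume "j \<in> {..<n}"
    have "((\<lambda>s. x j + s * d j) \<longlongrightarrow> x j + 0 * d j) (nhds 0)"
      by (intro tendsto_intros filterlim_ident)
    then show "\<forall>\<^sub>F s in nhds 0. 0 < x j + s * d j"
      using x[of j] \<open>j \<in> {..<n}\<close> by (intro order_tendstoD(1)) auto
  qed auto
  then obtain e where e: "e > 0" "\<And>s. \<bar>s\<bar> < e \<Longrightarrow> \<forall>j<n. 0 < x j + s * d j"
    unfolding eventually_nhds_metric by (auto simp: dist_real_def)
  have "((\<lambda>s. \<Sum>j<n. ln (x j + s * d j)) has_field_derivative (\<Sum>j<n. d j / x j)) (at 0)"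
    by (rule DERIV_sum) (use x in \<open>auto intro!: derivative_eq_intros\<close>)
  then show ?thesis
  proof (rule DERIV_local_max)
    show "0 < e" by fact
    show "\<forall>s. \<bar>0 - s\<bar> < e \<longrightarrow> (\<Sum>j<n. ln (x j + s * d j)) \<le> (\<Sum>j<n. ln (x j + 0 * d j))"
    proof (intro allI impI)
      fix s assume "\<bar>0 - s\<bar> < e"
      then have s: "0 < x j + s * d j" if "j < n" for j using e that by auto
      have "(\<Sum>j<n. ln (x j + s * d j)) = ln (\<Prod>j<n. x j + s * d j)"
        by (subst ln_prod) (auto simp: less_imp_neq[OF s, symmetric])
      also have "\<dots> \<le> ln (\<Prod>j<n. x j)"
        using s x by (subst ln_le_cancel_iff) (auto intro!: prod_pos max)
      also have "\<dots> = (\<Sum>j<n. ln (x j))" by (subst ln_prod) (auto simp: less_imp_neq[OF x, symmetric])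
      finally show "(\<Sum>j<n. ln (x j + s * d j)) \<le> (\<Sum>j<n. ln (x j + 0 * d j))" by simp
    qed
  qed
qed

text \<open>\<open>1 / w\<close> is the analytic centre of the polytope, the maximiser of the product of the coordinates.\<close>
lemma is_wvec_exists:
  assumes "standing m n A b"
  shows "\<exists>w. is_wvec m n A b w"
proof -
  let ?K = "Kset m n A b"
  have rank: "full_row_rank m n A" and mn: "m \<le> n" and K: "compact ?K"
    using assms by (auto simp: standing_def)
  obtain x1 where x1: "x1 \<in> ?K" "\<forall>j<n. 0 < x1 j" using assms by (auto simp: standing_def)
  have "continuous_on ?K (\<lambda>x. \<Prod>j<n. x j)"
    by (rule continuous_on_subset[of UNIV])
       (auto intro!: continuous_intros continuous_on_product_coordinates)
  from continuous_attains_sup[OF K _ this] x1 obtain x where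
    x: "x \<in> ?K" and max: "\<And>y. y \<in> ?K \<Longrightarrow> (\<Prod>j<n. y j) \<le> (\<Prod>j<n. x j)" by blast
  \<comment> \<open>A strictly positive point of the polytope makes the maximum positive, so the
    maximiser has no zero coordinate and every kernel direction can be followed both ways.\<close>
  have "0 < (\<Prod>j<n. x1 j)" using x1 by (intro prod_pos) auto
  also have "\<dots> \<le> (\<Prod>j<n. x j)" by (rule max) fact
  finally have "0 < (\<Prod>j<n. x j)" .
  then have "x j \<noteq> 0" if "j < n" for j
    using that prod_zero[of "{..<n}" x] by (metis finite_lessThan lessThan_iff less_irrefl)
  then have xpos: "0 < x j" if "j < n" for j
    using x that by (force simp: Kset_def order_less_le)
  \<comment> \<open>Lagrange multipliers: \<open>1 / x\<close> is the gradient of the logarithm of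
    the product, it annihilates the kernel of \<open>A\<close>, hence it is a combination of the
    rows.\<close>
  have "\<exists>c. \<forall>j<n. 1 / x j = (\<Sum>l<m. c l * A l j)"
  proof (rule kernel_complement_row_span[OF rank mn])
    fix d assume d: "\<forall>l<m. (\<Sum>j<n. A l j * d j) = 0"
    have "(\<Sum>j<n. d j / x j) = 0"
    proof (rule prod_critical_point[OF xpos])
      fix s assume s: "\<And>j. j < n \<Longrightarrow> 0 < x j + s * d j"
      let ?y = "\<lambda>j\<in>{..<n}. x j + s * d j"
      have "(\<Sum>j<n. A l j * (x j + s * d j)) = b l" if "l < m" for l
      proof -
        have "(\<Sum>j<n. A l j * (x j + s * d j)) = (\<Sum>j<n. A l j * x j) + s * (\<Sum>j<n. A l j * d j)"
          by (simp add: sum.distrib distrib_left sum_distrib_left algebra_simps)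
        then show ?thesis using x d that by (simp add: Kset_def)
      qed
      then have "?y \<in> ?K" using s by (auto simp: Kset_def less_imp_le)
      from max[OF this] show "(\<Prod>j<n. x j + s * d j) \<le> (\<Prod>j<n. x j)" by simp
    qed
    then show "(\<Sum>j<n. 1 / x j * d j) = 0" by simp
  qed
  then have "is_wvec m n A b (\<lambda>j\<in>{..<n}. 1 / x j)"
    using x xpos by (auto simp: is_wvec_def Kset_def)
  then show ?thesis by (rule exI[where P = "is_wvec m n A b"])
qed

lemma is_wvec_wvec:
  assumes "standing m n A b"
  shows "is_wvec m n A b (wvec m n A b)"
proof -
  obtain w where w: "is_wvec m n A b w" using is_wvec_exists[OF assms] ..
  have "wvec m n A b = (THE w. is_wvec m n A b w)" by (simp add: wvec_def is_wvec_def)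
  also have "\<dots> = w" using w by (rule the_equality[where P = "is_wvec m n A b"]) (rule is_wvec_unique[OF _ w])
  finally show ?thesis using w by simp
qed

section \<open>The plane \<open>A x = b\<close> in standardized coordinates\<close>

lemma orth_param_exists:
  assumes "standing m n A b"
  shows "orth_param m n A b (SOME \<phi>. orth_param m n A b \<phi>)"
proof -
  obtain x0 where x0: "x0 \<in> Kset m n A b" using assms by (auto simp: standing_def)
  obtain V where "orthonormal (n-m) n V" "\<forall>k<n-m. \<forall>l<m. (\<Sum>j<n. A l j * V k j) = 0"
    using orthonormal_kernel_exists[of m "n-m" n A] assms by (auto simp: standing_def)
  with x0 have "orth_param m n A b (\<lambda>y. \<lambda>j\<in>{..<n}. x0 j + (\<Sum>k<n-m. y k * V k j))"
    unfolding orth_param_def orthonormal_def Kset_def by blast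
  then show ?thesis by (rule someI[where P = "orth_param m n A b"])
qed

lemma full_row_rank_Atil:
  assumes "standing m n A b"
  shows "full_row_rank m n (Atil m n A b)"
  unfolding full_row_rank_def
proof (intro allI impI)
  fix c :: "nat \<Rightarrow> real" and l
  assume c: "\<forall>j<n. (\<Sum>l<m. c l * Atil m n A b l j) = 0" and "l < m"
  have "(\<Sum>l<m. c l * A l j) = 0" if "j < n" for j
  proof -
    have "wvec m n A b j \<noteq> 0" using is_wvec_wvec[OF assms] that by (auto simp: is_wvec_def)
    moreover have "(\<Sum>l<m. c l * A l j) / wvec m n A b j = 0"
      using c that by (simp add: Atil_def sum_divide_distrib)
    ultimately show ?thesis by simp
  qed
  then show "c l = 0" using assms \<open>l < m\<close> unfolding standing_def full_row_rank_def by blast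
qed

lemma Ahat_whiten: "Ahat m n A b = whiten m n (Atil m n A b)"
  by (intro ext) (simp add: Ahat_def whiten_def)

lemma ker_Ahat:
  assumes "standing m n A b"
  shows "ker_mat m n (Ahat m n A b) = ker_mat m n (Atil m n A b)"
  unfolding ker_mat_def Ahat_whiten using whiten_kernel[OF full_row_rank_Atil[OF assms]] by blast

lemma Ahat_orthonormal: "standing m n A b \<Longrightarrow> orthonormal m n (Ahat m n A b)"
  unfolding Ahat_whiten by (rule whiten_orthonormal[OF full_row_rank_Atil])

text \<open>In the coordinates \<open>w * x - 1\<close> the affine plane becomes the kernel of \<open>Ahat\<close>; the
  parametrization is no longer isometric there, which only costs a constant factor.\<close>
lemma orth_param_standardized:
  assumes st: "standing m n A b" and \<phi>: "orth_param m n A b \<phi>"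
  defines "w \<equiv> wvec m n A b" and "Q \<equiv> Ahat m n A b"
  obtains p B \<omega> where
    "\<And>y j. j < n \<Longrightarrow> w j * \<phi> y j - 1 = p j + (\<Sum>k<n-m. y k * B k j)"
    "\<And>i. i < m \<Longrightarrow> (\<Sum>j<n. Q i j * p j) = 0"
    "\<And>i k. i < m \<Longrightarrow> k < n - m \<Longrightarrow> (\<Sum>j<n. Q i j * B k j) = 0"
    "\<And>y. (\<And>i. i < m \<Longrightarrow> (\<Sum>j<n. Q i j * y j) = 0) \<Longrightarrow> \<exists>v. \<forall>j<n. y j = (\<Sum>k<n-m. v k * B k j)"
    "\<omega> > 0" "\<And>v. (\<Sum>j<n. (\<Sum>k<n-m. v k * B k j)\<^sup>2) \<ge> \<omega>\<^sup>2 * (\<Sum>k<n-m. (v k)\<^sup>2)"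
    "\<And>l y. l < m \<Longrightarrow> (\<Sum>j<n. A l j * \<phi> y j) = b l"
    "\<And>y. \<phi> y \<in> extensional {..<n}"
    "\<And>j. j < n \<Longrightarrow> (\<lambda>y. \<phi> y j) \<in> borel_measurable (PiM {..<n-m} (\<lambda>_. lborel))"
proof -
  have rank: "full_row_rank m n A" and mn: "m < n" using st by (auto simp: standing_def)
  have wpos: "0 < w j" if "j < n" for j using is_wvec_wvec[OF st] that by (simp add: is_wvec_def w_def)
  have Aw: "(\<Sum>j<n. A l j / w j) = b l" if "l < m" for l
    using is_wvec_wvec[OF st] that by (simp add: is_wvec_def w_def)
  obtain x0 V where x0: "\<forall>l<m. (\<Sum>j<n. A l j * x0 j) = b l"
    and AV: "\<forall>k<n-m. \<forall>l<m. (\<Sum>j<n. A l j * V k j) = 0"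
    and V: "orthonormal (n - m) n V"
    and \<phi>_eq: "\<phi> = (\<lambda>y. \<lambda>j\<in>{..<n}. x0 j + (\<Sum>k<n-m. y k * V k j))"
    using \<phi> unfolding orth_param_def orthonormal_def by blast
  have Qker: "(\<forall>i<m. (\<Sum>j<n. Q i j * y j) = 0) \<longleftrightarrow> (\<forall>i<m. (\<Sum>j<n. A i j / w j * y j) = 0)" for y
    using whiten_kernel[OF full_row_rank_Atil[OF st]] unfolding Q_def Ahat_whiten
    by (simp add: Atil_def w_def)
  define p where "p j = w j * x0 j - 1" for j
  define B where "B k j = w j * V k j" for k j
  show ?thesis
  proof (rule that)
    show "w j * \<phi> y j - 1 = p j + (\<Sum>k<n-m. y k * B k j)" if "j < n" for y j
      using that by (simp add: \<phi>_eq p_def B_def sum_distrib_left algebra_simps)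
    have "\<forall>i<m. (\<Sum>j<n. A i j / w j * p j) = 0"
    proof (intro allI impI)
      fix i assume i: "i < m"
      have "(\<Sum>j<n. A i j / w j * p j) = (\<Sum>j<n. A i j * x0 j - A i j / w j)"
      proof (intro sum.cong refl)
        fix j assume "j \<in> {..<n}"
        then have "w j > 0" using wpos by simp
        then show "A i j / w j * p j = A i j * x0 j - A i j / w j" by (simp add: p_def field_simps)
      qed
      then show "(\<Sum>j<n. A i j / w j * p j) = 0" using x0 Aw i by (simp add: sum_subtractf)
    qed
    then show "(\<Sum>j<n. Q i j * p j) = 0" if "i < m" for i using Qker that by blast
    have "\<forall>i<m. (\<Sum>j<n. A i j / w j * B k j) = 0" if "k < n - m" for k
    proof (intro allI impI)
      fix i assume i: "i < m"
      have "(\<Sum>j<n. A i j / w j * B k j) = (\<Sum>j<n. A i j * V k j)"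
        using wpos by (intro sum.cong) (auto simp: B_def less_imp_neq[symmetric])
      then show "(\<Sum>j<n. A i j / w j * B k j) = 0" using AV that i by simp
    qed
    then show "(\<Sum>j<n. Q i j * B k j) = 0" if "i < m" "k < n - m" for i k using Qker that by blast
    show "\<exists>v. \<forall>j<n. y j = (\<Sum>k<n-m. v k * B k j)" if y: "\<And>i. i < m \<Longrightarrow> (\<Sum>j<n. Q i j * y j) = 0" for y
    proof -
      have "\<forall>i<m. (\<Sum>j<n. A i j * (y j / w j)) = 0" using Qker[of y] y by simp
      from kernel_spanned[OF rank less_imp_le[OF mn] V AV this]
      have eq: "y j / w j = (\<Sum>k<n-m. (\<Sum>i<n. V k i * (y i / w i)) * V k j)" if "j < n" for j
        using that by blast
      have "y j = (\<Sum>k<n-m. (\<Sum>i<n. V k i * (y i / w i)) * B k j)" if "j < n" for j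
      proof -
        have "y j = w j * (y j / w j)" using wpos[OF that] by simp
        then show ?thesis unfolding eq[OF that] by (simp only: sum_distrib_left B_def mult_ac)
      qed
      then show ?thesis by (intro exI[of _ "\<lambda>k. \<Sum>i<n. V k i * (y i / w i)"]) simp
    qed
    \<comment> \<open>The witness for \<open>\<omega>\<close> is the least weight: passing from
      \<open>V k j\<close> to \<open>B k j = w j * V k j\<close> stretches every coordinate of an
      isometric image by at least this factor.\<close>
    show "0 < Min (w ` {..<n})" using mn wpos by (subst Min_gr_iff) auto
    show "(\<Sum>j<n. (\<Sum>k<n-m. v k * B k j)\<^sup>2) \<ge> (Min (w ` {..<n}))\<^sup>2 * (\<Sum>k<n-m. (v k)\<^sup>2)" for v
    proof -
      have "(Min (w ` {..<n}))\<^sup>2 * (\<Sum>k<n-m. (v k)\<^sup>2) = (\<Sum>j<n. (Min (w ` {..<n}))\<^sup>2 * (\<Sum>k<n-m. v k * V k j)\<^sup>2)"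
        using orthonormal_Parseval[OF V, of v v] by (simp add: power2_eq_square sum_distrib_left[symmetric])
      also have "\<dots> \<le> (\<Sum>j<n. (w j)\<^sup>2 * (\<Sum>k<n-m. v k * V k j)\<^sup>2)"
        using \<open>0 < Min (w ` {..<n})\<close>
        by (intro sum_mono mult_right_mono power_mono) (auto intro!: Min_le)
      also have "\<dots> = (\<Sum>j<n. (\<Sum>k<n-m. v k * B k j)\<^sup>2)"
        by (simp add: B_def power_mult_distrib[symmetric] sum_distrib_left mult_ac)
      finally show ?thesis .
    qed
    show "(\<Sum>j<n. A l j * \<phi> y j) = b l" if "l < m" for l y
    proof -
      have "(\<Sum>j<n. A l j * \<phi> y j) = (\<Sum>j<n. A l j * x0 j) + (\<Sum>j<n. \<Sum>k<n-m. y k * (A l j * V k j))"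
        by (simp add: \<phi>_eq distrib_left sum.distrib sum_distrib_left mult_ac)
      also have "(\<Sum>j<n. \<Sum>k<n-m. y k * (A l j * V k j)) = (\<Sum>k<n-m. y k * (\<Sum>j<n. A l j * V k j))"
        by (subst sum.swap) (simp add: sum_distrib_left)
      finally show ?thesis using x0 AV that by simp
    qed
    show "\<phi> y \<in> extensional {..<n}" for y by (simp add: \<phi>_eq)
    show "(\<lambda>y. \<phi> y j) \<in> borel_measurable (PiM {..<n-m} (\<lambda>_. lborel))" if "j < n" for j
      using that unfolding \<phi>_eq by simp
  qed
qed

text \<open>Since \<open>w\<close> is in the row span of \<open>A\<close>, the constant vector is in
  the row span of \<open>Atil\<close>. It is therefore orthogonal to the kernel, and its expansion
  in the rows of \<open>Ahat\<close> leaves no remainder.\<close>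

lemma ones_row_span:
  assumes st: "standing m n A b" and j: "j < n"
  shows "1 = (\<Sum>i<m. (\<Sum>k<n. Ahat m n A b i k) * Ahat m n A b i j)"
proof -
  let ?Q = "Ahat m n A b" and ?w = "wvec m n A b"
  obtain V where V: "orthonormal (n-m) n V" "\<forall>k<n-m. \<forall>l<m. (\<Sum>j<n. ?Q l j * V k j) = 0"
    using orthonormal_kernel_exists[of m "n-m" n ?Q] st by (auto simp: standing_def)
  have wpos: "0 < ?w j" if "j < n" for j using is_wvec_wvec[OF st] that by (simp add: is_wvec_def)
  obtain c where c: "\<forall>j<n. ?w j = (\<Sum>l<m. c l * A l j)"
    using is_wvec_wvec[OF st] by (auto simp: is_wvec_def)
  have one: "1 = (\<Sum>l<m. c l * Atil m n A b l j)" if "j < n" for j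
    using c wpos[OF that] that by (simp add: Atil_def sum_divide_distrib[symmetric])
  have "(\<Sum>j<n. V k j) = 0" if k: "k < n - m" for k
  proof -
    have ker: "\<forall>l<m. (\<Sum>j<n. Atil m n A b l j * V k j) = 0"
      using V(2) k whiten_kernel[OF full_row_rank_Atil[OF st], of "V k"] by (simp add: Ahat_whiten)
    have "(\<Sum>j<n. V k j) = (\<Sum>j<n. (\<Sum>l<m. c l * Atil m n A b l j) * V k j)"
      using one by (intro sum.cong) auto
    also have "\<dots> = (\<Sum>l<m. c l * (\<Sum>j<n. Atil m n A b l j * V k j))"
      by (rule sum_bilinear_swap)
    finally show ?thesis using ker by simp
  qed
  then show ?thesis
    using orthonormal_split_expand[OF Ahat_orthonormal[OF st] V _ j, of "\<lambda>_. 1"] st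
    by (simp add: standing_def)
qed

section \<open>Lebesgue measure on functions\<close>

abbreviation lebn :: "nat \<Rightarrow> (nat \<Rightarrow> real) measure" where
  "lebn d \<equiv> PiM {..<d} (\<lambda>_. lborel)"

interpretation LB: product_sigma_finite "\<lambda>_::nat. lborel :: real measure"
  by standard

lemma sigma_finite_lebn: "sigma_finite_measure (lebn d)"
  by (rule LB.sigma_finite) simp

lemma pair_sigma_finite_lebn: "pair_sigma_finite (lebn m) (lebn d)"
  by (intro pair_sigma_finite.intro sigma_finite_lebn)

lemma measurable_fst_component: "j < d \<Longrightarrow> (\<lambda>x. fst x j) \<in> borel_measurable (lebn d \<Otimes>\<^sub>M N)"
  using measurable_compose[OF measurable_fst measurable_component_singleton[of j "{..<d}" "\<lambda>_. lborel"]] by simp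

lemma measurable_snd_component: "j < d \<Longrightarrow> (\<lambda>x. snd x j) \<in> borel_measurable (N \<Otimes>\<^sub>M lebn d)"
  using measurable_compose[OF measurable_snd measurable_component_singleton[of j "{..<d}" "\<lambda>_. lborel"]] by simp

text \<open>On boxes this is the one-dimensional affine substitution in each coordinate. It supplies
  the translations and scalings of \<open>lebn\<close>; the general linear map needed later goes
  through \<open>haar_uniqueness\<close>.\<close>

lemma lebn_affine:
  assumes c: "c \<noteq> 0"
  shows "lebn d = density (distr (lebn d) (lebn d) (\<lambda>x. \<lambda>i\<in>{..<d}. s i + c * x i)) (\<lambda>_. ennreal (\<bar>c\<bar> ^ d))"
proof (rule LB.PiM_eqI[symmetric])
  let ?T = "\<lambda>x. \<lambda>i\<in>{..<d}. s i + c * x i"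
  have T[measurable]: "?T \<in> measurable (lebn d) (lebn d)"
    by (rule measurable_restrict) auto
  fix A :: "nat \<Rightarrow> real set" assume A: "\<And>i. i \<in> {..<d} \<Longrightarrow> A i \<in> sets lborel"
  have pre: "?T -` PiE {..<d} A \<inter> space (lebn d) = PiE {..<d} (\<lambda>i. (\<lambda>x. s i + c * x) -` A i)"
    by (auto simp: space_PiM PiE_iff extensional_def)
  have meas: "(\<lambda>x. s i + c * x) -` A i \<in> sets lborel" if "i \<in> {..<d}" for i
  proof -
    have "(\<lambda>x. s i + c * x) \<in> measurable borel borel" by simp
    from measurable_sets[OF this, of "A i"] A[OF that] show ?thesis by simp
  qed
  have one: "emeasure lborel (A i) = ennreal \<bar>c\<bar> * emeasure lborel ((\<lambda>x. s i + c * x) -` A i)" if "i \<in> {..<d}" for i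
    using A[OF that] by (subst lborel_real_affine[OF c, of "s i"]) (simp add: emeasure_density_const emeasure_distr)
  have "emeasure (density (distr (lebn d) (lebn d) ?T) (\<lambda>_. ennreal (\<bar>c\<bar> ^ d))) (PiE {..<d} A)
      = ennreal (\<bar>c\<bar> ^ d) * emeasure (lebn d) (?T -` PiE {..<d} A \<inter> space (lebn d))"
    using A by (subst emeasure_density_const) (auto intro!: sets_PiM_I_finite simp: emeasure_distr)
  also have "\<dots> = ennreal (\<bar>c\<bar> ^ d) * (\<Prod>i<d. emeasure lborel ((\<lambda>x. s i + c * x) -` A i))"
    unfolding pre using meas by (subst LB.emeasure_PiM) auto
  also have "\<dots> = (\<Prod>i<d. emeasure lborel (A i))"
    by (simp add: one prod.distrib ennreal_power)
  finally show "emeasure (density (distr (lebn d) (lebn d) ?T) (\<lambda>_. ennreal (\<bar>c\<bar> ^ d))) (PiE {..<d} A)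
      = (\<Prod>i<d. emeasure lborel (A i))" .
qed simp_all

lemma nn_integral_lebn_translate:
  assumes [measurable]: "f \<in> borel_measurable (lebn d)"
  shows "(\<integral>\<^sup>+x. f (\<lambda>i\<in>{..<d}. x i + s i) \<partial>lebn d) = (\<integral>\<^sup>+x. f x \<partial>lebn d)"
proof -
  have [measurable]: "(\<lambda>x. \<lambda>i\<in>{..<d}. s i + 1 * x i) \<in> measurable (lebn d) (lebn d)"
    by (rule measurable_restrict) auto
  show ?thesis
    by (subst (2) lebn_affine[of 1 d s])
       (simp_all add: nn_integral_density nn_integral_distr add.commute)
qed

lemma integral_lebn_scale:
  fixes f :: "(nat \<Rightarrow> real) \<Rightarrow> complex"
  assumes [measurable]: "f \<in> borel_measurable (lebn d)" and c: "c > 0"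
  shows "(\<integral>x. f x \<partial>lebn d) = c ^ d * (\<integral>x. f (\<lambda>i\<in>{..<d}. c * x i) \<partial>lebn d)"
proof -
  have [measurable]: "(\<lambda>x. \<lambda>i\<in>{..<d}. 0 + c * x i) \<in> measurable (lebn d) (lebn d)"
    by (rule measurable_restrict) auto
  show ?thesis using c
    by (subst lebn_affine[of c d "\<lambda>_. 0"])
       (simp_all add: integral_density integral_distr scaleR_conv_of_real)
qed

text \<open>Integrate first in a coordinate \<open>k\<close> with
  \<open>\<beta> k \<noteq> 0\<close>: each line in that direction meets the hyperplane in one
  point. If all \<open>\<beta> k\<close> vanish, the set is empty because
  \<open>\<alpha> \<noteq> 0\<close>.\<close>

lemma AE_lebn_hyperplane:
  assumes "\<alpha> \<noteq> 0 \<or> (\<exists>k<d. \<beta> k \<noteq> 0)"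
  shows "AE v in lebn d. \<alpha> + (\<Sum>k<d. v k * \<beta> k) \<noteq> 0"
proof (cases "\<exists>k<d. \<beta> k \<noteq> 0")
  case False
  then have "\<alpha> \<noteq> 0" "\<And>k. k < d \<Longrightarrow> \<beta> k = 0" using assms by auto
  then show ?thesis by (intro AE_I2) simp
next
  case True
  then obtain k where k: "k < d" "\<beta> k \<noteq> 0" by blast
  define I where "I = {..<d} - {k}"
  have I: "{..<d} = insert k I" "k \<notin> I" "finite I" using k by (auto simp: I_def)
  let ?S = "{v \<in> space (lebn d). \<alpha> + (\<Sum>k<d. v k * \<beta> k) = 0}"
  have S: "?S \<in> sets (lebn d)" by measurable
  have "emeasure (lebn d) ?S = (\<integral>\<^sup>+v. indicator ?S v \<partial>lebn d)" using S by simp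
  also have "\<dots> = (\<integral>\<^sup>+x. (\<integral>\<^sup>+y. indicator ?S (x(k := y)) \<partial>lborel) \<partial>PiM I (\<lambda>_. lborel))"
    using S unfolding I(1) by (subst LB.product_nn_integral_insert[OF I(3,2)]) auto
  also have "\<dots> = (\<integral>\<^sup>+x. 0 \<partial>PiM I (\<lambda>_. lborel :: real measure))"
  proof (rule nn_integral_cong)
    fix x :: "nat \<Rightarrow> real"
    let ?y = "- (\<alpha> + (\<Sum>i\<in>I. x i * \<beta> i)) / \<beta> k"
    have "(\<integral>\<^sup>+y. indicator ?S (x(k := y)) \<partial>lborel) \<le> (\<integral>\<^sup>+y. indicator {?y} y \<partial>lborel)"
    proof (intro nn_integral_mono)
      fix y
      have "(\<Sum>i<d. (x(k := y)) i * \<beta> i) = y * \<beta> k + (\<Sum>i\<in>I. x i * \<beta> i)"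
        unfolding I(1) using I(2,3) by (simp cong: sum.cong) (intro sum.cong, auto)
      then have "y = ?y" if "x(k := y) \<in> ?S" using that k(2) by (auto simp: field_simps)
      then show "indicator ?S (x(k := y)) \<le> (indicator {?y} y :: ennreal)"
        by (auto simp: indicator_def)
    qed
    then show "(\<integral>\<^sup>+y. indicator ?S (x(k := y)) \<partial>lborel) = 0" by simp
  qed
  finally have "emeasure (lebn d) ?S = 0" by simp
  with S show ?thesis by (intro AE_I[of _ _ ?S]) auto
qed

text \<open>Uniqueness of Haar measure: integrate \<open>f (T p + y) * g y\<close> over \<open>p\<close> and \<open>y\<close> in both orders.\<close>
lemma haar_uniqueness:
  fixes P :: "'p measure" and T :: "'p \<Rightarrow> nat \<Rightarrow> real"
  assumes P: "sigma_finite_measure P" and T[measurable]: "T \<in> measurable P (lebn n)"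
    and f[measurable]: "f \<in> borel_measurable (lebn n)" and g[measurable]: "g \<in> borel_measurable (lebn n)"
    and inv: "\<And>y F. y \<in> space (lebn n) \<Longrightarrow> F \<in> borel_measurable (lebn n) \<Longrightarrow>
      (\<integral>\<^sup>+p. F (\<lambda>j\<in>{..<n}. T p j + y j) \<partial>P) = (\<integral>\<^sup>+p. F (T p) \<partial>P)"
    and sym: "\<And>y. g (\<lambda>j\<in>{..<n}. - y j) = g y"
  shows "(\<integral>\<^sup>+y. g y \<partial>lebn n) * (\<integral>\<^sup>+p. f (T p) \<partial>P) = (\<integral>\<^sup>+y. f y \<partial>lebn n) * (\<integral>\<^sup>+p. g (T p) \<partial>P)"
proof -
  interpret PS: pair_sigma_finite P "lebn n"
    by (intro pair_sigma_finite.intro P sigma_finite_lebn)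
  have Tspace: "T p \<in> space (lebn n)" if "p \<in> space P" for p using measurable_space[OF T that] .
  have comp[measurable]: "(\<lambda>x. T (fst x) j) \<in> borel_measurable (P \<Otimes>\<^sub>M lebn n)" if "j \<in> {..<n}" for j
    using that measurable_compose[OF measurable_fst measurable_compose[OF T measurable_component_singleton[of j "{..<n}"]]]
    by simp
  have m1: "(\<lambda>x. \<lambda>j\<in>{..<n}. T (fst x) j + snd x j) \<in> measurable (P \<Otimes>\<^sub>M lebn n) (lebn n)"
    by (rule measurable_restrict) (use comp measurable_snd_component in \<open>auto intro!: borel_measurable_add\<close>)
  have m2: "(\<lambda>x. \<lambda>j\<in>{..<n}. snd x j - T (fst x) j) \<in> measurable (P \<Otimes>\<^sub>M lebn n) (lebn n)"
    by (rule measurable_restrict) (use comp measurable_snd_component in \<open>auto intro!: borel_measurable_diff\<close>)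
  \<comment> \<open>The symmetry of \<open>g\<close> turns \<open>y - T p\<close> into
    \<open>T p - y\<close>, a translate to which the invariance applies.\<close>
  have neg: "(\<integral>\<^sup>+p. g (\<lambda>j\<in>{..<n}. y j - T p j) \<partial>P) = (\<integral>\<^sup>+p. g (T p) \<partial>P)" if y: "y \<in> space (lebn n)" for y
  proof -
    have "(\<integral>\<^sup>+p. g (\<lambda>j\<in>{..<n}. y j - T p j) \<partial>P) = (\<integral>\<^sup>+p. g (\<lambda>j\<in>{..<n}. T p j + (\<lambda>j\<in>{..<n}. - y j) j) \<partial>P)"
    proof (rule nn_integral_cong)
      fix p
      have "(\<lambda>j\<in>{..<n}. y j - T p j) = (\<lambda>j\<in>{..<n}. - (\<lambda>j\<in>{..<n}. T p j + (\<lambda>j\<in>{..<n}. - y j) j) j)"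
        by (auto simp: restrict_def)
      then show "g (\<lambda>j\<in>{..<n}. y j - T p j) = g (\<lambda>j\<in>{..<n}. T p j + (\<lambda>j\<in>{..<n}. - y j) j)"
        by (simp only: sym)
    qed
    also have "\<dots> = (\<integral>\<^sup>+p. g (T p) \<partial>P)" by (rule inv) (simp_all add: space_PiM PiE_iff extensional_def)
    finally show ?thesis .
  qed
  have "(\<integral>\<^sup>+y. g y \<partial>lebn n) * (\<integral>\<^sup>+p. f (T p) \<partial>P) = (\<integral>\<^sup>+y. g y * (\<integral>\<^sup>+p. f (T p) \<partial>P) \<partial>lebn n)"
    by (simp add: nn_integral_multc)
  also have "\<dots> = (\<integral>\<^sup>+y. \<integral>\<^sup>+p. f (\<lambda>j\<in>{..<n}. T p j + y j) * g y \<partial>P \<partial>lebn n)"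
  proof (rule nn_integral_cong)
    fix y assume y: "y \<in> space (lebn n)"
    have "(\<lambda>p. \<lambda>j\<in>{..<n}. T p j + y j) \<in> measurable P (lebn n)"
      using measurable_compose[OF measurable_Pair2'[OF y, of P] m1] by simp
    then have "(\<lambda>p. f (\<lambda>j\<in>{..<n}. T p j + y j)) \<in> borel_measurable P"
      by (rule measurable_compose) fact
    from nn_integral_multc[OF this, of "g y"]
    show "g y * (\<integral>\<^sup>+p. f (T p) \<partial>P) = (\<integral>\<^sup>+p. f (\<lambda>j\<in>{..<n}. T p j + y j) * g y \<partial>P)"
      unfolding inv[OF y f] by (simp only: mult.commute)
  qed
  also have "\<dots> = (\<integral>\<^sup>+p. \<integral>\<^sup>+y. f (\<lambda>j\<in>{..<n}. T p j + y j) * g y \<partial>lebn n \<partial>P)"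
  proof (rule PS.Fubini')
    show "(\<lambda>(p, y). f (\<lambda>j\<in>{..<n}. T p j + y j) * g y) \<in> borel_measurable (P \<Otimes>\<^sub>M lebn n)"
      unfolding split_beta
      by (intro borel_measurable_times_ennreal measurable_compose[OF m1 f] measurable_compose[OF measurable_snd g])
  qed
  also have "\<dots> = (\<integral>\<^sup>+p. \<integral>\<^sup>+y. f y * g (\<lambda>j\<in>{..<n}. y j - T p j) \<partial>lebn n \<partial>P)"
  proof (rule nn_integral_cong)
    fix p assume p: "p \<in> space P"
    have F: "(\<lambda>y. f y * g (\<lambda>j\<in>{..<n}. y j - T p j)) \<in> borel_measurable (lebn n)"
      using measurable_compose[OF measurable_Pair1'[OF p, of "lebn n"] measurable_compose[OF m2 g]]
      by (intro borel_measurable_times_ennreal f) simp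
    have "(\<integral>\<^sup>+y. f y * g (\<lambda>j\<in>{..<n}. y j - T p j) \<partial>lebn n) =
        (\<integral>\<^sup>+y. f (\<lambda>j\<in>{..<n}. y j + T p j) * g (\<lambda>j\<in>{..<n}. (\<lambda>j\<in>{..<n}. y j + T p j) j - T p j) \<partial>lebn n)"
      by (rule nn_integral_lebn_translate[OF F, symmetric])
    also have "\<dots> = (\<integral>\<^sup>+y. f (\<lambda>j\<in>{..<n}. T p j + y j) * g y \<partial>lebn n)"
    proof (rule nn_integral_cong)
      fix y assume "y \<in> space (lebn n)"
      then have "(\<lambda>j\<in>{..<n}. (\<lambda>j\<in>{..<n}. y j + T p j) j - T p j) = y"
        by (auto simp: space_PiM PiE_iff extensional_def restrict_def fun_eq_iff)
      then show "f (\<lambda>j\<in>{..<n}. y j + T p j) * g (\<lambda>j\<in>{..<n}. (\<lambda>j\<in>{..<n}. y j + T p j) j - T p j) =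
          f (\<lambda>j\<in>{..<n}. T p j + y j) * g y" by (simp only: add.commute)
    qed
    finally show "(\<integral>\<^sup>+y. f (\<lambda>j\<in>{..<n}. T p j + y j) * g y \<partial>lebn n) =
      (\<integral>\<^sup>+y. f y * g (\<lambda>j\<in>{..<n}. y j - T p j) \<partial>lebn n)" ..
  qed
  also have "\<dots> = (\<integral>\<^sup>+y. \<integral>\<^sup>+p. f y * g (\<lambda>j\<in>{..<n}. y j - T p j) \<partial>P \<partial>lebn n)"
  proof (rule PS.Fubini'[symmetric])
    show "(\<lambda>(p, y). f y * g (\<lambda>j\<in>{..<n}. y j - T p j)) \<in> borel_measurable (P \<Otimes>\<^sub>M lebn n)"
      unfolding split_beta
      by (intro borel_measurable_times_ennreal measurable_compose[OF m2 g] measurable_compose[OF measurable_snd f])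
  qed
  also have "\<dots> = (\<integral>\<^sup>+y. f y * (\<integral>\<^sup>+p. g (T p) \<partial>P) \<partial>lebn n)"
  proof (rule nn_integral_cong)
    fix y assume y: "y \<in> space (lebn n)"
    have "(\<lambda>p. g (\<lambda>j\<in>{..<n}. y j - T p j)) \<in> borel_measurable P"
      using measurable_compose[OF measurable_Pair2'[OF y, of P] measurable_compose[OF m2 g]] by simp
    then show "(\<integral>\<^sup>+p. f y * g (\<lambda>j\<in>{..<n}. y j - T p j) \<partial>P) = f y * (\<integral>\<^sup>+p. g (T p) \<partial>P)"
      by (simp add: nn_integral_cmult neg[OF y])
  qed
  also have "\<dots> = (\<integral>\<^sup>+y. f y \<partial>lebn n) * (\<integral>\<^sup>+p. g (T p) \<partial>P)" by (simp add: nn_integral_multc)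
  finally show ?thesis .
qed

section \<open>One-variable majorants and integrals of products\<close>

lemma integrable_cauchy:
  assumes a: "a > 0"
  shows "integrable lborel (\<lambda>x::real. 1 / (1 + a * x\<^sup>2))"
proof -
  have "integrable lborel (\<lambda>x::real. inverse (1 + x\<^sup>2))"
    using integrable_inverse_1_plus_square by (simp add: set_integrable_def einterval_def)
  then have "integrable lborel (\<lambda>x::real. inverse (1 + (0 + sqrt a * x)\<^sup>2))"
    by (rule lborel_integrable_real_affine) (use a in simp)
  then show ?thesis using a by (simp add: power_mult_distrib inverse_eq_divide)
qed

text \<open>Truncating the exponential series and taking reciprocals reduces the integrability of
  exponential and Gaussian tails to that of a rescaled arctangent derivative.\<close>

lemma exp_neg_le_cauchy:
  fixes x :: real
  assumes "c > 0"
  shows "exp (- c * \<bar>x\<bar>) \<le> 1 / (1 + (c\<^sup>2 / 2) * x\<^sup>2)" "exp (- c * x\<^sup>2) \<le> 1 / (1 + c * x\<^sup>2)"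
proof -
  have "1 + (c\<^sup>2 / 2) * x\<^sup>2 \<le> 1 + c * \<bar>x\<bar> + (c * \<bar>x\<bar>)\<^sup>2 / 2"
    using assms by (simp add: power_mult_distrib)
  also have "\<dots> \<le> exp (c * \<bar>x\<bar>)" using assms by (intro exp_lower_Taylor_quadratic) simp
  finally have "1 + (c\<^sup>2 / 2) * x\<^sup>2 \<le> exp (c * \<bar>x\<bar>)" .
  then show "exp (- c * \<bar>x\<bar>) \<le> 1 / (1 + (c\<^sup>2 / 2) * x\<^sup>2)"
    by (simp add: exp_minus inverse_eq_divide, intro divide_left_mono) (auto intro!: mult_pos_pos add_pos_nonneg)
  have "1 + c * x\<^sup>2 \<le> exp (c * x\<^sup>2)" by (rule exp_ge_add_one_self)
  then show "exp (- c * x\<^sup>2) \<le> 1 / (1 + c * x\<^sup>2)"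
    using assms by (simp add: exp_minus inverse_eq_divide, intro divide_left_mono) (auto intro!: mult_pos_pos add_pos_nonneg)
qed

lemma integrable_exp_neg_abs:
  assumes "c > 0" shows "integrable lborel (\<lambda>x::real. exp (- c * \<bar>x\<bar>))"
  by (rule Bochner_Integration.integrable_bound[OF integrable_cauchy[of "c\<^sup>2 / 2"]])
     (use assms exp_neg_le_cauchy(1)[OF assms] in auto)

lemma integrable_exp_neg_sq:
  assumes "c > 0" shows "integrable lborel (\<lambda>x::real. exp (- c * x\<^sup>2))"
  by (rule Bochner_Integration.integrable_bound[OF integrable_cauchy[OF assms]])
     (use assms exp_neg_le_cauchy(2)[OF assms] in auto)

lemma integrable_lebn_prod:
  fixes f :: "nat \<Rightarrow> real \<Rightarrow> 'a::{real_normed_field, banach, second_countable_topology}"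
  assumes "\<And>i. i < d \<Longrightarrow> integrable lborel (f i)"
  shows "integrable (lebn d) (\<lambda>x. \<Prod>i<d. f i (x i))"
  using assms by (intro LB.product_integrable_prod) auto

lemma integral_lebn_prod:
  fixes f :: "nat \<Rightarrow> real \<Rightarrow> 'a::{real_normed_field, banach, second_countable_topology}"
  assumes "\<And>i. i < d \<Longrightarrow> integrable lborel (f i)"
  shows "(\<integral>x. (\<Prod>i<d. f i (x i)) \<partial>lebn d) = (\<Prod>i<d. integral\<^sup>L lborel (f i))"
  using assms by (intro LB.product_integral_prod) auto

lemma (in pair_sigma_finite) integrable_pair_mult:
  fixes f :: "'a \<Rightarrow> 'c::{real_normed_field, banach, second_countable_topology}"
  assumes [measurable]: "integrable M1 f" "integrable M2 g"
  shows "integrable (M1 \<Otimes>\<^sub>M M2) (\<lambda>x. f (fst x) * g (snd x))"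
proof (rule Fubini_integrable)
  show "integrable M1 (\<lambda>x. \<integral>y. norm (f (fst (x, y)) * g (snd (x, y))) \<partial>M2)"
    using assms by (simp add: norm_mult)
  show "AE x in M1. integrable M2 (\<lambda>y. f (fst (x, y)) * g (snd (x, y)))" using assms by simp
qed simp

lemma (in pair_sigma_finite) integral_pair_mult:
  fixes f :: "'a \<Rightarrow> 'c::{real_normed_field, banach, second_countable_topology}"
  assumes "integrable M1 f" "integrable M2 g"
  shows "(\<integral>x. f (fst x) * g (snd x) \<partial>(M1 \<Otimes>\<^sub>M M2)) = integral\<^sup>L M1 f * integral\<^sup>L M2 g"
  using integral_fst'[OF integrable_pair_mult[OF assms]] by simp

section \<open>Slices of the shifted orthant\<close>

abbreviation gauss :: "real \<Rightarrow> complex" where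
  "gauss x \<equiv> complex_of_real (exp (- (1/2) * x\<^sup>2))"

abbreviation gauss_mass :: real where
  "gauss_mass \<equiv> \<integral>x. exp (- (1/2) * x\<^sup>2) \<partial>lborel"

text \<open>\<open>expo 0\<close> is the density of a standard exponential variable minus
  \<open>1\<close>, the law of \<open>w j * x j - 1\<close> under \<open>P_{n,w}\<close>; the
  parameter \<open>\<zeta>\<close> is an exponential tilt.\<close>

definition expo :: "complex \<Rightarrow> real \<Rightarrow> complex" where
  "expo \<zeta> x = (if - 1 \<le> x then exp (\<zeta> * x - (x + 1)) else 0)"

lemma measurable_expo[measurable]: "expo \<zeta> \<in> borel_measurable borel"
  unfolding expo_def by measurable

text \<open>A tilt by at most \<open>1/2\<close> leaves half of the exponential decay. The constant
  \<open>1\<close> in the exponent is dictated by \<open>x = - 1\<close>, where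
  \<open>exp (- (x + 1))\<close> does not help against \<open>Re \<zeta> = - 1/2\<close>.\<close>

lemma norm_expo_le:
  assumes "\<bar>Re \<zeta>\<bar> \<le> 1/2"
  shows "norm (expo \<zeta> x) \<le> exp (1 - \<bar>x\<bar> / 2)"
proof (cases "- 1 \<le> x")
  case True
  have "Re \<zeta> * x \<le> \<bar>Re \<zeta>\<bar> * \<bar>x\<bar>" by (simp flip: abs_mult)
  also have "\<dots> \<le> 1/2 * \<bar>x\<bar>" using assms by (intro mult_right_mono) auto
  finally have "Re \<zeta> * x - (x + 1) \<le> 1 - \<bar>x\<bar> / 2" using True by linarith
  then show ?thesis using True by (simp add: expo_def)
qed (simp add: expo_def)

lemma integrable_expo:
  assumes "\<bar>Re \<zeta>\<bar> \<le> 1/2"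
  shows "integrable lborel (expo \<zeta>)"
proof (rule Bochner_Integration.integrable_bound)
  show "integrable lborel (\<lambda>x::real. exp 1 * exp (- (1/2) * \<bar>x\<bar>))"
    using integrable_exp_neg_abs[of "1/2"] by simp
  show "AE x in lborel. norm (expo \<zeta> x) \<le> norm (exp 1 * exp (- (1/2) * \<bar>x\<bar>))"
    using norm_expo_le[OF assms] by (intro AE_I2) (simp add: exp_add[symmetric])
qed simp

lemma integral_expo:
  assumes \<zeta>: "\<bar>Re \<zeta>\<bar> \<le> 1/2"
  shows "(\<integral>x. expo \<zeta> x \<partial>lborel) = exp (- \<zeta>) / (1 - \<zeta>)"
proof -
  have ne: "1 - \<zeta> \<noteq> 0" using \<zeta> by auto
  let ?f = "\<lambda>x::real. exp (\<zeta> * x - (x + 1))" and ?F = "\<lambda>x::real. - exp (\<zeta> * x - (x + 1)) / (1 - \<zeta>)"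
  have F: "(?F has_vector_derivative ?f x) (at x)" for x
  proof -
    let ?e = "exp (\<zeta> * x - (x + 1))"
    have "((\<lambda>w. exp (\<zeta> * w - (w + 1))) has_field_derivative ?e * (\<zeta> - 1)) (at (complex_of_real x))"
      by (auto intro!: derivative_eq_intros)
    from DERIV_cdivide[OF DERIV_minus[OF this], of "1 - \<zeta>"]
    have "((\<lambda>w. - exp (\<zeta> * w - (w + 1)) / (1 - \<zeta>)) has_field_derivative - (?e * (\<zeta> - 1)) / (1 - \<zeta>)) (at (complex_of_real x))" .
    also have "- (?e * (\<zeta> - 1)) / (1 - \<zeta>) = ?e" using ne by (simp add: divide_eq_eq algebra_simps)
    finally have "((\<lambda>w. - exp (\<zeta> * w - (w + 1)) / (1 - \<zeta>)) has_field_derivative ?e) (at (complex_of_real x))" .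
    from has_vector_derivative_real_field[OF this] show ?thesis by simp
  qed
  have eq: "expo \<zeta> x = indicator {- 1<..} x *\<^sub>R ?f x" if "x \<noteq> - 1" for x
    using that by (auto simp: expo_def indicator_def)
  have AEeq: "AE x in lborel. expo \<zeta> x = indicator {- 1<..} x *\<^sub>R ?f x"
    using AE_lborel_singleton[of "- 1::real"] eq by auto
  have ei: "einterval (- 1) \<infinity> = {- 1<..}"
    by (auto simp: einterval_def) (metis ereal_less(2) less_ereal.simps(1) one_ereal_def uminus_ereal.simps(1))+
  have int: "set_integrable lborel (einterval (- 1) \<infinity>) ?f"
    unfolding set_integrable_def ei
    using integrable_cong_AE[OF _ _ AEeq] integrable_expo[OF \<zeta>] by simp
  have "(LBINT x=-1..\<infinity>. ?f x) = 0 - ?F (- 1)"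
  proof (rule interval_integral_FTC_integrable[OF _ F _ int])
    show "((?F \<circ> real_of_ereal) \<longlongrightarrow> ?F (- 1)) (at_right (- 1))"
      unfolding one_ereal_def uminus_ereal.simps ereal_tendsto_simps
      by (intro tendsto_eq_intros refl | (use ne in simp))+
    show "((?F \<circ> real_of_ereal) \<longlongrightarrow> 0) (at_left \<infinity>)"
      unfolding ereal_tendsto_simps
    proof (rule tendsto_norm_zero_cancel, rule tendsto_0_le[where K = "1 / norm (1 - \<zeta>)"])
      show "((\<lambda>x. exp (- (1 - Re \<zeta>) * x)) \<longlongrightarrow> 0) at_top"
        using \<zeta> by (intro filterlim_compose[OF exp_at_bot] filterlim_tendsto_neg_mult_at_bot[OF tendsto_const]) (auto intro: filterlim_ident)
      show "\<forall>\<^sub>F x in at_top. norm (norm (?F x)) \<le> norm (exp (- (1 - Re \<zeta>) * x)) * (1 / norm (1 - \<zeta>))"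
        by (intro always_eventually allI) (auto simp: norm_divide algebra_simps intro!: divide_right_mono)
    qed
  qed (auto intro!: continuous_intros simp: one_ereal_def)
  also have "0 - ?F (- 1) = exp (- \<zeta>) / (1 - \<zeta>)" by simp
  also have "(LBINT x=-1..\<infinity>. ?f x) = (\<integral>x. indicator {- 1<..} x *\<^sub>R ?f x \<partial>lborel)"
    by (simp add: interval_lebesgue_integral_def set_lebesgue_integral_def ei)
  also have "\<dots> = (\<integral>x. expo \<zeta> x \<partial>lborel)"
    by (rule integral_cong_AE) (use AEeq in auto)
  finally show ?thesis .
qed

definition zeta :: "nat \<Rightarrow> (nat \<Rightarrow> nat \<Rightarrow> real) \<Rightarrow> (nat \<Rightarrow> real) \<Rightarrow> complex \<Rightarrow> (nat \<Rightarrow> real) \<Rightarrow> nat \<Rightarrow> complex" where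
  "zeta m Q h z t j = z * h j + \<i> * (\<Sum>i<m. t i * Q i j)"

text \<open>The joint transform \<open>E exp (z * (h . y) + \<i> * (t . Q y))\<close> for
  independent \<open>y j\<close>, each a standard exponential minus \<open>1\<close>; see
  \<open>integral_expo\<close> and \<open>fourier_G\<close>.\<close>

definition psi :: "nat \<Rightarrow> nat \<Rightarrow> (nat \<Rightarrow> nat \<Rightarrow> real) \<Rightarrow> (nat \<Rightarrow> real) \<Rightarrow> complex \<Rightarrow> (nat \<Rightarrow> real) \<Rightarrow> complex" where
  "psi m n Q h z t = (\<Prod>j<n. exp (- zeta m Q h z t j) / (1 - zeta m Q h z t j))"

lemma measurable_zeta[measurable]: "(\<lambda>t. zeta m Q h z t j) \<in> borel_measurable (lebn m)"
  unfolding zeta_def by measurable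

lemma measurable_psi[measurable]: "psi m n Q h z \<in> borel_measurable (lebn m)"
  unfolding psi_def by measurable

section \<open>Linear coordinates adapted to the slice\<close>

lemma abs_le_L2_set: "\<bar>x k\<bar> \<le> L2_set x {..<n}" if "k < n" for x :: "nat \<Rightarrow> real"
  using member_le_L2_set[of "{..<n}" k "\<lambda>k. \<bar>x k\<bar>"] that by (simp add: L2_set_def)

lemma emeasure_lebn_space: "emeasure (lebn d) (space (lebn d)) \<noteq> 0"
  using LB.emeasure_PiM[of "{..<d}" "\<lambda>_. UNIV"] by (simp add: space_PiM)

lemma integral_positive:
  fixes f :: "'a \<Rightarrow> real"
  assumes f: "integrable M f" "\<And>x. f x > 0" and M: "emeasure M (space M) \<noteq> 0"
  shows "0 < integral\<^sup>L M f"
proof -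
  have "integral\<^sup>L M f \<noteq> 0"
  proof
    assume "integral\<^sup>L M f = 0"
    then have "AE x in M. f x = 0"
      using f by (subst (asm) integral_nonneg_eq_0_iff_AE) (auto simp: less_imp_le)
    then have "AE x in M. False" by eventually_elim (use f(2) in \<open>metis less_irrefl\<close>)
    then obtain N where N: "space M \<subseteq> N" "emeasure M N = 0" "N \<in> sets M" by (auto elim!: AE_E)
    from emeasure_mono[OF N(1,3)] N(2) M show False by simp
  qed
  moreover have "0 \<le> integral\<^sup>L M f" using f(2) by (intro integral_nonneg_AE) (auto simp: less_imp_le)
  ultimately show ?thesis by simp
qed

text \<open>The points \<open>p + \<Sum>k<d. v k * B k\<close> fill the kernel of \<open>Q\<close>.
  The rows of \<open>B\<close> come from a parametrization that is isometric only in the original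
  coordinates, so \<open>coercive\<close> takes the place of orthonormality; \<open>ones\<close> is
  the trace of \<open>w\<close> being in the row span of \<open>A\<close>.\<close>

locale slice =
  fixes m n d :: nat and Q B :: "nat \<Rightarrow> nat \<Rightarrow> real" and p :: "nat \<Rightarrow> real" and \<omega> :: real
  assumes Q: "orthonormal m n Q"
    and Qp: "\<And>i. i < m \<Longrightarrow> (\<Sum>j<n. Q i j * p j) = 0"
    and QB: "\<And>i k. i < m \<Longrightarrow> k < d \<Longrightarrow> (\<Sum>j<n. Q i j * B k j) = 0"
    and span: "\<And>y. (\<And>i. i < m \<Longrightarrow> (\<Sum>j<n. Q i j * y j) = 0) \<Longrightarrow> \<exists>v. \<forall>j<n. y j = (\<Sum>k<d. v k * B k j)"
    and omega: "\<omega> > 0"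
    and coercive: "\<And>v. (\<Sum>j<n. (\<Sum>k<d. v k * B k j)\<^sup>2) \<ge> \<omega>\<^sup>2 * (\<Sum>k<d. (v k)\<^sup>2)"
    and ones: "\<And>j. j < n \<Longrightarrow> 1 = (\<Sum>i<m. (\<Sum>k<n. Q i k) * Q i j)"
begin

definition kap :: "(nat \<Rightarrow> real) \<Rightarrow> nat \<Rightarrow> real" where
  "kap v j = p j + (\<Sum>k<d. v k * B k j)"

text \<open>\<open>u\<close> holds the values of \<open>Q\<close> at the point (see
  \<open>Q_T\<close>), \<open>v\<close> moves along the fibre, and \<open>u = 0\<close> is the slice
  itself.\<close>

definition T :: "(nat \<Rightarrow> real) \<times> (nat \<Rightarrow> real) \<Rightarrow> nat \<Rightarrow> real" where
  "T = (\<lambda>(u, v). \<lambda>j\<in>{..<n}. (\<Sum>i<m. u i * Q i j) + kap v j)"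

abbreviation P where "P \<equiv> lebn m \<Otimes>\<^sub>M lebn d"

sublocale PS: pair_sigma_finite "lebn m" "lebn d"
  by (rule pair_sigma_finite_lebn)

lemma T_apply: "j < n \<Longrightarrow> T (u, v) j = (\<Sum>i<m. u i * Q i j) + kap v j"
  by (simp add: T_def)

lemma Q_kap: "i < m \<Longrightarrow> (\<Sum>j<n. Q i j * kap v j) = 0"
proof -
  assume i: "i < m"
  have "(\<Sum>j<n. Q i j * kap v j) = (\<Sum>j<n. Q i j * p j) + (\<Sum>j<n. \<Sum>k<d. v k * (Q i j * B k j))"
    by (simp add: kap_def distrib_left sum.distrib sum_distrib_left mult_ac)
  also have "(\<Sum>j<n. \<Sum>k<d. v k * (Q i j * B k j)) = (\<Sum>k<d. v k * (\<Sum>j<n. Q i j * B k j))"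
    by (subst sum.swap) (simp add: sum_distrib_left)
  finally show ?thesis using Qp QB i by simp
qed

text \<open>By \<open>ones\<close> the constant vector is a combination of rows of \<open>Q\<close>,
  to which the slice is orthogonal. This is what makes the exponential density constant on the
  slice.\<close>

lemma sum_kap: "(\<Sum>j<n. kap v j) = 0"
proof -
  have "(\<Sum>j<n. kap v j) = (\<Sum>j<n. (\<Sum>i<m. (\<Sum>k<n. Q i k) * Q i j) * kap v j)"
    using ones by (intro sum.cong) auto
  also have "\<dots> = (\<Sum>i<m. (\<Sum>k<n. Q i k) * (\<Sum>j<n. Q i j * kap v j))"
    by (rule sum_bilinear_swap)
  finally show ?thesis using Q_kap by simp
qed

lemma Q_T:
  assumes i: "i < m" shows "(\<Sum>j<n. Q i j * T (u, v) j) = u i"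
  using orthonormal_coeff[OF Q i, of u] Q_kap[OF i, of v]
  by (simp add: T_apply distrib_left sum.distrib)

lemma T_sq: "(\<Sum>j<n. (T (u, v) j)\<^sup>2) = (\<Sum>i<m. (u i)\<^sup>2) + (\<Sum>j<n. (kap v j)\<^sup>2)"
proof -
  have cross: "(\<Sum>j<n. (\<Sum>i<m. u i * Q i j) * kap v j) = 0"
    unfolding sum_bilinear_swap using Q_kap by simp
  have "(\<Sum>j<n. (T (u, v) j)\<^sup>2) = (\<Sum>j<n. (\<Sum>i<m. u i * Q i j)\<^sup>2) + 2 * (\<Sum>j<n. (\<Sum>i<m. u i * Q i j) * kap v j)
      + (\<Sum>j<n. (kap v j)\<^sup>2)"
    by (simp add: T_apply power2_sum sum.distrib sum_distrib_left[symmetric] mult.assoc)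
  then show ?thesis using orthonormal_Parseval[OF Q, of u u] cross by (simp add: power2_eq_square)
qed

text \<open>\<open>coercive\<close> bounds every single \<open>|v k|\<close> by the length of the
  \<open>B\<close>-part, and the triangle inequality removes the offset \<open>p\<close>. The
  denominator \<open>d + 1\<close> is positive also for \<open>d = 0\<close>.\<close>

lemma kap_ge: "\<omega> / (d + 1) * (\<Sum>k<d. \<bar>v k\<bar>) - L2_set p {..<n} \<le> L2_set (kap v) {..<n}"
proof -
  let ?Bv = "\<lambda>j. \<Sum>k<d. v k * B k j"
  have "L2_set ?Bv {..<n} = L2_set (\<lambda>j. kap v j + - p j) {..<n}" by (simp add: kap_def)
  also have "\<dots> \<le> L2_set (kap v) {..<n} + L2_set (\<lambda>j. - p j) {..<n}" by (rule L2_set_triangle_ineq)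
  finally have 1: "L2_set ?Bv {..<n} \<le> L2_set (kap v) {..<n} + L2_set p {..<n}" by (simp add: L2_set_def)
  have 2: "\<omega> * \<bar>v k\<bar> \<le> L2_set ?Bv {..<n}" if "k < d" for k
  proof -
    have "(\<omega> * \<bar>v k\<bar>)\<^sup>2 \<le> \<omega>\<^sup>2 * (\<Sum>k<d. (v k)\<^sup>2)"
      using that by (auto simp: power_mult_distrib intro!: mult_left_mono member_le_sum)
    also have "\<dots> \<le> (\<Sum>j<n. (?Bv j)\<^sup>2)" by (rule coercive)
    finally show ?thesis unfolding L2_set_def by (rule real_le_rsqrt)
  qed
  have "\<omega> * (\<Sum>k<d. \<bar>v k\<bar>) \<le> (\<Sum>k<d. L2_set ?Bv {..<n})"
    unfolding sum_distrib_left using 2 by (intro sum_mono) auto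
  also have "\<dots> \<le> (d + 1) * L2_set ?Bv {..<n}" by (simp add: distrib_right L2_set_nonneg)
  finally have "\<omega> / (d + 1) * (\<Sum>k<d. \<bar>v k\<bar>) \<le> L2_set ?Bv {..<n}" by (simp add: field_simps)
  with 1 show ?thesis by linarith
qed

text \<open>Growth along the fibre, uniform in \<open>u\<close>. In \<open>distr_T\<close> it is
  combined with \<open>sum_abs_T_ge_u\<close>; in \<open>norm_G_T\<close> it acts alone.\<close>

lemma sum_abs_T_ge_v: "\<omega> / (d + 1) * (\<Sum>k<d. \<bar>v k\<bar>) - L2_set p {..<n} \<le> (\<Sum>j<n. \<bar>T (u, v) j\<bar>)"
proof -
  note kap_ge[of v]
  also have "L2_set (kap v) {..<n} \<le> L2_set (T (u, v)) {..<n}"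
    unfolding L2_set_def T_sq by (simp add: sum_nonneg)
  also have "\<dots> \<le> (\<Sum>j<n. \<bar>T (u, v) j\<bar>)" by (rule L2_set_le_sum_abs)
  finally show ?thesis .
qed

lemma sum_abs_T_ge_u: "1 / (m + 1) * (\<Sum>i<m. \<bar>u i\<bar>) \<le> (\<Sum>j<n. \<bar>T (u, v) j\<bar>)"
proof -
  have "(\<Sum>i<m. \<bar>u i\<bar>) \<le> (\<Sum>i<m. L2_set u {..<m})"
    using abs_le_L2_set by (intro sum_mono) auto
  also have "\<dots> \<le> (m + 1) * L2_set u {..<m}" by (simp add: distrib_right L2_set_nonneg)
  finally have "1 / (m + 1) * (\<Sum>i<m. \<bar>u i\<bar>) \<le> L2_set u {..<m}" by (simp add: field_simps)
  also have "L2_set u {..<m} \<le> L2_set (T (u, v)) {..<n}"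
    unfolding L2_set_def T_sq by (simp add: sum_nonneg)
  also have "\<dots> \<le> (\<Sum>j<n. \<bar>T (u, v) j\<bar>)" by (rule L2_set_le_sum_abs)
  finally show ?thesis .
qed

lemma measurable_kap[measurable]: "(\<lambda>v. kap v j) \<in> borel_measurable (lebn d)"
  unfolding kap_def by measurable

lemma measurable_T[measurable]: "T \<in> measurable P (lebn n)"
  unfolding T_def split_beta
proof (rule measurable_restrict)
  fix j
  have "(\<lambda>x. kap (snd x) j) \<in> borel_measurable P"
    by (rule measurable_compose[OF measurable_snd measurable_kap])
  moreover have "(\<lambda>x. \<Sum>i<m. fst x i * Q i j) \<in> borel_measurable P"
    by (intro borel_measurable_sum borel_measurable_times measurable_fst_component) auto
  ultimately show "(\<lambda>x. (\<Sum>i<m. fst x i * Q i j) + kap (snd x) j) \<in> measurable P lborel" by simp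
qed

lemma measurable_rescale: "(\<lambda>x. (\<lambda>i\<in>{..<m}. \<delta> * fst x i, snd x)) \<in> measurable P P"
proof (rule measurable_Pair)
  show "(\<lambda>x. \<lambda>i\<in>{..<m}. \<delta> * fst x i) \<in> measurable P (lebn m)"
    by (rule measurable_restrict) (use measurable_fst_component in \<open>auto intro!: borel_measurable_times\<close>)
qed simp

text \<open>Any \<open>y\<close> splits into a combination of the rows of \<open>Q\<close> and a
  kernel vector, which \<open>span\<close> writes in terms of \<open>B\<close>. Translating the
  image by \<open>y\<close> is thus translating \<open>u\<close> and \<open>v\<close>, and Lebesgue
  measure absorbs that.\<close>

lemma T_translate:
  assumes "y \<in> space (lebn n)" and F[measurable]: "F \<in> borel_measurable (lebn n)"
  shows "(\<integral>\<^sup>+x. F (\<lambda>j\<in>{..<n}. T x j + y j) \<partial>P) = (\<integral>\<^sup>+x. F (T x) \<partial>P)"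
proof -
  define u' where "u' i = (\<Sum>j<n. Q i j * y j)" for i
  have "(\<Sum>j<n. Q i j * (y j - (\<Sum>i<m. u' i * Q i j))) = 0" if "i < m" for i
    using orthonormal_coeff[OF Q that, of u'] by (simp add: right_diff_distrib sum_subtractf u'_def)
  from span[OF this] obtain v' where v': "\<forall>j<n. y j - (\<Sum>i<m. u' i * Q i j) = (\<Sum>k<d. v' k * B k j)" by blast
  have T': "(\<lambda>j\<in>{..<n}. T (u, v) j + y j) = T (\<lambda>i\<in>{..<m}. u i + u' i, \<lambda>k\<in>{..<d}. v k + v' k)" for u v
  proof
    fix j
    show "(\<lambda>j\<in>{..<n}. T (u, v) j + y j) j = T (\<lambda>i\<in>{..<m}. u i + u' i, \<lambda>k\<in>{..<d}. v k + v' k) j"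
    proof (cases "j < n")
      case True
      then have "y j = (\<Sum>i<m. u' i * Q i j) + (\<Sum>k<d. v' k * B k j)" using v' by (simp add: algebra_simps)
      with True show ?thesis by (simp add: T_apply kap_def distrib_right sum.distrib)
    qed (simp add: T_def)
  qed
  have shift: "(\<lambda>u. \<lambda>i\<in>{..<e}. u i + s i) \<in> measurable (lebn e) (lebn e)" for e and s :: "nat \<Rightarrow> real"
    by (rule measurable_restrict) auto
  have FT[measurable]: "(\<lambda>x. F (T x)) \<in> borel_measurable P" by measurable
  have FT': "(\<lambda>x. F (T (\<lambda>i\<in>{..<m}. fst x i + u' i, \<lambda>k\<in>{..<d}. snd x k + v' k))) \<in> borel_measurable P"
    by (rule measurable_compose[OF measurable_Pair FT])
       (rule measurable_compose[OF measurable_fst shift] measurable_compose[OF measurable_snd shift])+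
  have FT'': "(\<lambda>x. F (T (fst x, \<lambda>k\<in>{..<d}. snd x k + v' k))) \<in> borel_measurable P"
    by (rule measurable_compose[OF measurable_Pair FT])
       (rule measurable_fst measurable_compose[OF measurable_snd shift])+
  have "(\<integral>\<^sup>+x. F (\<lambda>j\<in>{..<n}. T x j + y j) \<partial>P)
      = (\<integral>\<^sup>+x. F (T (\<lambda>i\<in>{..<m}. fst x i + u' i, \<lambda>k\<in>{..<d}. snd x k + v' k)) \<partial>P)"
    using T' by (intro nn_integral_cong) (metis prod.collapse)
  also have "\<dots> = (\<integral>\<^sup>+u. \<integral>\<^sup>+v. F (T (\<lambda>i\<in>{..<m}. u i + u' i, \<lambda>k\<in>{..<d}. v k + v' k)) \<partial>lebn d \<partial>lebn m)"
    using PS.M2.nn_integral_fst[OF FT'] by simp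
  also have "\<dots> = (\<integral>\<^sup>+u. \<integral>\<^sup>+v. F (T (u, \<lambda>k\<in>{..<d}. v k + v' k)) \<partial>lebn d \<partial>lebn m)"
  proof -
    have "(\<lambda>u. \<integral>\<^sup>+v. F (T (u, \<lambda>k\<in>{..<d}. v k + v' k)) \<partial>lebn d) \<in> borel_measurable (lebn m)"
      using PS.M2.borel_measurable_nn_integral_fst[OF FT''] by simp
    from nn_integral_lebn_translate[OF this, of u'] show ?thesis .
  qed
  also have "\<dots> = (\<integral>\<^sup>+u. \<integral>\<^sup>+v. F (T (u, v)) \<partial>lebn d \<partial>lebn m)"
  proof (rule nn_integral_cong)
    fix u assume u: "u \<in> space (lebn m)"
    have "(\<lambda>v. F (T (u, v))) \<in> borel_measurable (lebn d)"
      using measurable_compose[OF measurable_Pair1'[OF u, of "lebn d"] FT] by simp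
    from nn_integral_lebn_translate[OF this, of v']
    show "(\<integral>\<^sup>+v. F (T (u, \<lambda>k\<in>{..<d}. v k + v' k)) \<partial>lebn d) = (\<integral>\<^sup>+v. F (T (u, v)) \<partial>lebn d)" .
  qed
  also have "\<dots> = (\<integral>\<^sup>+x. F (T x) \<partial>P)" using PS.M2.nn_integral_fst[OF FT] by simp
  finally show ?thesis .
qed

lemma emeasure_P_space: "emeasure P (space P) \<noteq> 0"
  using PS.M2.emeasure_pair_measure_Times[of "space (lebn m)" "lebn m" "space (lebn d)"]
    emeasure_lebn_space[of m] emeasure_lebn_space[of d] by (simp add: space_pair_measure)

text \<open>The image measure is translation invariant, so uniqueness of Haar measure makes it a
  multiple of Lebesgue measure. The test function \<open>?g\<close> is symmetric and positive, with
  finite integral on both sides; \<open>c\<close> is the ratio of these integrals.\<close>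

lemma distr_T: "\<exists>c>0. distr P (lebn n) T = density (lebn n) (\<lambda>_. ennreal c)"
proof -
  let ?g = "\<lambda>y::nat \<Rightarrow> real. exp (- (1/2) * (\<Sum>j<n. \<bar>y j\<bar>))"
  have g_prod: "?g = (\<lambda>y. \<Prod>j<n. exp (- (1/2) * \<bar>y j\<bar>))"
    by (simp add: exp_sum sum_distrib_left)
  have [measurable]: "?g \<in> borel_measurable (lebn n)" by measurable
  have g_int: "integrable (lebn n) ?g"
    unfolding g_prod by (intro integrable_lebn_prod integrable_exp_neg_abs) simp
  \<comment> \<open>Both constants are a quarter of the growth rates in
    \<open>sum_abs_T_ge_u\<close> and \<open>sum_abs_T_ge_v\<close>: the factor \<open>1/2\<close>
    in \<open>?g\<close> is shared equally between the two bounds.\<close>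
  define a where "a = 1 / (4 * (m + 1))"
  define e where "e = \<omega> / (4 * (d + 1))"
  have a4: "4 * a = 1 / (m + 1)" by (simp add: a_def field_simps)
  have e4: "4 * e = \<omega> / (d + 1)" by (simp add: e_def field_simps)
  have ae: "a > 0" "e > 0" using omega by (auto simp: a_def e_def)
  let ?D = "\<lambda>x :: (nat \<Rightarrow> real) \<times> (nat \<Rightarrow> real). (exp (L2_set p {..<n}) * (\<Prod>i<m. exp (- a * \<bar>fst x i\<bar>))) * (\<Prod>k<d. exp (- e * \<bar>snd x k\<bar>))"
  have D_int: "integrable P ?D"
    by (rule PS.integrable_pair_mult)
       (intro integrable_mult_right integrable_lebn_prod integrable_exp_neg_abs ae)+
  have gT_int: "integrable P (\<lambda>x. ?g (T x))"
  proof (rule Bochner_Integration.integrable_bound[OF D_int])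
    show "AE x in P. norm (?g (T x)) \<le> norm (?D x)"
    proof (rule AE_I2)
      fix x :: "(nat \<Rightarrow> real) \<times> (nat \<Rightarrow> real)"
      obtain u v where x: "x = (u, v)" by force
      have "a * (\<Sum>i<m. \<bar>u i\<bar>) + e * (\<Sum>k<d. \<bar>v k\<bar>) - L2_set p {..<n} \<le> (1/2) * (\<Sum>j<n. \<bar>T x j\<bar>)"
      proof -
        have "4 * a * (\<Sum>i<m. \<bar>u i\<bar>) \<le> (\<Sum>j<n. \<bar>T x j\<bar>)"
          using sum_abs_T_ge_u[of u v] unfolding x a4 .
        moreover have "4 * e * (\<Sum>k<d. \<bar>v k\<bar>) - L2_set p {..<n} \<le> (\<Sum>j<n. \<bar>T x j\<bar>)"
          using sum_abs_T_ge_v[of v u] unfolding x e4 .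
        moreover have "0 \<le> L2_set p {..<n}" by (rule L2_set_nonneg)
        ultimately show ?thesis by linarith
      qed
      then have "?g (T x) \<le> exp (L2_set p {..<n} + - a * (\<Sum>i<m. \<bar>u i\<bar>) + - e * (\<Sum>k<d. \<bar>v k\<bar>))" by simp
      also have "\<dots> = ?D x" by (simp only: exp_add exp_sum sum_distrib_left x fst_conv snd_conv finite_lessThan)
      finally show "norm (?g (T x)) \<le> norm (?D x)" by (simp add: abs_prod)
    qed
  qed measurable
  define A where "A = (\<integral>y. ?g y \<partial>lebn n)"
  define M where "M = (\<integral>x. ?g (T x) \<partial>P)"
  have A: "A > 0"
    unfolding A_def by (rule integral_positive[OF g_int _ emeasure_lebn_space]) simp
  have M: "M > 0"
    unfolding M_def by (rule integral_positive[OF gT_int _ emeasure_P_space]) simp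
  have gA: "(\<integral>\<^sup>+y. ennreal (?g y) \<partial>lebn n) = ennreal A"
    unfolding A_def by (rule nn_integral_eq_integral[OF g_int]) simp
  have gM: "(\<integral>\<^sup>+x. ennreal (?g (T x)) \<partial>P) = ennreal M"
    unfolding M_def by (rule nn_integral_eq_integral[OF gT_int]) simp
  have "distr P (lebn n) T = density (lebn n) (\<lambda>_. ennreal (M / A))"
  proof (rule measure_eqI)
    fix E assume "E \<in> sets (distr P (lebn n) T)"
    then have E[measurable]: "E \<in> sets (lebn n)" by simp
    have "ennreal A * (\<integral>\<^sup>+x. indicator E (T x) \<partial>P) = (\<integral>\<^sup>+y. indicator E y \<partial>lebn n) * ennreal M"
      unfolding gA[symmetric] gM[symmetric]
    proof (rule haar_uniqueness)
      show "sigma_finite_measure P" by unfold_locales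
      show "ennreal (?g (\<lambda>j\<in>{..<n}. - y j)) = ennreal (?g y)" for y by simp
    qed (use T_translate in auto)
    also have "(\<integral>\<^sup>+x. indicator E (T x) \<partial>P) = emeasure (distr P (lebn n) T) E"
    proof -
      have "(\<integral>\<^sup>+y. indicator E y \<partial>distr P (lebn n) T) = (\<integral>\<^sup>+x. indicator E (T x) \<partial>P)"
        by (rule nn_integral_distr) auto
      then show ?thesis by simp
    qed
    finally have eq: "ennreal A * emeasure (distr P (lebn n) T) E = emeasure (lebn n) E * ennreal M" by simp
    have "emeasure (distr P (lebn n) T) E = ennreal (1 / A) * (ennreal A * emeasure (distr P (lebn n) T) E)"
      using A by (simp flip: mult.assoc ennreal_mult')
    also have "\<dots> = ennreal (M / A) * emeasure (lebn n) E"
      unfolding eq using A M by (simp add: ennreal_mult'[of "1/A" M, simplified] mult_ac)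
    finally show "emeasure (distr P (lebn n) T) E = emeasure (density (lebn n) (\<lambda>_. ennreal (M / A))) E"
      by (simp add: emeasure_density_const)
  qed simp
  then show ?thesis using A M by (intro exI[of _ "M / A"]) auto
qed

end

section \<open>Fourier inversion at the slice\<close>

lemma isCont_expo:
  assumes "x \<noteq> - 1"
  shows "isCont (expo \<zeta>) x"
proof (cases "x > - 1")
  case True
  have "\<forall>\<^sub>F y in nhds x. y \<in> {- 1<..}" by (rule eventually_nhds_in_open) (use True in auto)
  then have "\<forall>\<^sub>F y in nhds x. expo \<zeta> y = exp (\<zeta> * y - (y + 1))"
    by eventually_elim (simp add: expo_def)
  then show ?thesis by (subst isCont_cong) (auto intro!: continuous_intros)
next
  case False
  then have "\<forall>\<^sub>F y in nhds x. y \<in> {..< - 1}" using assms by (intro eventually_nhds_in_open) auto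
  then have "\<forall>\<^sub>F y in nhds x. expo \<zeta> y = 0"
    by eventually_elim (simp add: expo_def)
  then show ?thesis by (subst isCont_cong) auto
qed

lemma expo_mult_exp: "expo \<zeta> x * iexp (a * x) = expo (\<zeta> + \<i> * a) x"
  by (simp add: expo_def exp_add[symmetric] algebra_simps)

lemma integrable_std_normal_iexp:
  assumes "\<delta> > 0"
  shows "integrable lborel (\<lambda>t::real. complex_of_real (std_normal_density (\<delta> * t)) * iexp (x * t))"
proof (rule Bochner_Integration.integrable_bound)
  show "integrable lborel (\<lambda>t. exp (- (\<delta>\<^sup>2 / 2) * t\<^sup>2))"
    using assms by (intro integrable_exp_neg_sq) simp
  have "1 / sqrt (2 * pi) \<le> 1" using pi_ge_two by (simp add: real_le_lsqrt)
  then have "std_normal_density (\<delta> * t) \<le> exp (- (\<delta>\<^sup>2 / 2) * t\<^sup>2)" for t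
    using mult_right_mono[of "1 / sqrt (2 * pi)" 1 "exp (- (\<delta>\<^sup>2 / 2) * t\<^sup>2)"]
    by (simp add: std_normal_density_def power_mult_distrib)
  then show "AE t in lborel. norm (complex_of_real (std_normal_density (\<delta> * t)) * iexp (x * t))
      \<le> norm (exp (- (\<delta>\<^sup>2 / 2) * t\<^sup>2))"
    by (intro AE_I2) (simp add: norm_mult)
qed measurable

text \<open>The standard normal law has a Gaussian characteristic function; substituting
  \<open>\<delta> * t\<close> for the integration variable produces the prefactor
  \<open>\<delta>\<close>.\<close>

lemma gaussian_fourier:
  assumes \<delta>: "\<delta> > 0"
  shows "complex_of_real (exp (- (x / \<delta>)\<^sup>2 / 2)) =
    \<delta> * (\<integral>t. complex_of_real (std_normal_density (\<delta> * t)) * iexp (x * t) \<partial>lborel)"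
proof -
  have "complex_of_real (exp (- (x / \<delta>)\<^sup>2 / 2)) = char std_normal_distribution (x / \<delta>)"
    by (simp add: char_std_normal_distribution)
  also have "\<dots> = (\<integral>s. std_normal_density s *\<^sub>R iexp ((x / \<delta>) * s) \<partial>lborel)"
    unfolding char_def by (subst integral_density) (auto simp: mult.assoc)
  also have "\<dots> = \<bar>\<delta>\<bar> *\<^sub>R (\<integral>t. std_normal_density (0 + \<delta> * t) *\<^sub>R iexp ((x / \<delta>) * (0 + \<delta> * t)) \<partial>lborel)"
    using \<delta> by (intro lborel_integral_real_affine) simp
  also have "\<dots> = \<delta> * (\<integral>t. complex_of_real (std_normal_density (\<delta> * t)) * iexp (x * t) \<partial>lborel)"
    using \<delta> by (simp add: scaleR_conv_of_real)
  finally show ?thesis .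
qed

lemma gaussian_fourier_lebn:
  assumes \<delta>: "\<delta> > 0"
  shows "(\<Prod>i<m. complex_of_real (exp (- (x i / \<delta>)\<^sup>2 / 2))) =
    \<delta> ^ m * (\<integral>t. (\<Prod>i<m. complex_of_real (std_normal_density (\<delta> * t i)) * iexp (x i * t i)) \<partial>lebn m)"
proof -
  have "(\<integral>t. (\<Prod>i<m. complex_of_real (std_normal_density (\<delta> * t i)) * iexp (x i * t i)) \<partial>lebn m) =
      (\<Prod>i<m. \<integral>t. complex_of_real (std_normal_density (\<delta> * t)) * iexp (x i * t) \<partial>lborel)"
    by (rule integral_lebn_prod) (rule integrable_std_normal_iexp[OF \<delta>])
  then show ?thesis unfolding gaussian_fourier[OF \<delta>] by (simp only: prod.distrib prod_constant card_lessThan)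
qed

context slice
begin

definition G :: "(nat \<Rightarrow> real) \<Rightarrow> complex \<Rightarrow> (nat \<Rightarrow> real) \<Rightarrow> complex" where
  "G h z y = (\<Prod>j<n. expo (z * h j) (y j))"

lemma measurable_G[measurable]: "G h z \<in> borel_measurable (lebn n)"
  unfolding G_def by measurable

context
  fixes h :: "nat \<Rightarrow> real" and z :: complex
  assumes hz: "\<And>j. j < n \<Longrightarrow> \<bar>Re (z * h j)\<bar> \<le> 1/2"
begin

lemma norm_G: "norm (G h z y) \<le> exp (n - (1/2) * (\<Sum>j<n. \<bar>y j\<bar>))"
proof -
  have "norm (G h z y) \<le> (\<Prod>j<n. exp (1 - \<bar>y j\<bar> / 2))"
    unfolding G_def prod_norm[symmetric] by (intro prod_mono conjI norm_ge_zero norm_expo_le hz) auto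
  also have "\<dots> = exp (n - (1/2) * (\<Sum>j<n. \<bar>y j\<bar>))"
    by (simp add: exp_sum[symmetric] sum_subtractf sum_divide_distrib)
  finally show ?thesis .
qed

lemma integrable_G: "integrable (lebn n) (G h z)"
  unfolding G_def[abs_def] by (intro integrable_lebn_prod integrable_expo hz)

lemma fourier_G:
  "(\<integral>y. G h z y * iexp (\<Sum>i<m. (\<Sum>j<n. Q i j * y j) * t i) \<partial>lebn n) = psi m n Q h z t"
proof -
  have eq: "G h z y * iexp (\<Sum>i<m. (\<Sum>j<n. Q i j * y j) * t i) = (\<Prod>j<n. expo (zeta m Q h z t j) (y j))" for y
  proof -
    have "(\<Sum>i<m. (\<Sum>j<n. Q i j * y j) * t i) = (\<Sum>j<n. (\<Sum>i<m. t i * Q i j) * y j)"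
      unfolding sum_distrib_right by (subst sum.swap) (simp add: mult_ac)
    then have "iexp (\<Sum>i<m. (\<Sum>j<n. Q i j * y j) * t i) = (\<Prod>j<n. iexp ((\<Sum>i<m. t i * Q i j) * y j))"
      by (simp only: of_real_sum of_real_mult sum_distrib_left exp_sum finite_lessThan)
    then show ?thesis
      unfolding G_def zeta_def expo_mult_exp[symmetric] prod.distrib by simp
  qed
  have Re: "\<bar>Re (zeta m Q h z t j)\<bar> \<le> 1/2" if "j < n" for j
    using hz[OF that] by (simp add: zeta_def)
  show ?thesis unfolding eq psi_def
    by (subst integral_lebn_prod) (auto intro!: integrable_expo Re prod.cong simp: integral_expo[OF Re])
qed

text \<open>A majorant that does not depend on the smoothing width: the Gaussian weight controls
  \<open>u\<close>, and the growth of \<open>T\<close> along the fibre controls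
  \<open>v\<close>.\<close>

definition dominator :: "(nat \<Rightarrow> real) \<times> (nat \<Rightarrow> real) \<Rightarrow> real" where
  "dominator x = (exp (n + L2_set p {..<n}) * (\<Prod>i<m. exp (- (1/2) * (fst x i)\<^sup>2))) *
     (\<Prod>k<d. exp (- (\<omega> / (2 * (d + 1))) * \<bar>snd x k\<bar>))"

lemma integrable_dominator: "integrable P dominator"
  unfolding dominator_def[abs_def]
  by (rule PS.integrable_pair_mult)
     (intro integrable_mult_right integrable_lebn_prod integrable_exp_neg_abs integrable_exp_neg_sq;
      use omega in simp)+

text \<open>The point \<open>u'\<close> inside \<open>T\<close> is independent of the point
  \<open>u\<close> in the weight, so one majorant serves all rescaled arguments
  \<open>\<delta> * u\<close> and also \<open>u' = 0\<close>.\<close>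

lemma norm_G_T:
  "norm (G h z (T (u', v)) * (\<Prod>i<m. gauss (u i))) \<le> norm (dominator (u, v))"
proof -
  let ?e = "\<omega> / (2 * (d + 1))"
  have e2: "2 * ?e = \<omega> / (d + 1)" by (simp add: field_simps)
  have "2 * ?e * (\<Sum>k<d. \<bar>v k\<bar>) - L2_set p {..<n} \<le> (\<Sum>j<n. \<bar>T (u', v) j\<bar>)"
    using sum_abs_T_ge_v[of v u'] unfolding e2 .
  moreover have "0 \<le> L2_set p {..<n}" by (rule L2_set_nonneg)
  ultimately have "n - (1/2) * (\<Sum>j<n. \<bar>T (u', v) j\<bar>) \<le> (n + L2_set p {..<n}) + - ?e * (\<Sum>k<d. \<bar>v k\<bar>)"
    by linarith
  then have "exp (n - (1/2) * (\<Sum>j<n. \<bar>T (u', v) j\<bar>)) \<le> exp (n + L2_set p {..<n}) * (\<Prod>k<d. exp (- ?e * \<bar>v k\<bar>))"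
    by (simp only: exp_add[symmetric] exp_sum[symmetric] sum_distrib_left[symmetric] exp_le_cancel_iff finite_lessThan)
  with norm_G[of "T (u', v)"]
  have "norm (G h z (T (u', v))) \<le> exp (n + L2_set p {..<n}) * (\<Prod>k<d. exp (- ?e * \<bar>v k\<bar>))" by linarith
  then have "norm (G h z (T (u', v))) * (\<Prod>i<m. exp (- (1/2) * (u i)\<^sup>2)) \<le>
     exp (n + L2_set p {..<n}) * (\<Prod>k<d. exp (- ?e * \<bar>v k\<bar>)) * (\<Prod>i<m. exp (- (1/2) * (u i)\<^sup>2))"
    by (rule mult_right_mono) (intro prod_nonneg ballI exp_ge_zero)
  then show ?thesis
    by (simp add: dominator_def norm_mult abs_mult prod_norm[symmetric] abs_prod mult_ac)
qed

text \<open>Convolving the slice function with a Gaussian of width \<open>\<delta>\<close> makes Fourier inversion a mere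
  exchange of integrals; letting \<open>\<delta>\<close> tend to \<open>0\<close> recovers the slice at the origin.\<close>
lemma smoothed_inversion:
  assumes c: "c > 0" "distr P (lebn n) T = density (lebn n) (\<lambda>_. ennreal c)"
    and \<delta>: "\<delta> > 0"
  shows "(\<integral>x. G h z (T (\<lambda>i\<in>{..<m}. \<delta> * fst x i, snd x)) * (\<Prod>i<m. gauss (fst x i)) \<partial>P)
    = c * (\<integral>t. (\<Prod>i<m. complex_of_real (std_normal_density (\<delta> * t i))) * psi m n Q h z t \<partial>lebn m)"
proof -
  \<comment> \<open>\<open>f\<close> and \<open>H\<close> are the same smoothed function, on
    \<open>R^n\<close> and in the coordinates \<open>(u, v)\<close>. They agree because
    \<open>Q\<close> reads off \<open>u\<close> from \<open>T (u, v)\<close>.\<close>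
  define f where "f y = G h z y * (\<Prod>i<m. complex_of_real (exp (- ((\<Sum>j<n. Q i j * y j) / \<delta>)\<^sup>2 / 2)))" for y
  define H where "H x = G h z (T x) * (\<Prod>i<m. complex_of_real (exp (- (fst x i / \<delta>)\<^sup>2 / 2)))" for x
  have f_meas[measurable]: "f \<in> borel_measurable (lebn n)"
    unfolding f_def[abs_def] by measurable
  have f_int: "integrable (lebn n) f"
  proof (rule Bochner_Integration.integrable_bound[OF integrable_G])
    have "norm (f y) \<le> norm (G h z y) * 1" for y
      unfolding f_def norm_mult
      by (intro mult_left_mono norm_ge_zero) (auto simp: prod_norm[symmetric] intro!: prod_le_1)
    then show "AE y in lebn n. norm (f y) \<le> norm (G h z y)" by simp
  qed simp
  have H: "H x = f (T x)" for x
    by (cases x) (simp add: H_def f_def Q_T)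
  have H_int: "integrable P H"
  proof -
    have "integrable (distr P (lebn n) T) f"
      unfolding c(2) using f_int c(1) by (subst integrable_density) auto
    then show ?thesis unfolding H[abs_def] by (subst (asm) integrable_distr_eq) auto
  qed
  have H_c: "(\<integral>x. H x \<partial>P) = c * (\<integral>y. f y \<partial>lebn n)"
  proof -
    have "(\<integral>x. H x \<partial>P) = (\<integral>y. f y \<partial>distr P (lebn n) T)"
      unfolding H by (rule integral_distr[symmetric]) auto
    also have "\<dots> = c * (\<integral>y. f y \<partial>lebn n)"
      unfolding c(2) using c(1) by (subst integral_density) (auto simp: scaleR_conv_of_real)
    finally show ?thesis .
  qed
  let ?sc = "\<lambda>x. (\<lambda>i\<in>{..<m}. \<delta> * fst x i, snd x)"
  have Hs: "H (?sc x) = G h z (T (?sc x)) * (\<Prod>i<m. gauss (fst x i))" for x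
    using \<delta> by (simp add: H_def)
  have H_meas[measurable]: "H \<in> borel_measurable P" using H_int by simp
  have Hs_int: "integrable P (\<lambda>x. H (?sc x))"
  proof (rule Bochner_Integration.integrable_bound[OF integrable_dominator])
    show "(\<lambda>x. H (?sc x)) \<in> borel_measurable P" by (rule measurable_compose[OF measurable_rescale H_meas])
    show "AE x in P. norm (H (?sc x)) \<le> norm (dominator x)"
      unfolding Hs using norm_G_T by (intro AE_I2) (metis prod.collapse)
  qed
  \<comment> \<open>Zooming in on the slice by \<open>u = \<delta> * u'\<close> gives the Gaussian
    weight unit width and moves \<open>\<delta>\<close> into the argument of
    \<open>G\<close>.\<close>
  have "(\<integral>x. H x \<partial>P) = (\<integral>u. \<integral>v. H (u, v) \<partial>lebn d \<partial>lebn m)"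
    by (rule PS.integral_fst'[OF H_int, symmetric])
  also have "\<dots> = \<delta> ^ m * (\<integral>u. \<integral>v. H (\<lambda>i\<in>{..<m}. \<delta> * u i, v) \<partial>lebn d \<partial>lebn m)"
  proof -
    have "(\<lambda>u. \<integral>v. H (u, v) \<partial>lebn d) \<in> borel_measurable (lebn m)"
      using PS.integrable_fst'[OF H_int] by simp
    from integral_lebn_scale[OF this \<delta>] show ?thesis by simp
  qed
  also have "(\<integral>u. \<integral>v. H (\<lambda>i\<in>{..<m}. \<delta> * u i, v) \<partial>lebn d \<partial>lebn m) = (\<integral>x. H (?sc x) \<partial>P)"
    using PS.integral_fst'[OF Hs_int] by simp
  finally have lhs: "(\<integral>x. H x \<partial>P) = \<delta> ^ m * (\<integral>x. H (?sc x) \<partial>P)" .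
  define \<Phi> where "\<Phi> t = (\<Prod>i<m. complex_of_real (std_normal_density (\<delta> * t i)))" for t
  have \<Phi>_int: "integrable (lebn m) \<Phi>"
    unfolding \<Phi>_def[abs_def] using integrable_std_normal_iexp[OF \<delta>, of 0]
    by (intro integrable_lebn_prod) simp
  define E where "E y t = iexp (\<Sum>i<m. (\<Sum>j<n. Q i j * y j) * t i)" for y t
  have nE: "norm (E y t) = 1" for y t by (simp add: E_def)
  interpret R: pair_sigma_finite "lebn n" "lebn m" by (rule pair_sigma_finite_lebn)
  \<comment> \<open>The Gaussian weight is replaced by its Fourier representation, so that the
    integral over \<open>y\<close> becomes the transform \<open>psi\<close>.\<close>
  have f_eq: "f y = \<delta> ^ m * (\<integral>t. G h z y * \<Phi> t * E y t \<partial>lebn m)" for y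
  proof -
    have "(\<Prod>i<m. complex_of_real (std_normal_density (\<delta> * t i)) * iexp ((\<Sum>j<n. Q i j * y j) * t i))
        = \<Phi> t * E y t" for t
      unfolding \<Phi>_def E_def prod.distrib by (simp only: of_real_sum of_real_mult sum_distrib_left exp_sum finite_lessThan)
    with gaussian_fourier_lebn[OF \<delta>, where m = m and x = "\<lambda>i. \<Sum>j<n. Q i j * y j"]
    have "f y = G h z y * (\<delta> ^ m * (\<integral>t. \<Phi> t * E y t \<partial>lebn m))" by (simp add: f_def)
    also have "\<dots> = \<delta> ^ m * (\<integral>t. G h z y * (\<Phi> t * E y t) \<partial>lebn m)"
      by simp
    finally show ?thesis by (simp add: mult.assoc)
  qed
  have E_meas: "(\<lambda>x. E (fst x) (snd x)) \<in> borel_measurable (lebn n \<Otimes>\<^sub>M lebn m)"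
    unfolding E_def
    by (intro measurable_compose[OF _ borel_measurable_exp] borel_measurable_times borel_measurable_const
        measurable_compose[OF _ borel_measurable_of_real] borel_measurable_sum measurable_fst_component measurable_snd_component) auto
  have prod_int: "integrable (lebn n \<Otimes>\<^sub>M lebn m) (\<lambda>x. G h z (fst x) * \<Phi> (snd x))"
    by (rule R.integrable_pair_mult[OF integrable_G \<Phi>_int])
  have GE_int: "integrable (lebn n \<Otimes>\<^sub>M lebn m) (\<lambda>(y, t). G h z y * \<Phi> t * E y t)"
  proof (rule Bochner_Integration.integrable_bound[OF prod_int])
    show "(\<lambda>(y, t). G h z y * \<Phi> t * E y t) \<in> borel_measurable (lebn n \<Otimes>\<^sub>M lebn m)"
      unfolding split_beta by (rule borel_measurable_times[OF borel_measurable_integrable[OF prod_int] E_meas])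
  qed (auto simp: norm_mult nE)
  have "(\<integral>y. f y \<partial>lebn n) = \<delta> ^ m * (\<integral>y. \<integral>t. G h z y * \<Phi> t * E y t \<partial>lebn m \<partial>lebn n)"
    unfolding f_eq by simp
  also have "(\<integral>y. \<integral>t. G h z y * \<Phi> t * E y t \<partial>lebn m \<partial>lebn n) = (\<integral>t. \<integral>y. G h z y * \<Phi> t * E y t \<partial>lebn n \<partial>lebn m)"
    by (rule R.Fubini_integral[OF GE_int, symmetric])
  also have "\<dots> = (\<integral>t. \<Phi> t * psi m n Q h z t \<partial>lebn m)"
  proof (rule Bochner_Integration.integral_cong[OF refl])
    fix t
    have "(\<integral>y. G h z y * \<Phi> t * E y t \<partial>lebn n) = \<Phi> t * (\<integral>y. G h z y * E y t \<partial>lebn n)"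
      unfolding integral_mult_right_zero[symmetric] by (simp only: mult_ac)
    then show "(\<integral>y. G h z y * \<Phi> t * E y t \<partial>lebn n) = \<Phi> t * psi m n Q h z t"
      using fourier_G[of t] by (simp add: E_def)
  qed
  \<comment> \<open>One factor \<open>\<delta> ^ m\<close> comes from the rescaling of
    \<open>u\<close> and the other from the Fourier representation; they cancel.\<close>
  finally have "\<delta> ^ m * (\<integral>x. H (?sc x) \<partial>P) = \<delta> ^ m * (c * (\<integral>t. \<Phi> t * psi m n Q h z t \<partial>lebn m))"
    using H_c lhs by simp
  then have "(\<integral>x. H (?sc x) \<partial>P) = c * (\<integral>t. \<Phi> t * psi m n Q h z t \<partial>lebn m)" using \<delta> by simp
  then show ?thesis unfolding Hs \<Phi>_def .
qed

text \<open>\<open>expo\<close> jumps at \<open>- 1\<close>, so pointwise convergence of the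
  smoothed integrand is claimed only off the hyperplanes where some coordinate of the slice point is
  \<open>- 1\<close>.\<close>

lemma AE_kap_not_boundary: "AE v in lebn d. \<forall>j<n. kap v j \<noteq> - 1"
proof -
  have "\<forall>j\<in>{..<n}. AE v in lebn d. (p j + 1) + (\<Sum>k<d. v k * B k j) \<noteq> 0"
  proof (intro ballI AE_lebn_hyperplane)
    fix j assume j: "j \<in> {..<n}"
    \<comment> \<open>\<open>p\<close> is a kernel vector, hence a combination of the
      \<open>B k\<close>. If all \<open>B k j\<close> vanish, then \<open>p j = 0\<close> and
      coordinate \<open>j\<close> is constantly \<open>0\<close>, away from
      \<open>- 1\<close>.\<close>
    obtain v where "\<forall>j<n. p j = (\<Sum>k<d. v k * B k j)" using span[OF Qp] by blast
    then have "p j = 0" if "\<forall>k<d. B k j = 0" using j that by simp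
    then show "p j + 1 \<noteq> 0 \<or> (\<exists>k<d. B k j \<noteq> 0)" by (cases "\<forall>k<d. B k j = 0") auto
  qed
  then have "AE v in lebn d. \<forall>j\<in>{..<n}. (p j + 1) + (\<Sum>k<d. v k * B k j) \<noteq> 0"
    by (subst AE_finite_all) auto
  then show ?thesis by eventually_elim (auto simp: kap_def algebra_simps add_eq_0_iff)
qed

lemma AE_P_kap_not_boundary: "AE x in P. \<forall>j<n. kap (snd x) j \<noteq> - 1"
proof (rule PS.AE_pair_measure)
  have "(\<lambda>x. kap (snd x) j) \<in> borel_measurable P" for j
    by (rule measurable_compose[OF measurable_snd measurable_kap])
  then show "{x \<in> space P. \<forall>j<n. kap (snd x) j \<noteq> - 1} \<in> sets P" by measurable
  show "AE u in lebn m. AE v in lebn d. \<forall>j<n. kap (snd (u, v)) j \<noteq> - 1"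
    using AE_kap_not_boundary by simp
qed

text \<open>Both sides of \<open>smoothed_inversion\<close> converge by domination: the left by
  \<open>dominator\<close>, the right by \<open>norm (psi ...)\<close> because the standard normal
  density is at most \<open>1\<close>. The Gaussian mass arises on the left, the density at
  \<open>0\<close> on the right.\<close>

lemma limit_inversion:
  assumes c: "c > 0" "distr P (lebn n) T = density (lebn n) (\<lambda>_. ennreal c)"
    and psi: "integrable (lebn m) (psi m n Q h z)"
  shows "gauss_mass ^ m * (\<integral>v. G h z (kap v) \<partial>lebn d)
    = (c * std_normal_density 0 ^ m) * (\<integral>t. psi m n Q h z t \<partial>lebn m)"
proof -
  define \<delta> where "\<delta> N = 1 / real (Suc N)" for N
  have \<delta>: "\<delta> N > 0" for N by (simp add: \<delta>_def)
  have \<delta>0: "\<delta> \<longlonglongrightarrow> 0" unfolding \<delta>_def by (rule LIMSEQ_Suc[OF lim_1_over_n])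
  let ?g = "\<lambda>x. \<Prod>i<m. gauss (fst x i)"
  let ?L = "\<lambda>N x. G h z (T (\<lambda>i\<in>{..<m}. \<delta> N * fst x i, snd x)) * ?g x"
  have g_int: "integrable (lebn m) (\<lambda>u. \<Prod>i<m. gauss (u i))"
    by (intro integrable_lebn_prod integrable_of_real integrable_exp_neg_sq) simp
  have Gk: "(\<lambda>v. G h z (kap v)) \<in> borel_measurable (lebn d)"
    unfolding G_def by measurable
  have Gk_int: "integrable (lebn d) (\<lambda>v. G h z (kap v))"
  proof (rule Bochner_Integration.integrable_bound[OF _ Gk])
    let ?b = "\<lambda>v::nat \<Rightarrow> real. exp (n + L2_set p {..<n}) * (\<Prod>k<d. exp (- (\<omega> / (2 * (d + 1))) * \<bar>v k\<bar>))"
    show "integrable (lebn d) ?b"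
      by (intro integrable_mult_right integrable_lebn_prod integrable_exp_neg_abs) (use omega in simp)
    have "norm (G h z (kap v)) \<le> norm (?b v)" for v
    proof -
      have "G h z (T (\<lambda>_. 0, v)) = G h z (kap v)" by (simp add: G_def T_apply)
      then show ?thesis using norm_G_T[of "\<lambda>_. 0" v "\<lambda>_. 0"] by (simp add: dominator_def)
    qed
    then show "AE v in lebn d. norm (G h z (kap v)) \<le> norm (?b v)" by simp
  qed
  have pair_int: "integrable P (\<lambda>x. ?g x * G h z (kap (snd x)))"
    by (rule PS.integrable_pair_mult[OF g_int Gk_int])
  have T_meas: "(\<lambda>x. T (\<lambda>i\<in>{..<m}. \<delta> N * fst x i, snd x)) \<in> measurable P (lebn n)" for N
    by (rule measurable_compose[OF measurable_rescale measurable_T])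
  have g_meas: "?g \<in> borel_measurable P"
    using measurable_compose[OF measurable_fst borel_measurable_integrable[OF g_int]] by simp
  have L_lim: "(\<lambda>N. \<integral>x. ?L N x \<partial>P) \<longlonglongrightarrow> (\<integral>x. ?g x * G h z (kap (snd x)) \<partial>P)"
  proof (rule integral_dominated_convergence[OF _ _ integrable_dominator])
    show "(\<lambda>x. ?g x * G h z (kap (snd x))) \<in> borel_measurable P" using pair_int by simp
    show "?L N \<in> borel_measurable P" for N
      by (intro borel_measurable_times measurable_compose[OF T_meas measurable_G] g_meas)
    show "AE x in P. norm (?L N x) \<le> dominator x" for N
    proof (rule AE_I2)
      fix x
      have "dominator x \<ge> 0" by (simp add: dominator_def prod_nonneg)
      then show "norm (?L N x) \<le> dominator x"
        using norm_G_T[of _ "snd x" "fst x"] by (metis prod.collapse real_norm_def abs_of_nonneg)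
    qed
    show "AE x in P. (\<lambda>N. ?L N x) \<longlonglongrightarrow> ?g x * G h z (kap (snd x))"
      using AE_P_kap_not_boundary
    proof eventually_elim
      case (elim x)
      have "(\<lambda>N. T (\<lambda>i\<in>{..<m}. \<delta> N * fst x i, snd x) j) \<longlonglongrightarrow> kap (snd x) j" if j: "j < n" for j
      proof -
        have "(\<lambda>N. (\<Sum>i<m. \<delta> N * fst x i * Q i j) + kap (snd x) j) \<longlonglongrightarrow> (\<Sum>i<m. 0 * fst x i * Q i j) + kap (snd x) j"
          by (intro tendsto_intros \<delta>0)
        then show ?thesis using j by (simp add: T_apply)
      qed
      then have "(\<lambda>N. G h z (T (\<lambda>i\<in>{..<m}. \<delta> N * fst x i, snd x))) \<longlonglongrightarrow> G h z (kap (snd x))"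
        unfolding G_def using elim by (intro tendsto_prod isCont_tendsto_compose[OF isCont_expo]) auto
      then have "(\<lambda>N. ?L N x) \<longlonglongrightarrow> G h z (kap (snd x)) * ?g x" by (intro tendsto_intros)
      then show ?case by (simp only: mult.commute)
    qed
  qed
  have L_val: "(\<integral>x. ?g x * G h z (kap (snd x)) \<partial>P) =
      complex_of_real gauss_mass ^ m * (\<integral>v. G h z (kap v) \<partial>lebn d)"
  proof -
    have "(\<integral>u. (\<Prod>i<m. gauss (u i)) \<partial>lebn m) =
        (\<Prod>i<m. \<integral>x. gauss x \<partial>lborel)"
      by (rule integral_lebn_prod) (intro integrable_of_real integrable_exp_neg_sq, simp)
    then show ?thesis unfolding PS.integral_pair_mult[OF g_int Gk_int] by simp
  qed
  let ?R = "\<lambda>N t. (\<Prod>i<m. complex_of_real (std_normal_density (\<delta> N * t i))) * psi m n Q h z t"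
  have R_lim: "(\<lambda>N. \<integral>t. ?R N t \<partial>lebn m) \<longlonglongrightarrow>
      (\<integral>t. (\<Prod>i<m. complex_of_real (std_normal_density 0)) * psi m n Q h z t \<partial>lebn m)"
  proof (rule integral_dominated_convergence[OF _ _ integrable_norm[OF psi]])
    show "(\<lambda>t. (\<Prod>i<m. complex_of_real (std_normal_density 0)) * psi m n Q h z t) \<in> borel_measurable (lebn m)"
      by measurable
    show "?R N \<in> borel_measurable (lebn m)" for N by measurable
    have "1 / sqrt (2 * pi) \<le> 1" using pi_ge_two by (simp add: real_le_lsqrt)
    then have le1: "std_normal_density x \<le> 1" for x
      using mult_mono[of "1 / sqrt (2 * pi)" 1 "exp (- x\<^sup>2 / 2)" 1]
      by (simp add: std_normal_density_def)
    have "norm (\<Prod>i<m. complex_of_real (std_normal_density (\<delta> N * t i))) \<le> 1" for N t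
      unfolding prod_norm[symmetric] using le1 by (intro prod_le_1) auto
    then show "AE t in lebn m. norm (?R N t) \<le> norm (psi m n Q h z t)" for N
      by (intro AE_I2) (simp add: norm_mult mult_left_le_one_le)
    have sd: "(\<lambda>N. std_normal_density (\<delta> N * a)) \<longlonglongrightarrow> std_normal_density 0" for a
    proof -
      have "(\<lambda>N. std_normal_density (\<delta> N * a)) \<longlonglongrightarrow> std_normal_density (0 * a)"
        unfolding std_normal_density_def by (intro tendsto_intros \<delta>0) auto
      then show ?thesis by simp
    qed
    show "AE t in lebn m. (\<lambda>N. ?R N t) \<longlonglongrightarrow> (\<Prod>i<m. complex_of_real (std_normal_density 0)) * psi m n Q h z t"
      by (intro AE_I2 tendsto_intros sd)
  qed
  have "(\<lambda>N. \<integral>x. ?L N x \<partial>P) = (\<lambda>N. c * (\<integral>t. ?R N t \<partial>lebn m))"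
    using smoothed_inversion[OF c \<delta>] by (intro ext)
  then have "(\<lambda>N. \<integral>x. ?L N x \<partial>P) \<longlonglongrightarrow>
      c * (\<integral>t. (\<Prod>i<m. complex_of_real (std_normal_density 0)) * psi m n Q h z t \<partial>lebn m)"
    using tendsto_mult_left[OF R_lim, of "complex_of_real c"] by simp
  from LIMSEQ_unique[OF L_lim this] show ?thesis unfolding L_val by simp
qed

end

text \<open>The untilted density is \<open>exp (- (\<Sum>j<n. kap v j + 1))\<close> on the orthant,
  and \<open>sum_kap\<close> makes it the constant \<open>exp (- n)\<close>.\<close>

lemma G_kap:
  "G h z (kap v) = (if \<forall>j<n. - 1 \<le> kap v j then exp (z * (\<Sum>j<n. h j * kap v j)) else 0) * exp (- real n)"
proof (cases "\<forall>j<n. - 1 \<le> kap v j")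
  case True
  have "G h z (kap v) = (\<Prod>j<n. exp (z * h j * kap v j - (kap v j + 1)))"
    unfolding G_def using True by (intro prod.cong) (auto simp: expo_def)
  also have "\<dots> = exp (\<Sum>j<n. z * h j * kap v j - (kap v j + 1))" by (simp add: exp_sum)
  also have "(\<Sum>j<n. z * h j * kap v j - (kap v j + 1)) = z * (\<Sum>j<n. h j * kap v j) - of_real (\<Sum>j<n. kap v j) - n"
    by (simp add: sum_subtractf sum.distrib sum_distrib_left mult.assoc)
  finally show ?thesis using True by (simp add: sum_kap exp_diff exp_minus exp_of_real[symmetric] divide_inverse)
next
  case False
  then show ?thesis unfolding G_def by (auto simp: expo_def intro!: bexI)
qed

text \<open>\<open>C\<close> is quantified before \<open>h\<close> and \<open>z\<close>, which lets
  it cancel when the formula is divided by its instance at \<open>z = 0\<close>.\<close>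

lemma inversion:
  "\<exists>C>0. \<forall>h (z::complex). (\<forall>j<n. \<bar>Re (z * h j)\<bar> \<le> 1/2) \<longrightarrow> integrable (lebn m) (psi m n Q h z) \<longrightarrow>
    (\<integral>v. (if \<forall>j<n. - 1 \<le> kap v j then exp (z * (\<Sum>j<n. h j * kap v j)) else 0) \<partial>lebn d) =
      complex_of_real C * (\<integral>t. psi m n Q h z t \<partial>lebn m)"
proof -
  obtain c where c: "c > 0" "distr P (lebn n) T = density (lebn n) (\<lambda>_. ennreal c)"
    using distr_T by blast
  define a where "a = gauss_mass"
  have a: "a > 0"
    unfolding a_def using integrable_exp_neg_sq[of "1/2"] by (intro integral_positive) auto
  define C where "C = exp n * (c * std_normal_density 0 ^ m) / a ^ m"
  have "C > 0" using a c by (simp add: C_def std_normal_density_def)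
  moreover have "(\<integral>v. (if \<forall>j<n. - 1 \<le> kap v j then exp (z * (\<Sum>j<n. h j * kap v j)) else 0) \<partial>lebn d) =
      complex_of_real C * (\<integral>t. psi m n Q h z t \<partial>lebn m)"
    if "\<forall>j<n. \<bar>Re (z * h j)\<bar> \<le> 1/2" "integrable (lebn m) (psi m n Q h z)" for h and z :: complex
  proof -
    let ?I = "\<integral>v. (if \<forall>j<n. - 1 \<le> kap v j then exp (z * (\<Sum>j<n. h j * kap v j)) else 0) \<partial>lebn d"
    have "complex_of_real a ^ m * (?I * exp (- real n)) = (c * std_normal_density 0 ^ m) * (\<integral>t. psi m n Q h z t \<partial>lebn m)"
      using limit_inversion[of z h c] that c unfolding G_kap a_def by simp
    then show ?thesis using a
      by (simp add: C_def exp_minus field_simps exp_of_real[symmetric])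
  qed
  ultimately show ?thesis by blast
qed

end

section \<open>Asymptotics of the Fourier integral\<close>

text \<open>The left side is the tail of the logarithm series from the cubic term on, compared with
  a geometric series of ratio at most \<open>1/2\<close>.\<close>

lemma Ln_one_minus_quadratic:
  fixes \<zeta> :: complex
  assumes "norm \<zeta> \<le> 1/2"
  shows "norm (Ln (1 - \<zeta>) + \<zeta> + \<zeta>\<^sup>2 / 2) \<le> 2 * norm \<zeta> ^ 3"
proof -
  have lt: "norm \<zeta> < 1" using assms by simp
  \<comment> \<open>The term at index \<open>0\<close> is \<open>0\<close> by division by zero, so
    the three terms split off below are \<open>0\<close>, \<open>- \<zeta>\<close> and
    \<open>- \<zeta>^2 / 2\<close>.\<close>
  let ?f = "\<lambda>n. - (\<zeta> ^ n) / of_nat n"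
  have "?f sums Ln (1 - \<zeta>)" using Ln_series'[of "- \<zeta>"] lt by simp
  from sums_split_initial_segment[OF this, of 3]
  have s: "(\<lambda>i. ?f (i + 3)) sums (Ln (1 - \<zeta>) + \<zeta> + \<zeta>\<^sup>2 / 2)"
    by (simp add: numeral_3_eq_3 numeral_2_eq_2 field_simps)
  have g: "summable (\<lambda>i. norm \<zeta> ^ 3 * norm \<zeta> ^ i)" using lt by (intro summable_mult summable_geometric) simp
  have "norm (?f (i + 3)) \<le> norm \<zeta> ^ 3 * norm \<zeta> ^ i" for i
  proof -
    have "norm (?f (i + 3)) = (norm \<zeta> ^ 3 * norm \<zeta> ^ i) / real (i + 3)"
      by (simp add: norm_divide norm_mult norm_power power_add mult.commute del: of_nat_add)
    also have "\<dots> \<le> norm \<zeta> ^ 3 * norm \<zeta> ^ i"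
      using mult_left_mono[of "1 / real (i + 3)" 1 "norm \<zeta> ^ 3 * norm \<zeta> ^ i"] by simp
    finally show ?thesis .
  qed
  from norm_suminf_le[OF this g] s
  have "norm (Ln (1 - \<zeta>) + \<zeta> + \<zeta>\<^sup>2 / 2) \<le> (\<Sum>i. norm \<zeta> ^ 3 * norm \<zeta> ^ i)" by (simp add: sums_iff)
  also have "\<dots> = norm \<zeta> ^ 3 * (1 / (1 - norm \<zeta>))"
    using lt by (simp add: suminf_mult suminf_geometric)
  also have "\<dots> \<le> norm \<zeta> ^ 3 * 2" using assms by (intro mult_left_mono) (auto simp: field_simps)
  finally show ?thesis by simp
qed

text \<open>Each factor is \<open>exp (\<zeta>^2 / 2)\<close> up to a relative error with cubic
  exponent. One power of the cube is bounded by \<open>e N\<close>, the remaining squares sum to at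
  most \<open>K\<close>.\<close>

lemma prod_exp_div_tendsto:
  fixes \<zeta> :: "nat \<Rightarrow> nat \<Rightarrow> complex"
  assumes max: "\<And>N j. j < n N \<Longrightarrow> norm (\<zeta> N j) \<le> e N" and e: "e \<longlonglongrightarrow> 0"
    and sq: "\<And>N. (\<Sum>j<n N. (norm (\<zeta> N j))\<^sup>2) \<le> K"
    and s: "\<And>N. (\<Sum>j<n N. (\<zeta> N j)\<^sup>2) = s"
  shows "(\<lambda>N. \<Prod>j<n N. exp (- \<zeta> N j) / (1 - \<zeta> N j)) \<longlonglongrightarrow> exp (s / 2)"
proof -
  define \<rho> where "\<rho> N = (\<Sum>j<n N. - \<zeta> N j - Ln (1 - \<zeta> N j))" for N
  have small: "\<forall>\<^sub>F N in sequentially. e N < 1/2" using e by (rule order_tendstoD) simp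
  have "(\<lambda>N. \<rho> N - s / 2) \<longlonglongrightarrow> 0"
  proof (rule Lim_null_comparison)
    show "(\<lambda>N. 2 * K * \<bar>e N\<bar>) \<longlonglongrightarrow> 0" by (intro tendsto_mult_right_zero tendsto_rabs_zero e)
    show "\<forall>\<^sub>F N in sequentially. norm (\<rho> N - s / 2) \<le> 2 * K * \<bar>e N\<bar>"
      using small
    proof eventually_elim
      case (elim N)
      have "\<rho> N - s / 2 = - (\<Sum>j<n N. Ln (1 - \<zeta> N j) + \<zeta> N j + (\<zeta> N j)\<^sup>2 / 2)"
        unfolding s[of N, symmetric] by (simp add: \<rho>_def sum.distrib sum_subtractf sum_negf sum_divide_distrib)
      then have "norm (\<rho> N - s / 2) \<le> (\<Sum>j<n N. norm (Ln (1 - \<zeta> N j) + \<zeta> N j + (\<zeta> N j)\<^sup>2 / 2))"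
        by (simp only: norm_minus_cancel norm_sum)
      also have "\<dots> \<le> (\<Sum>j<n N. 2 * \<bar>e N\<bar> * (norm (\<zeta> N j))\<^sup>2)"
      proof (intro sum_mono)
        fix j assume "j \<in> {..<n N}"
        then have j: "norm (\<zeta> N j) \<le> e N" using max by simp
        then have "norm (Ln (1 - \<zeta> N j) + \<zeta> N j + (\<zeta> N j)\<^sup>2 / 2) \<le> 2 * norm (\<zeta> N j) ^ 3"
          using elim by (intro Ln_one_minus_quadratic) simp
        also have "\<dots> = 2 * norm (\<zeta> N j) * (norm (\<zeta> N j))\<^sup>2" by (simp add: power2_eq_square power3_eq_cube)
        also have "\<dots> \<le> 2 * \<bar>e N\<bar> * (norm (\<zeta> N j))\<^sup>2" using j by (intro mult_right_mono) auto
        finally show "norm (Ln (1 - \<zeta> N j) + \<zeta> N j + (\<zeta> N j)\<^sup>2 / 2) \<le> 2 * \<bar>e N\<bar> * (norm (\<zeta> N j))\<^sup>2" .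
      qed
      also have "\<dots> = 2 * \<bar>e N\<bar> * (\<Sum>j<n N. (norm (\<zeta> N j))\<^sup>2)" by (simp add: sum_distrib_left)
      also have "\<dots> \<le> 2 * \<bar>e N\<bar> * K" by (intro mult_left_mono sq) simp
      finally show ?case by (simp add: mult_ac)
    qed
  qed
  then have "\<rho> \<longlonglongrightarrow> s / 2" by (simp add: LIM_zero_iff)
  then have lim: "(\<lambda>N. exp (\<rho> N)) \<longlonglongrightarrow> exp (s / 2)" by (rule tendsto_exp)
  have "\<forall>\<^sub>F N in sequentially. exp (\<rho> N) = (\<Prod>j<n N. exp (- \<zeta> N j) / (1 - \<zeta> N j))"
    using small
  proof eventually_elim
    case (elim N)
    have "exp (\<rho> N) = (\<Prod>j<n N. exp (- \<zeta> N j - Ln (1 - \<zeta> N j)))" by (simp add: \<rho>_def exp_sum)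
    also have "\<dots> = (\<Prod>j<n N. exp (- \<zeta> N j) / (1 - \<zeta> N j))"
    proof (rule prod.cong[OF refl])
      fix j assume "j \<in> {..<n N}"
      then have "norm (\<zeta> N j) < 1" using max[of j N] elim by simp
      then have "\<zeta> N j \<noteq> 1" by auto
      then show "exp (- \<zeta> N j - Ln (1 - \<zeta> N j)) = exp (- \<zeta> N j) / (1 - \<zeta> N j)"
        by (simp add: exp_diff)
    qed
    finally show ?case .
  qed
  from Lim_transform_eventually[OF lim this] show ?thesis .
qed

text \<open>By concavity \<open>1 + x \<ge> (1 + y) powr (x / y)\<close> on \<open>[0, y]\<close>.\<close>
lemma prod_one_plus_ge:
  fixes x :: "nat \<Rightarrow> real"
  assumes x: "\<And>j. j < n \<Longrightarrow> 0 \<le> x j" "\<And>j. j < n \<Longrightarrow> x j \<le> y"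
    and sum: "(\<Sum>j<n. x j) = real N * y" and y: "y \<ge> 0"
  shows "(1 + y) ^ N \<le> (\<Prod>j<n. 1 + x j)"
proof (cases "y = 0")
  case True
  then have "x j = 0" if "j < n" for j using x[OF that] by simp
  then show ?thesis using True by simp
next
  case False
  then have y: "y > 0" using y by simp
  define l where "l = ln (1 + y)"
  have el: "exp l = 1 + y" using y by (simp add: l_def)
  have "(1 + y) ^ N = exp (real N * l)" by (simp add: exp_of_nat_mult el)
  also have "real N * l = (\<Sum>j<n. x j / y * l)"
    using sum y by (simp add: sum_distrib_right[symmetric] sum_divide_distrib[symmetric])
  also have "exp \<dots> = (\<Prod>j<n. exp (x j / y * l))" by (simp add: exp_sum)
  also have "\<dots> \<le> (\<Prod>j<n. 1 + x j)"
  proof (intro prod_mono conjI exp_ge_zero)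
    fix j assume "j \<in> {..<n}"
    then have xj: "0 \<le> x j" "x j \<le> y" using x by auto
    have "exp ((1 - x j / y) *\<^sub>R 0 + (x j / y) *\<^sub>R l) \<le> (1 - x j / y) * exp 0 + (x j / y) * exp l"
      by (rule convex_onD[OF exp_convex]) (use xj y in auto)
    moreover have "(1 - x j / y) * 1 + (x j / y) * (1 + y) = 1 + x j" using y by (simp add: field_simps)
    ultimately show "exp (x j / y * l) \<le> 1 + x j" by (simp add: el)
  qed
  finally show ?thesis .
qed

section \<open>Bounds and limit of the Fourier integrand\<close>

lemma sqrt_prod: "sqrt (\<Prod>i\<in>A. f i) = (\<Prod>i\<in>A. sqrt (f i))"
  by (induction A rule: infinite_finite_induct) (simp_all add: real_sqrt_mult)

text \<open>The data left after standardization: \<open>h\<close> is a unit vector in the kernel of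
  \<open>Q\<close>, and the single number \<open>e\<close>, which later tends to \<open>0\<close>,
  bounds all entries of \<open>Q\<close> and \<open>h\<close>.\<close>

locale near_gaussian =
  fixes m n :: nat and Q :: "nat \<Rightarrow> nat \<Rightarrow> real" and h :: "nat \<Rightarrow> real" and e :: real
  assumes m: "m \<ge> 1" and Q: "orthonormal m n Q"
    and Qh: "\<And>i. i < m \<Longrightarrow> (\<Sum>j<n. Q i j * h j) = 0"
    and h1: "(\<Sum>j<n. (h j)\<^sup>2) = 1"
    and Q_le: "\<And>i j. i < m \<Longrightarrow> j < n \<Longrightarrow> \<bar>Q i j\<bar> \<le> e"
    and h_le: "\<And>j. j < n \<Longrightarrow> \<bar>h j\<bar> \<le> e"
begin

abbreviation lin :: "(nat \<Rightarrow> real) \<Rightarrow> nat \<Rightarrow> real" where "lin t j \<equiv> \<Sum>i<m. t i * Q i j"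

lemma e_nonneg: "e \<ge> 0"
proof -
  have "n \<noteq> 0" using h1 by (intro notI) simp
  then show ?thesis using h_le[of 0] by simp
qed

lemma sum_lin_sq: "(\<Sum>j<n. (lin t j)\<^sup>2) = (\<Sum>i<m. (t i)\<^sup>2)"
  using orthonormal_Parseval[OF Q, of t t] by (simp add: power2_eq_square)

lemma sum_h_lin: "(\<Sum>j<n. h j * lin t j) = 0"
proof -
  have "(\<Sum>j<n. lin t j * h j) = 0" unfolding sum_bilinear_swap using Qh by simp
  then show ?thesis by (simp only: mult.commute)
qed

lemma zeta_alt: "zeta m Q h z t j = z * of_real (h j) + \<i> * of_real (lin t j)"
  by (simp add: zeta_def)

lemma norm_zeta_split: "norm (zeta m Q h z t j) \<le> norm z * \<bar>h j\<bar> + \<bar>lin t j\<bar>"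
  unfolding zeta_alt using norm_triangle_ineq[of "z * of_real (h j)" "\<i> * of_real (lin t j)"]
  by (simp only: norm_mult norm_of_real norm_ii mult_1)

lemma sum_zeta_sq: "(\<Sum>j<n. (zeta m Q h z t j)\<^sup>2) = z\<^sup>2 - of_real (\<Sum>i<m. (t i)\<^sup>2)"
proof -
  have "(zeta m Q h z t j)\<^sup>2 = z\<^sup>2 * of_real ((h j)\<^sup>2) + 2 * \<i> * z * of_real (h j * lin t j) - of_real ((lin t j)\<^sup>2)" for j
    unfolding zeta_alt by (simp add: power2_sum power_mult_distrib)
  then have "(\<Sum>j<n. (zeta m Q h z t j)\<^sup>2) = z\<^sup>2 * of_real (\<Sum>j<n. (h j)\<^sup>2)
      + 2 * \<i> * z * of_real (\<Sum>j<n. h j * lin t j) - of_real (\<Sum>j<n. (lin t j)\<^sup>2)"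
    by (simp only: sum_subtractf sum.distrib sum_distrib_left of_real_sum)
  then show ?thesis unfolding h1 sum_h_lin sum_lin_sq by simp
qed

lemma sum_norm_zeta_sq: "(\<Sum>j<n. (norm (zeta m Q h z t j))\<^sup>2) \<le> 2 * (norm z)\<^sup>2 + 2 * (\<Sum>i<m. (t i)\<^sup>2)"
proof -
  have "(\<Sum>j<n. (norm (zeta m Q h z t j))\<^sup>2) \<le> (\<Sum>j<n. 2 * (norm z)\<^sup>2 * (h j)\<^sup>2 + 2 * (lin t j)\<^sup>2)"
  proof (intro sum_mono)
    fix j
    have "(norm (zeta m Q h z t j))\<^sup>2 \<le> (norm z * \<bar>h j\<bar> + \<bar>lin t j\<bar>)\<^sup>2" by (intro power_mono norm_zeta_split) auto
    also have "\<dots> \<le> 2 * (norm z * \<bar>h j\<bar>)\<^sup>2 + 2 * \<bar>lin t j\<bar>\<^sup>2"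
      using sum_squares_bound[of "norm z * \<bar>h j\<bar>" "\<bar>lin t j\<bar>"] by (simp add: power2_sum)
    finally show "(norm (zeta m Q h z t j))\<^sup>2 \<le> 2 * (norm z)\<^sup>2 * (h j)\<^sup>2 + 2 * (lin t j)\<^sup>2"
      by (simp add: power_mult_distrib)
  qed
  also have "\<dots> = 2 * (norm z)\<^sup>2 * (\<Sum>j<n. (h j)\<^sup>2) + 2 * (\<Sum>j<n. (lin t j)\<^sup>2)"
    by (simp add: sum.distrib sum_distrib_left)
  finally show ?thesis unfolding h1 sum_lin_sq by simp
qed

lemma abs_lin_le: "j < n \<Longrightarrow> \<bar>lin t j\<bar> \<le> e * (\<Sum>i<m. \<bar>t i\<bar>)"
proof -
  assume j: "j < n"
  have "\<bar>lin t j\<bar> \<le> (\<Sum>i<m. \<bar>t i\<bar> * \<bar>Q i j\<bar>)" using sum_abs[of "\<lambda>i. t i * Q i j"] by (simp add: abs_mult)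
  also have "\<dots> \<le> (\<Sum>i<m. \<bar>t i\<bar> * e)" using Q_le j by (intro sum_mono mult_left_mono) auto
  finally show ?thesis by (simp add: sum_distrib_left mult.commute)
qed

lemma norm_zeta_le: "j < n \<Longrightarrow> norm (zeta m Q h z t j) \<le> e * (norm z + (\<Sum>i<m. \<bar>t i\<bar>))"
proof -
  assume j: "j < n"
  note norm_zeta_split
  also have "norm z * \<bar>h j\<bar> + \<bar>lin t j\<bar> \<le> norm z * e + e * (\<Sum>i<m. \<bar>t i\<bar>)"
    using h_le[OF j] abs_lin_le[OF j] by (intro add_mono mult_left_mono) auto
  finally show ?thesis by (simp add: algebra_simps)
qed

text \<open>With \<open>r = Re \<zeta>\<close> and \<open>b = Im \<zeta>\<close>, the inequality
  \<open>1 - r \<le> 2\<close> extracts \<open>(1 - r)^2\<close> from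
  \<open>(1 - r)^2 + b^2\<close>, and the logarithm bound gives
  \<open>exp (- r) / (1 - r) \<le> exp (2 * r^2)\<close>.\<close>

lemma norm_factor_le:
  assumes "\<bar>Re \<zeta>\<bar> \<le> 1/2"
  shows "norm (exp (- \<zeta>) / (1 - \<zeta>)) \<le> exp (2 * (Re \<zeta>)\<^sup>2) * (1 / sqrt (1 + (Im \<zeta>)\<^sup>2 / 4))"
proof -
  let ?r = "Re \<zeta>" and ?b = "Im \<zeta>"
  have r: "1 - ?r > 0" "1 - ?r \<le> 2" using assms by linarith+
  have "(1 - ?r)\<^sup>2 * (1 + ?b\<^sup>2 / 4) \<le> (1 - ?r)\<^sup>2 + ?b\<^sup>2"
  proof -
    have "(1 - ?r)\<^sup>2 \<le> 2\<^sup>2" using r by (intro power_mono) auto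
    then have "(1 - ?r)\<^sup>2 * (?b\<^sup>2 / 4) \<le> 2\<^sup>2 * (?b\<^sup>2 / 4)" by (intro mult_right_mono) auto
    then show ?thesis by (simp add: distrib_left)
  qed
  also have "\<dots> = (norm (1 - \<zeta>))\<^sup>2" by (simp add: cmod_power2)
  finally have "sqrt ((1 - ?r)\<^sup>2 * (1 + ?b\<^sup>2 / 4)) \<le> norm (1 - \<zeta>)" by (intro real_le_lsqrt) auto
  then have n: "(1 - ?r) * sqrt (1 + ?b\<^sup>2 / 4) \<le> norm (1 - \<zeta>)" using r by (simp add: real_sqrt_mult)
  have pos: "sqrt (1 + ?b\<^sup>2 / 4) > 0" by (simp add: add_pos_nonneg)
  have "\<bar>ln (1 + - ?r) - - ?r\<bar> \<le> 2 * (- ?r)\<^sup>2" using assms by (intro abs_ln_one_plus_x_minus_x_bound) simp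
  then have "- ?r - ln (1 - ?r) \<le> 2 * ?r\<^sup>2" by (simp add: abs_le_iff)
  then have "exp (- ?r - ln (1 - ?r)) \<le> exp (2 * ?r\<^sup>2)" by simp
  then have ex: "exp (- ?r) / (1 - ?r) \<le> exp (2 * ?r\<^sup>2)" using r by (simp add: exp_diff)
  have "norm (exp (- \<zeta>) / (1 - \<zeta>)) = exp (- ?r) / norm (1 - \<zeta>)" by (simp add: norm_divide)
  also have "\<dots> \<le> exp (- ?r) / ((1 - ?r) * sqrt (1 + ?b\<^sup>2 / 4))"
    using n r pos by (intro divide_left_mono mult_pos_pos) (auto intro: order_less_le_trans[OF mult_pos_pos])
  also have "\<dots> = exp (- ?r) / (1 - ?r) * (1 / sqrt (1 + ?b\<^sup>2 / 4))" by simp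
  also have "\<dots> \<le> exp (2 * ?r\<^sup>2) * (1 / sqrt (1 + ?b\<^sup>2 / 4))" using ex pos by (intro mult_right_mono) auto
  finally show ?thesis .
qed

text \<open>The majorant does not depend on \<open>n\<close>. The real parts contribute only
  \<open>exp (2 * (Re z)^2)\<close> because \<open>h\<close> is a unit vector; the decay in
  \<open>t\<close> comes from the imaginary parts through \<open>prod_one_plus_ge\<close>.\<close>

lemma norm_psi_le:
  assumes e1: "e * norm z \<le> 1/2" and e2: "4 * (real m)\<^sup>2 * e\<^sup>2 \<le> 1"
  shows "norm (psi m n Q h z t) \<le> exp (2 * (Re z)\<^sup>2) * (\<Prod>i<m. 1 / (1 + 1 / (8 * real m) * (t i)\<^sup>2))"
proof -
  define b where "b j = Im (zeta m Q h z t j)" for j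
  define x where "x j = (b j)\<^sup>2 / 4" for j
  define S where "S = (\<Sum>i<m. (t i)\<^sup>2)"
  have S: "S \<ge> 0" by (simp add: S_def sum_nonneg)
  have b: "b j = Im z * h j + lin t j" for j by (simp add: b_def zeta_alt)
  have Re: "Re (zeta m Q h z t j) = Re z * h j" for j by (simp add: zeta_alt)
  have "(\<Sum>j<n. (b j)\<^sup>2) = (Im z)\<^sup>2 * (\<Sum>j<n. (h j)\<^sup>2) + 2 * Im z * (\<Sum>j<n. h j * lin t j) + (\<Sum>j<n. (lin t j)\<^sup>2)"
    unfolding b by (simp add: power2_sum sum.distrib sum_distrib_left[symmetric] power_mult_distrib mult.assoc)
  then have sumb: "(\<Sum>j<n. (b j)\<^sup>2) = (Im z)\<^sup>2 + S" unfolding h1 sum_h_lin sum_lin_sq S_def by simp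
  \<comment> \<open>The exponent \<open>2 * m\<close> is chosen because the modulus carries a square
    root: \<open>sqrt ((1 + y) ^ (2 * m)) = (1 + y) ^ m\<close> has one factor for each of the
    \<open>m\<close> integration variables.\<close>
  define y where "y = (\<Sum>j<n. x j) / real (2 * m)"
  have y_eq: "y = ((Im z)\<^sup>2 + S) / (8 * real m)"
    using sumb m by (simp add: y_def x_def sum_divide_distrib[symmetric])
  \<comment> \<open>No coordinate carries more than the fraction \<open>1 / (2 * m)\<close> of the
    total: its share is at most \<open>2 * m * e^2\<close>, and this is where
    \<open>4 * m^2 * e^2 \<le> 1\<close> enters.\<close>
  have xy: "x j \<le> y" if j: "j < n" for j
  proof -
    have "(lin t j)\<^sup>2 \<le> S * (\<Sum>i<m. (Q i j)\<^sup>2)" unfolding S_def by (rule Cauchy_Schwarz_ineq_sum)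
    also have "(\<Sum>i<m. (Q i j)\<^sup>2) \<le> (\<Sum>i<m. e\<^sup>2)"
      using Q_le[OF _ j] e_nonneg by (intro sum_mono) (metis abs_le_square_iff abs_of_nonneg lessThan_iff)
    finally have lin2: "(lin t j)\<^sup>2 \<le> S * (m * e\<^sup>2)" using S by (simp add: mult_left_mono)
    have "(h j)\<^sup>2 \<le> e\<^sup>2" using h_le[OF j] e_nonneg by (metis abs_le_square_iff abs_of_nonneg)
    also have "\<dots> \<le> m * e\<^sup>2" using m mult_right_mono[of 1 "real m" "e\<^sup>2"] by simp
    finally have "(Im z)\<^sup>2 * (h j)\<^sup>2 \<le> (Im z)\<^sup>2 * (m * e\<^sup>2)" by (intro mult_left_mono) auto
    moreover have "(b j)\<^sup>2 \<le> 2 * ((Im z)\<^sup>2 * (h j)\<^sup>2) + 2 * (lin t j)\<^sup>2"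
      unfolding b using sum_squares_bound[of "Im z * h j" "lin t j"] by (simp add: power2_sum power_mult_distrib)
    ultimately have "(b j)\<^sup>2 \<le> ((Im z)\<^sup>2 + S) * (2 * m * e\<^sup>2)" using lin2 by (simp add: algebra_simps)
    also have "\<dots> \<le> ((Im z)\<^sup>2 + S) * (1 / (2 * m))"
      using e2 m S by (intro mult_left_mono) (auto simp: field_simps power2_eq_square)
    finally have "(b j)\<^sup>2 / 4 \<le> ((Im z)\<^sup>2 + S) * (1 / (2 * m)) / 4" by (intro divide_right_mono) auto
    then show ?thesis by (simp add: x_def y_eq)
  qed
  have y0: "y \<ge> 0" using S by (simp add: y_eq)
  have "(1 + y) ^ (2 * m) \<le> (\<Prod>j<n. 1 + x j)"
    by (rule prod_one_plus_ge) (use xy m y0 in \<open>auto simp: y_def x_def\<close>)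
  then have "sqrt ((1 + y) ^ (2 * m)) \<le> sqrt (\<Prod>j<n. 1 + x j)" by simp
  moreover have "sqrt ((1 + y) ^ (2 * m)) = (1 + y) ^ m" using y0 by (simp add: power_mult real_sqrt_power power_even_eq)
  moreover have "(\<Prod>i<m. 1 + 1 / (8 * real m) * (t i)\<^sup>2) \<le> (\<Prod>i<m. 1 + y)"
  proof (intro prod_mono conjI)
    fix i assume i: "i \<in> {..<m}"
    have "(t i)\<^sup>2 \<le> S" unfolding S_def using i by (auto intro!: member_le_sum)
    then have "(t i)\<^sup>2 \<le> (Im z)\<^sup>2 + S" by (simp add: add_increasing)
    then show "1 + 1 / (8 * real m) * (t i)\<^sup>2 \<le> 1 + y" using m by (simp add: y_eq divide_right_mono)
  qed simp
  ultimately have le: "(\<Prod>i<m. 1 + 1 / (8 * real m) * (t i)\<^sup>2) \<le> sqrt (\<Prod>j<n. 1 + x j)" by simp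
  have pos: "0 < (\<Prod>i<m. 1 + 1 / (8 * real m) * (t i)\<^sup>2)" by (intro prod_pos) (auto intro!: add_pos_nonneg)
  have "norm (psi m n Q h z t) = (\<Prod>j<n. norm (exp (- zeta m Q h z t j) / (1 - zeta m Q h z t j)))"
    by (simp only: psi_def prod_norm)
  also have "\<dots> \<le> (\<Prod>j<n. exp (2 * (Re z * h j)\<^sup>2) * (1 / sqrt (1 + x j)))"
  proof (intro prod_mono conjI norm_ge_zero)
    fix j assume "j \<in> {..<n}"
    then have "\<bar>h j\<bar> \<le> e" using h_le by simp
    then have "\<bar>Re z\<bar> * \<bar>h j\<bar> \<le> norm z * e" by (intro mult_mono abs_Re_le_cmod) auto
    then have "\<bar>Re (zeta m Q h z t j)\<bar> \<le> 1/2" using e1 by (simp add: Re abs_mult mult.commute)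
    from norm_factor_le[OF this]
    show "norm (exp (- zeta m Q h z t j) / (1 - zeta m Q h z t j)) \<le> exp (2 * (Re z * h j)\<^sup>2) * (1 / sqrt (1 + x j))"
      unfolding Re b_def[symmetric] x_def[symmetric] .
  qed
  also have "\<dots> = exp (2 * (Re z)\<^sup>2) * (1 / sqrt (\<Prod>j<n. 1 + x j))"
  proof -
    have "(\<Prod>j<n. exp (2 * (Re z * h j)\<^sup>2)) = exp (2 * (Re z)\<^sup>2 * (\<Sum>j<n. (h j)\<^sup>2))"
      by (simp add: exp_sum[symmetric] sum_distrib_left power_mult_distrib mult.assoc)
    moreover have "(\<Prod>j<n. 1 / sqrt (1 + x j)) = 1 / sqrt (\<Prod>j<n. 1 + x j)"
      by (simp add: prod_dividef sqrt_prod)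
    ultimately show ?thesis unfolding prod.distrib h1 by simp
  qed
  also have "\<dots> \<le> exp (2 * (Re z)\<^sup>2) * (1 / (\<Prod>i<m. 1 + 1 / (8 * real m) * (t i)\<^sup>2))"
    using mult_pos_pos[OF order_less_le_trans[OF pos le] pos] le by (intro mult_left_mono divide_left_mono) auto
  finally show ?thesis by (simp add: prod_dividef)
qed

end

text \<open>The majorant of \<open>norm_psi_le\<close> is available once \<open>e N\<close> is small
  compared with \<open>norm z\<close> and \<open>m\<close>, so integrability is eventual and
  dominated convergence runs along the shifted sequence.\<close>

lemma psi_integral_tendsto:
  fixes Q :: "nat \<Rightarrow> nat \<Rightarrow> nat \<Rightarrow> real"
  assumes ng: "\<And>N. near_gaussian m (n N) (Q N) (h N) (e N)" and e: "e \<longlonglongrightarrow> 0"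
  shows "\<forall>\<^sub>F N in sequentially. integrable (lebn m) (psi m (n N) (Q N) (h N) z)"
    and "(\<lambda>N. \<integral>t. psi m (n N) (Q N) (h N) z t \<partial>lebn m) \<longlonglongrightarrow>
      exp (z\<^sup>2 / 2) * of_real (gauss_mass ^ m)"
proof -
  let ?psi = "\<lambda>N. psi m (n N) (Q N) (h N) z"
  have m: "m \<ge> 1" using ng[of 0] by (simp add: near_gaussian_def)
  let ?D = "\<lambda>t. exp (2 * (Re z)\<^sup>2) * (\<Prod>i<m. 1 / (1 + 1 / (8 * real m) * (t i)\<^sup>2))"
  have D: "integrable (lebn m) ?D"
    by (intro integrable_mult_right integrable_lebn_prod integrable_cauchy) (use m in simp)
  have "\<forall>\<^sub>F N in sequentially. e N * norm z < 1/2"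
    by (rule order_tendstoD(2)[OF tendsto_mult_left_zero[OF e]]) simp
  moreover have "\<forall>\<^sub>F N in sequentially. 4 * (real m)\<^sup>2 * (e N)\<^sup>2 < 1"
    by (rule order_tendstoD(2)[of _ "4 * (real m)\<^sup>2 * 0\<^sup>2"]) (auto intro!: tendsto_eq_intros e)
  ultimately have "\<forall>\<^sub>F N in sequentially. \<forall>t. norm (?psi N t) \<le> ?D t"
    by eventually_elim (intro allI near_gaussian.norm_psi_le[OF ng]; linarith)
  then obtain N0 where N0: "\<And>N t. N \<ge> N0 \<Longrightarrow> norm (?psi N t) \<le> ?D t"
    by (auto simp: eventually_sequentially)
  have D_nonneg: "?D t \<ge> 0" for t by (intro mult_nonneg_nonneg prod_nonneg) auto
  have "integrable (lebn m) (?psi N)" if "N \<ge> N0" for N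
  proof (rule Bochner_Integration.integrable_bound[OF D])
    show "AE t in lebn m. norm (?psi N t) \<le> norm (?D t)"
    proof (rule AE_I2)
      fix t
      show "norm (?psi N t) \<le> norm (?D t)" using N0[OF that, of t] unfolding real_norm_def by linarith
    qed
  qed simp
  then show "\<forall>\<^sub>F N in sequentially. integrable (lebn m) (?psi N)"
    by (auto simp: eventually_sequentially)
  let ?g = "\<lambda>t::nat \<Rightarrow> real. exp ((z\<^sup>2 - of_real (\<Sum>i<m. (t i)\<^sup>2)) / 2)"
  have g_eq: "?g t = exp (z\<^sup>2 / 2) * (\<Prod>i<m. gauss (t i))" for t
  proof -
    have "(z\<^sup>2 - of_real (\<Sum>i<m. (t i)\<^sup>2)) / 2 = z\<^sup>2 / 2 + of_real (\<Sum>i<m. - (1/2) * (t i)\<^sup>2)"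
      by (simp add: sum_distrib_left[symmetric] diff_divide_distrib sum_negf sum_divide_distrib[symmetric])
    then have "?g t = exp (z\<^sup>2 / 2) * of_real (exp (\<Sum>i<m. - (1/2) * (t i)\<^sup>2))"
      by (simp only: exp_add exp_of_real)
    then show ?thesis by (simp add: exp_sum)
  qed
  have lim: "(\<lambda>N. ?psi N t) \<longlonglongrightarrow> ?g t" for t
    unfolding psi_def
  proof (rule prod_exp_div_tendsto)
    show "norm (zeta m (Q N) (h N) z t j) \<le> e N * (norm z + (\<Sum>i<m. \<bar>t i\<bar>))" if "j < n N" for N j
      by (rule near_gaussian.norm_zeta_le[OF ng that])
    show "(\<lambda>N. e N * (norm z + (\<Sum>i<m. \<bar>t i\<bar>))) \<longlonglongrightarrow> 0"
      by (intro tendsto_mult_left_zero e)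
    show "(\<Sum>j<n N. (norm (zeta m (Q N) (h N) z t j))\<^sup>2) \<le> 2 * (norm z)\<^sup>2 + 2 * (\<Sum>i<m. (t i)\<^sup>2)" for N
      by (rule near_gaussian.sum_norm_zeta_sq[OF ng])
    show "(\<Sum>j<n N. (zeta m (Q N) (h N) z t j)\<^sup>2) = z\<^sup>2 - of_real (\<Sum>i<m. (t i)\<^sup>2)" for N
      by (rule near_gaussian.sum_zeta_sq[OF ng])
  qed
  have "(\<lambda>N. \<integral>t. ?psi (N + N0) t \<partial>lebn m) \<longlonglongrightarrow> (\<integral>t. ?g t \<partial>lebn m)"
  proof (rule integral_dominated_convergence[OF _ _ D])
    show "?g \<in> borel_measurable (lebn m)" by measurable
    show "AE t in lebn m. (\<lambda>N. ?psi (N + N0) t) \<longlonglongrightarrow> ?g t"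
      using lim by (intro AE_I2 LIMSEQ_ignore_initial_segment)
    show "AE t in lebn m. norm (?psi (N + N0) t) \<le> ?D t" for N
      by (intro AE_I2 N0) simp
  qed measurable
  then have "(\<lambda>N. \<integral>t. ?psi N t \<partial>lebn m) \<longlonglongrightarrow> (\<integral>t. ?g t \<partial>lebn m)"
    by (rule LIMSEQ_offset)
  also have "(\<integral>t. ?g t \<partial>lebn m) = exp (z\<^sup>2 / 2) * (\<integral>t. (\<Prod>i<m. gauss (t i)) \<partial>lebn m)"
    unfolding g_eq by simp
  also have "(\<integral>t. (\<Prod>i<m. gauss (t i)) \<partial>lebn m) =
      (\<Prod>i<m. \<integral>x. gauss x \<partial>lborel)"
    by (rule integral_lebn_prod) (intro integrable_of_real integrable_exp_neg_sq, simp)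
  finally show "(\<lambda>N. \<integral>t. ?psi N t \<partial>lebn m) \<longlonglongrightarrow>
      exp (z\<^sup>2 / 2) * of_real (gauss_mass ^ m)"
    by simp
qed

section \<open>Convergence of complex moment generating functions\<close>

lemma weak_conv_m_eventually:
  assumes "\<forall>\<^sub>F n in sequentially. M n = M' n" "weak_conv_m M' M0"
  shows "weak_conv_m M M0"
  unfolding weak_conv_m_def weak_conv_def
proof (intro allI impI)
  fix x assume "isCont (cdf M0) x"
  then have lim: "(\<lambda>n. cdf (M' n) x) \<longlonglongrightarrow> cdf M0 x" using assms(2) by (simp add: weak_conv_m_def weak_conv_def)
  have "\<forall>\<^sub>F n in sequentially. cdf (M' n) x = cdf (M n) x" using assms(1) by eventually_elim simp
  from Lim_transform_eventually[OF lim this] show "(\<lambda>n. cdf (M n) x) \<longlonglongrightarrow> cdf M0 x" .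
qed

lemma std_normal_real_distribution: "real_distribution std_normal_distribution"
proof -
  interpret prob_space std_normal_distribution by (rule prob_space_normal_density) simp
  show ?thesis by unfold_locales simp_all
qed

lemma weak_conv_std_normal:
  assumes ps: "\<forall>\<^sub>F n in sequentially. prob_space (U n) \<and> X n \<in> borel_measurable (U n)"
    and char: "\<And>t. (\<lambda>n. \<integral>x. iexp (t * X n x) \<partial>U n) \<longlonglongrightarrow> of_real (exp (- t\<^sup>2 / 2))"
  shows "weak_conv_m (\<lambda>n. distr (U n) borel (X n)) std_normal_distribution"
proof -
  define good where "good n \<longleftrightarrow> prob_space (U n) \<and> X n \<in> borel_measurable (U n)" for n
  \<comment> \<open>\<open>levy_continuity\<close> asks for a real distribution at every index, so
    the finitely many bad indices are filled with the limit law.\<close>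
  define M where "M n = (if good n then distr (U n) borel (X n) else std_normal_distribution)" for n
  have g: "\<forall>\<^sub>F n in sequentially. good n" using ps by (simp add: good_def)
  have "weak_conv_m M std_normal_distribution"
  proof (rule levy_continuity)
    show "real_distribution (M n)" for n
    proof (cases "good n")
      case True
      then have "prob_space (U n)" and X: "X n \<in> borel_measurable (U n)" by (simp_all add: good_def)
      then interpret prob_space "U n" by simp
      interpret D: prob_space "distr (U n) borel (X n)" by (rule prob_space_distr[OF X])
      have "real_distribution (distr (U n) borel (X n))" by unfold_locales simp_all
      then show ?thesis using True by (simp add: M_def)
    qed (simp add: M_def std_normal_real_distribution)
    show "real_distribution std_normal_distribution" by (rule std_normal_real_distribution)
    fix t
    have "\<forall>\<^sub>F n in sequentially. (\<integral>x. iexp (t * X n x) \<partial>U n) = char (M n) t"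
      using g
    proof eventually_elim
      case (elim n)
      then have [measurable]: "X n \<in> borel_measurable (U n)" by (simp add: good_def)
      show ?case using elim unfolding char_def M_def by (simp add: integral_distr)
    qed
    from Lim_transform_eventually[OF char this]
    show "(\<lambda>n. char (M n) t) \<longlonglongrightarrow> char std_normal_distribution t"
      by (simp only: char_std_normal_distribution)
  qed
  moreover have "\<forall>\<^sub>F n in sequentially. distr (U n) borel (X n) = M n"
    using g by eventually_elim (simp add: M_def)
  ultimately show ?thesis by (rule weak_conv_m_eventually[rotated])
qed

locale mgf_converges =
  fixes U :: "nat \<Rightarrow> 'a measure" and X :: "nat \<Rightarrow> 'a \<Rightarrow> real"
  assumes ps: "\<forall>\<^sub>F n in sequentially. prob_space (U n) \<and> X n \<in> borel_measurable (U n)"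
    and mgf: "\<And>z::complex. (\<lambda>n. \<integral>x. exp (z * X n x) \<partial>U n) \<longlonglongrightarrow> exp (z\<^sup>2 / 2)"
begin

lemma exp_i_sq: "exp ((\<i> * complex_of_real t)\<^sup>2 / 2) = of_real (exp (- t\<^sup>2 / 2))"
  by (simp only: exp_of_real[symmetric]) (simp add: power_mult_distrib)

lemma weak_conv: "weak_conv_m (\<lambda>n. distr (U n) borel (X n)) std_normal_distribution"
proof (rule weak_conv_std_normal[OF ps])
  fix t :: real
  show "(\<lambda>n. \<integral>x. iexp (t * X n x) \<partial>U n) \<longlonglongrightarrow> of_real (exp (- t\<^sup>2 / 2))"
    using mgf[of "\<i> * t"] unfolding exp_i_sq by (simp only: of_real_mult mult.assoc)
qed

text \<open>The limit of the integrals is nonzero, and a Bochner integral of a nonintegrable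
  function is \<open>0\<close>; convergence of the values therefore already yields integrability for
  large \<open>n\<close>.\<close>

lemma integrable_exp: "\<forall>\<^sub>F n in sequentially. integrable (U n) (\<lambda>x. exp (s * X n x))"
proof -
  have "\<forall>\<^sub>F n in sequentially. (\<integral>x. exp (complex_of_real s * X n x) \<partial>U n) \<noteq> 0"
    using mgf[of "of_real s"] by (rule tendsto_imp_eventually_ne) simp
  then show ?thesis
  proof eventually_elim
    case (elim n)
    then have "integrable (U n) (\<lambda>x. exp (complex_of_real s * X n x))"
      using not_integrable_integral_eq by blast
    from integrable_norm[OF this] show ?case by simp
  qed
qed

lemma real_mgf: "(\<lambda>n. \<integral>x. exp (s * X n x) \<partial>U n) \<longlonglongrightarrow> exp (s\<^sup>2 / 2)"
proof -
  have "(\<integral>x. exp (complex_of_real s * X n x) \<partial>U n) = of_real (\<integral>x. exp (s * X n x) \<partial>U n)" for n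
    unfolding integral_complex_of_real[symmetric] by (simp only: exp_of_real[symmetric] of_real_mult)
  moreover have "exp ((complex_of_real s)\<^sup>2 / 2) = of_real (exp (s\<^sup>2 / 2))"
    by (simp only: exp_of_real[symmetric]) simp
  ultimately have "(\<lambda>n. complex_of_real (\<integral>x. exp (s * X n x) \<partial>U n)) \<longlonglongrightarrow> complex_of_real (exp (s\<^sup>2 / 2))"
    using mgf[of "of_real s"] by simp
  then show ?thesis by (simp only: tendsto_of_real_iff)
qed

lemma integrable_X: "\<forall>\<^sub>F n in sequentially. integrable (U n) (X n)"
  using integrable_exp[of 1] integrable_exp[of "- 1"] ps
proof eventually_elim
  case (elim n)
  have "\<bar>x\<bar> \<le> exp x + exp (- x)" for x :: real
    using exp_ge_add_one_self[of x] exp_ge_add_one_self[of "- x"] exp_gt_zero[of x] exp_gt_zero[of "- x"] by linarith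
  then have b: "norm (X n x) \<le> norm (exp (1 * X n x) + exp (- 1 * X n x))" for x
    by (simp add: add_nonneg_nonneg)
  show ?case
    by (rule Bochner_Integration.integrable_bound[OF Bochner_Integration.integrable_add[OF elim(1,2)]])
       (use elim(3) b in auto)
qed

text \<open>Use \<open>s * E X \<le> E exp (s * X) - 1\<close> for small \<open>s\<close> of both signs.\<close>
lemma expectation_tendsto: "(\<lambda>n. \<integral>x. X n x \<partial>U n) \<longlonglongrightarrow> 0"
proof -
  have upper: "\<forall>\<^sub>F n in sequentially. sg * (\<integral>x. X n x \<partial>U n) < \<epsilon>"
    if \<epsilon>: "\<epsilon> > 0" and sg: "\<bar>sg\<bar> = 1" for \<epsilon> sg :: real
  proof -
    \<comment> \<open>\<open>s \<le> 1\<close> gives \<open>exp (s^2 / 2) \<le> 1 + s^2\<close>, and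
      \<open>s < \<epsilon>\<close> puts this strictly below \<open>1 + s * \<epsilon>\<close>. The
      sign \<open>sg\<close> selects the upper or the lower estimate of the mean.\<close>
    define s where "s = min 1 (\<epsilon> / 2)"
    have s: "0 < s" "s \<le> 1" "s < \<epsilon>" using \<epsilon> by (auto simp: s_def)
    have sg2: "sg\<^sup>2 = 1" using sg by (metis abs_power2 one_power2 power2_abs)
    have s2: "s\<^sup>2 \<le> 1" using s by (simp add: power_le_one)
    then have "exp (s\<^sup>2 / 2) \<le> 1 + s\<^sup>2 / 2 + (s\<^sup>2 / 2)\<^sup>2" by (intro exp_bound) auto
    also have "(s\<^sup>2 / 2)\<^sup>2 \<le> s\<^sup>2 / 2 * 1"
      unfolding power2_eq_square[of "s\<^sup>2 / 2"] using s2 by (intro mult_left_mono) auto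
    finally have "exp (s\<^sup>2 / 2) \<le> 1 + s * s" by (simp add: power2_eq_square)
    also have "\<dots> < 1 + s * \<epsilon>" using s by simp
    finally have "exp ((sg * s)\<^sup>2 / 2) < 1 + s * \<epsilon>" using sg2 by (simp add: power_mult_distrib)
    with real_mgf[of "sg * s"]
    have "\<forall>\<^sub>F n in sequentially. (\<integral>x. exp (sg * s * X n x) \<partial>U n) < 1 + s * \<epsilon>" by (rule order_tendstoD)
    then show ?thesis using integrable_exp[of "sg * s"] integrable_X ps
    proof eventually_elim
      case (elim n)
      interpret prob_space "U n" using elim by simp
      have "1 + sg * s * (\<integral>x. X n x \<partial>U n) = (\<integral>x. 1 + sg * s * X n x \<partial>U n)"
        using elim prob_space by simp
      also have "\<dots> \<le> (\<integral>x. exp (sg * s * X n x) \<partial>U n)"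
        using elim by (intro integral_mono) auto
      also have "\<dots> < 1 + s * \<epsilon>" by fact
      finally have "s * (sg * (\<integral>x. X n x \<partial>U n)) < s * \<epsilon>" by (simp add: mult_ac)
      then show ?case using s by simp
    qed
  qed
  show ?thesis
  proof (rule tendstoI)
    fix \<epsilon> :: real assume "\<epsilon> > 0"
    then have "\<forall>\<^sub>F n in sequentially. 1 * (\<integral>x. X n x \<partial>U n) < \<epsilon>" "\<forall>\<^sub>F n in sequentially. - 1 * (\<integral>x. X n x \<partial>U n) < \<epsilon>"
      by (intro upper; simp)+
    then show "\<forall>\<^sub>F n in sequentially. dist (\<integral>x. X n x \<partial>U n) 0 < \<epsilon>"
      by eventually_elim (auto simp: dist_real_def)
  qed
qed

text \<open>Subtracting the mean multiplies the characteristic function by a phase, which tends to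
  \<open>1\<close> by \<open>expectation_tendsto\<close>.\<close>

lemma weak_conv_centered:
  "weak_conv_m (\<lambda>n. distr (U n) borel (\<lambda>x. X n x - (\<integral>y. X n y \<partial>U n))) std_normal_distribution"
proof (rule weak_conv_std_normal)
  show "\<forall>\<^sub>F n in sequentially. prob_space (U n) \<and> (\<lambda>x. X n x - (\<integral>y. X n y \<partial>U n)) \<in> borel_measurable (U n)"
    using ps by eventually_elim auto
  fix t :: real
  let ?E = "\<lambda>n. \<integral>y. X n y \<partial>U n"
  have "(\<lambda>n. iexp (- t * ?E n) * (\<integral>x. exp (\<i> * t * X n x) \<partial>U n)) \<longlonglongrightarrow> iexp (- t * 0) * exp ((\<i> * t)\<^sup>2 / 2)"
    by (intro tendsto_intros mgf expectation_tendsto)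
  moreover have "iexp (- t * ?E n) * (\<integral>x. exp (\<i> * t * X n x) \<partial>U n) = (\<integral>x. iexp (t * (X n x - ?E n)) \<partial>U n)" for n
    unfolding integral_mult_right_zero[symmetric] exp_add[symmetric] by (simp add: algebra_simps)
  ultimately show "(\<lambda>n. \<integral>x. iexp (t * (X n x - ?E n)) \<partial>U n) \<longlonglongrightarrow> of_real (exp (- t\<^sup>2 / 2))"
    unfolding exp_i_sq by simp
qed

end

section \<open>The uniform distribution on the polytope\<close>

lemma integral_uniform_measure:
  fixes f :: "'a \<Rightarrow> complex"
  assumes A: "A \<in> sets M" "emeasure M A \<noteq> 0" "emeasure M A \<noteq> \<infinity>" and f[measurable]: "f \<in> borel_measurable M"
  shows "(\<integral>x. f x \<partial>uniform_measure M A) = (\<integral>x. indicator A x *\<^sub>R f x \<partial>M) / measure M A"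
proof -
  have em: "emeasure M A = ennreal (measure M A)" using A by (simp add: emeasure_eq_ennreal_measure)
  then have "measure M A \<noteq> 0" using A(2) by auto
  then have pos: "0 < measure M A" by (simp add: zero_less_measure_iff)
  from em have "uniform_measure M A = density M (\<lambda>x. ennreal (indicator A x / measure M A))"
    unfolding uniform_measure_def using pos
    by (intro arg_cong[where f = "density M"] ext) (auto simp: indicator_def divide_ennreal[symmetric])
  then have "(\<integral>x. f x \<partial>uniform_measure M A) = (\<integral>x. (indicator A x / measure M A) *\<^sub>R f x \<partial>M)"
    using A(1) by (simp add: integral_density)
  also have "\<dots> = (\<integral>x. (1 / measure M A) *\<^sub>R (indicator A x *\<^sub>R f x) \<partial>M)"
    by simp
  also have "\<dots> = (\<integral>x. indicator A x *\<^sub>R f x \<partial>M) / measure M A"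
    by (subst integral_scaleR_right) (simp add: scaleR_conv_of_real divide_inverse mult.commute)
  finally show ?thesis .
qed

text \<open>The inversion formula at \<open>z = 0\<close> computes the volume of the parameter
  domain; dividing the formula at \<open>z\<close> by it normalizes the measure and cancels
  \<open>C\<close>.\<close>

lemma unifK_mgf:
  fixes z :: complex
  assumes st: "standing m n A b"
  defines "Q \<equiv> Ahat m n A b" and "w \<equiv> wvec m n A b"
  assumes psi0: "integrable (lebn m) (psi m n Q h 0)" "(\<integral>t. psi m n Q h 0 t \<partial>lebn m) \<noteq> 0"
  shows "prob_space (unifK m n A b)" and "AE x in unifK m n A b. x \<in> Kset m n A b"
    and "\<lbrakk>\<And>j. j < n \<Longrightarrow> \<bar>Re (z * h j)\<bar> \<le> 1/2; integrable (lebn m) (psi m n Q h z)\<rbrakk> \<Longrightarrow>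
      (\<integral>x. exp (z * (\<Sum>j<n. h j * (w j * x j - 1))) \<partial>unifK m n A b) =
      (\<integral>t. psi m n Q h z t \<partial>lebn m) / (\<integral>t. psi m n Q h 0 t \<partial>lebn m)"
proof -
  define d where "d = n - m"
  define \<phi> where "\<phi> = (SOME \<phi>. orth_param m n A b \<phi>)"
  let ?K = "Kset m n A b"
  have wpos: "0 < w j" if "j < n" for j using is_wvec_wvec[OF st] that by (simp add: is_wvec_def w_def)
  obtain p B \<omega> where
    kap_eq: "\<And>y j. j < n \<Longrightarrow> w j * \<phi> y j - 1 = p j + (\<Sum>k<d. y k * B k j)"
    and sl: "\<And>i. i < m \<Longrightarrow> (\<Sum>j<n. Q i j * p j) = 0"
      "\<And>i k. i < m \<Longrightarrow> k < d \<Longrightarrow> (\<Sum>j<n. Q i j * B k j) = 0"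
      "\<And>y. (\<And>i. i < m \<Longrightarrow> (\<Sum>j<n. Q i j * y j) = 0) \<Longrightarrow> \<exists>v. \<forall>j<n. y j = (\<Sum>k<d. v k * B k j)"
      "\<omega> > 0" "\<And>v. (\<Sum>j<n. (\<Sum>k<d. v k * B k j)\<^sup>2) \<ge> \<omega>\<^sup>2 * (\<Sum>k<d. (v k)\<^sup>2)"
    and plane: "\<And>l y. l < m \<Longrightarrow> (\<Sum>j<n. A l j * \<phi> y j) = b l"
    and ext: "\<And>y. \<phi> y \<in> extensional {..<n}"
    and meas: "\<And>j. j < n \<Longrightarrow> (\<lambda>y. \<phi> y j) \<in> borel_measurable (lebn d)"
    using orth_param_standardized[OF st orth_param_exists[OF st]]
    unfolding \<phi>_def[symmetric] d_def[symmetric] Q_def[symmetric] w_def[symmetric] by blast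
  interpret slice m n d Q B p \<omega>
    using sl ones_row_span[OF st] Ahat_orthonormal[OF st] by unfold_locales (auto simp: Q_def)
  have kap: "w j * \<phi> y j - 1 = kap y j" if "j < n" for y j using kap_eq[OF that] by (simp add: kap_def)
  have \<phi>[measurable]: "\<phi> \<in> measurable (lebn d) (lebn n)"
    by (rule measurable_PiM_single') (use meas ext in \<open>auto simp: space_PiM PiE_iff\<close>)
  \<comment> \<open>The parametrization stays in the plane, so only the signs matter, and
    \<open>x j \<ge> 0\<close> reads \<open>w j * x j - 1 \<ge> - 1\<close>.\<close>
  have in_K: "\<phi> y \<in> ?K \<longleftrightarrow> (\<forall>j<n. - 1 \<le> kap y j)" for y
  proof -
    have "0 \<le> \<phi> y j \<longleftrightarrow> - 1 \<le> kap y j" if "j < n" for j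
      using wpos[OF that] by (simp add: kap[OF that, symmetric] zero_le_mult_iff)
    then show ?thesis using plane ext by (auto simp: Kset_def PiE_iff)
  qed
  define S where "S = {y \<in> space (lebn d). \<phi> y \<in> ?K}"
  have S: "S \<in> sets (lebn d)" unfolding S_def in_K by measurable
  have U: "unifK m n A b = distr (uniform_measure (lebn d) S) (lebn n) \<phi>"
    by (simp add: unifK_def Let_def \<phi>_def[symmetric] d_def[symmetric] S_def)
  obtain C where C: "C > 0" and inv: "\<And>h z. \<lbrakk>\<forall>j<n. \<bar>Re (z * of_real (h j))\<bar> \<le> 1/2; integrable (lebn m) (psi m n Q h z)\<rbrakk> \<Longrightarrow>
    (\<integral>v. (if \<forall>j<n. - 1 \<le> kap v j then exp (z * (\<Sum>j<n. h j * kap v j)) else 0) \<partial>lebn d) =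
      complex_of_real C * (\<integral>t. psi m n Q h z t \<partial>lebn m)"
    using inversion by blast
  have ind: "indicator S v *\<^sub>R f = (if \<forall>j<n. - 1 \<le> kap v j then f else 0)" if "v \<in> space (lebn d)" for v and f :: complex
    using that by (auto simp: S_def in_K)
  have I0: "(\<integral>v. indicator S v *\<^sub>R (1::complex) \<partial>lebn d) = C * (\<integral>t. psi m n Q h 0 t \<partial>lebn m)"
    using inv[of 0 h] psi0(1) by (subst Bochner_Integration.integral_cong[OF refl ind]) (auto cong: if_cong)
  \<comment> \<open>Again a nonzero Bochner integral implies integrability, here finite volume of
    the parameter domain.\<close>
  with C psi0(2) have "integrable (lebn d) (\<lambda>v. indicator S v *\<^sub>R (1::complex))"
    using not_integrable_integral_eq by fastforce
  from integrable_norm[OF this] have "integrable (lebn d) (indicator S :: _ \<Rightarrow> real)" by simp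
  then have fin: "emeasure (lebn d) S < \<infinity>" using S sets.sets_into_space[OF S] by (simp add: integrable_indicator_iff Int_absorb2)
  have vol: "complex_of_real (measure (lebn d) S) = C * (\<integral>t. psi m n Q h 0 t \<partial>lebn m)"
    using I0 S fin by (simp add: scaleR_conv_of_real)
  then have vol_ne: "measure (lebn d) S \<noteq> 0" using C psi0(2) by auto
  then have ne: "emeasure (lebn d) S \<noteq> 0" by (auto simp: measure_def)
  interpret UM: prob_space "uniform_measure (lebn d) S"
    by (rule prob_space_uniform_measure) (use ne fin in auto)
  have \<phi>'[measurable]: "\<phi> \<in> measurable (uniform_measure (lebn d) S) (lebn n)"
    using \<phi> by (simp cong: measurable_cong_sets)
  show "prob_space (unifK m n A b)" unfolding U by (rule UM.prob_space_distr) fact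
  show "AE x in unifK m n A b. x \<in> ?K"
  proof -
    have K: "{x \<in> space (lebn n). x \<in> ?K} \<in> sets (lebn n)"
      unfolding Kset_def by (simp add: space_PiM) measurable
    show ?thesis unfolding U
      by (subst AE_distr_iff[OF \<phi>' K]) (rule AE_uniform_measureI[OF S], auto simp: S_def)
  qed
  assume hz: "\<And>j. j < n \<Longrightarrow> \<bar>Re (z * h j)\<bar> \<le> 1/2" and psiz: "integrable (lebn m) (psi m n Q h z)"
  let ?F = "\<lambda>x. exp (z * (\<Sum>j<n. h j * (w j * x j - 1)))"
  have F[measurable]: "?F \<in> borel_measurable (lebn n)" by measurable
  have F\<phi>: "?F (\<phi> v) = exp (z * (\<Sum>j<n. h j * kap v j))" for v by (simp add: kap)
  have "(\<integral>x. ?F x \<partial>unifK m n A b) = (\<integral>v. ?F (\<phi> v) \<partial>uniform_measure (lebn d) S)"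
    unfolding U by (rule integral_distr) measurable
  also have "\<dots> = (\<integral>v. indicator S v *\<^sub>R ?F (\<phi> v) \<partial>lebn d) / measure (lebn d) S"
    by (rule integral_uniform_measure[OF S ne]) (use fin in simp, rule measurable_compose[OF \<phi> F])
  also have "(\<integral>v. indicator S v *\<^sub>R ?F (\<phi> v) \<partial>lebn d) = C * (\<integral>t. psi m n Q h z t \<partial>lebn m)"
    using inv[of z h] hz psiz unfolding F\<phi> by (subst Bochner_Integration.integral_cong[OF refl ind]) auto
  finally show "(\<integral>x. ?F x \<partial>unifK m n A b) = (\<integral>t. psi m n Q h z t \<partial>lebn m) / (\<integral>t. psi m n Q h 0 t \<partial>lebn m)"
    unfolding vol using C by simp
qed

section \<open>The projected weights on the polytope\<close>

lemma Kset_coordinate_bounded: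
  assumes "compact (Kset m n A b)"
  obtains c where "\<And>x. x \<in> Kset m n A b \<Longrightarrow> \<bar>x j\<bar> \<le> c"
proof -
  have "continuous_on (Kset m n A b) (\<lambda>x. x j)"
    by (rule continuous_on_subset[OF continuous_on_product_coordinates]) simp
  from compact_continuous_image[OF this assms] have "bounded ((\<lambda>x. x j) ` Kset m n A b)"
    by (rule compact_imp_bounded)
  then show ?thesis using that by (auto simp: bounded_iff)
qed

lemma mat_max_ge:
  assumes "i < m" "j < n" shows "\<bar>M i j\<bar> \<le> mat_max m n M"
proof -
  have "{\<bar>M i j\<bar> |i j. i < m \<and> j < n} = (\<lambda>(i, j). \<bar>M i j\<bar>) ` ({..<m} \<times> {..<n})" by auto
  then have "finite {\<bar>M i j\<bar> |i j. i < m \<and> j < n}" by simp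
  then show ?thesis unfolding mat_max_def using assms by (intro Max_ge) auto
qed

lemma vec_max_ge:
  assumes "j < n" shows "\<bar>v j\<bar> \<le> vec_max n v"
proof -
  have "{\<bar>v j\<bar> |j. j < n} = (\<lambda>j. \<bar>v j\<bar>) ` {..<n}" by auto
  then have "finite {\<bar>v j\<bar> |j. j < n}" by simp
  then show ?thesis unfolding vec_max_def using assms by (intro Max_ge) auto
qed

context
  fixes m n :: nat and A :: "nat \<Rightarrow> nat \<Rightarrow> real" and b lam :: "nat \<Rightarrow> real"
  assumes st: "standing m n A b"
begin

definition "pr = proj n (ker_mat m n (Ahat m n A b)) (lamhat m n A b lam)"

lemma pr_apply:
  "j < n \<Longrightarrow> pr j = lamhat m n A b lam j -
     (\<Sum>i<m. (\<Sum>k<n. Ahat m n A b i k * lamhat m n A b lam k) * Ahat m n A b i j)"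
  unfolding pr_def proj_kernel(1)[OF Ahat_orthonormal[OF st]] by simp

lemma Ahat_pr: "i < m \<Longrightarrow> (\<Sum>j<n. Ahat m n A b i j * pr j) = 0"
  using proj_kernel(3)[OF Ahat_orthonormal[OF st], of "lamhat m n A b lam"]
  unfolding pr_def proj_kernel(1)[OF Ahat_orthonormal[OF st]] by (simp add: ker_mat_def)

text \<open>Each coefficient of \<open>lamhat\<close> along a unit row of \<open>Ahat\<close> is at
  most \<open>enorm n lamhat\<close> by Cauchy-Schwarz, so the part removed by the projection has
  entries controlled by the entries of \<open>Ahat\<close>.\<close>

lemma abs_pr_le:
  assumes j: "j < n"
  shows "\<bar>pr j\<bar> \<le> vec_max n (lamhat m n A b lam) + m * (enorm n (lamhat m n A b lam) * mat_max m n (Ahat m n A b))"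
proof -
  let ?Q = "Ahat m n A b" and ?l = "lamhat m n A b lam"
  have c: "\<bar>\<Sum>k<n. ?Q i k * ?l k\<bar> \<le> enorm n ?l" if i: "i < m" for i
  proof -
    have "(\<Sum>k<n. ?Q i k * ?l k)\<^sup>2 \<le> (\<Sum>k<n. (?Q i k)\<^sup>2) * (\<Sum>k<n. (?l k)\<^sup>2)"
      by (rule Cauchy_Schwarz_ineq_sum)
    also have "(\<Sum>k<n. (?Q i k)\<^sup>2) = 1"
      using Ahat_orthonormal[OF st] i by (simp add: orthonormal_def power2_eq_square)
    finally show ?thesis unfolding enorm_def by (intro real_le_rsqrt) simp
  qed
  have "\<bar>\<Sum>i<m. (\<Sum>k<n. ?Q i k * ?l k) * ?Q i j\<bar> \<le> (\<Sum>i<m. \<bar>(\<Sum>k<n. ?Q i k * ?l k) * ?Q i j\<bar>)" by (rule sum_abs)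
  also have "\<dots> \<le> (\<Sum>i<m. enorm n ?l * mat_max m n ?Q)"
    unfolding abs_mult using c mat_max_ge[OF _ j, of _ m ?Q]
    by (intro sum_mono mult_mono) (auto simp: enorm_def sum_nonneg)
  finally show ?thesis unfolding pr_apply[OF j] using vec_max_ge[OF j, of ?l] by simp
qed

text \<open>On the polytope \<open>w * x - 1\<close> is in the kernel of \<open>Ahat\<close>, so
  pairing it with \<open>lamhat\<close> or with the projection of \<open>lamhat\<close> gives the
  same value.\<close>

lemma weighted_sum_eq:
  assumes x: "x \<in> Kset m n A b"
  shows "(\<Sum>j<n. lam j * (x j - 1 / wvec m n A b j)) = (\<Sum>j<n. pr j * (wvec m n A b j * x j - 1))"
proof -
  let ?Q = "Ahat m n A b" and ?l = "lamhat m n A b lam" and ?w = "wvec m n A b"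
  have wv: "is_wvec m n A b ?w" by (rule is_wvec_wvec[OF st])
  have wpos: "0 < ?w j" if "j < n" for j using wv that by (simp add: is_wvec_def)
  let ?y = "\<lambda>j. ?w j * x j - 1"
  have "(\<Sum>j<n. Atil m n A b i j * ?y j) = 0" if i: "i < m" for i
  proof -
    have "(\<Sum>j<n. Atil m n A b i j * ?y j) = (\<Sum>j<n. A i j * x j - A i j / ?w j)"
    proof (intro sum.cong refl)
      fix j assume "j \<in> {..<n}"
      then have "?w j > 0" using wpos by simp
      then show "Atil m n A b i j * ?y j = A i j * x j - A i j / ?w j" by (simp add: Atil_def field_simps)
    qed
    then show ?thesis using x wv i by (simp add: sum_subtractf Kset_def is_wvec_def)
  qed
  then have Qy: "(\<Sum>j<n. ?Q i j * ?y j) = 0" if "i < m" for i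
    using whiten_kernel[OF full_row_rank_Atil[OF st], of ?y] that unfolding Ahat_whiten by blast
  have "(\<Sum>j<n. lam j * (x j - 1 / ?w j)) = (\<Sum>j<n. ?l j * ?y j)"
  proof (intro sum.cong refl)
    fix j assume "j \<in> {..<n}"
    then have "?w j > 0" using wpos by simp
    then show "lam j * (x j - 1 / ?w j) = ?l j * ?y j" by (simp add: lamhat_def field_simps)
  qed
  also have "\<dots> = (\<Sum>j<n. pr j * ?y j) + (\<Sum>j<n. (\<Sum>i<m. (\<Sum>k<n. ?Q i k * ?l k) * ?Q i j) * ?y j)"
    unfolding sum.distrib[symmetric] by (intro sum.cong) (auto simp: pr_apply algebra_simps)
  also have "(\<Sum>j<n. (\<Sum>i<m. (\<Sum>k<n. ?Q i k * ?l k) * ?Q i j) * ?y j) =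
      (\<Sum>i<m. (\<Sum>k<n. ?Q i k * ?l k) * (\<Sum>j<n. ?Q i j * ?y j))"
    by (rule sum_bilinear_swap)
  finally show ?thesis using Qy by simp
qed

end

theorem theorem2p1:
  fixes m :: nat
    and A :: "nat \<Rightarrow> nat \<Rightarrow> nat \<Rightarrow> real"
    and b :: "nat \<Rightarrow> nat \<Rightarrow> real"
    and lam :: "nat \<Rightarrow> nat \<Rightarrow> real"
  assumes "1 \<le> m"
    and "\<forall>n>m. standing m n (A n) (b n)"
    and "(\<lambda>n. mat_max m n (Ahat m n (A n) (b n))) \<longlonglongrightarrow> 0"
    and "(\<lambda>n. vec_max n (lamhat m n (A n) (b n) (lam n))) \<longlonglongrightarrow> 0"
    and "limsup (\<lambda>n. ereal (enorm n (lamhat m n (A n) (b n) (lam n)))) < \<infinity>"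
    and "liminf (\<lambda>n. ereal ((enorm n (proj n (ker_mat m n (Ahat m n (A n) (b n)))
                                   (lamhat m n (A n) (b n) (lam n))))\<^sup>2)) > 0"
  shows "weak_conv_m
           (\<lambda>n. distr (unifK m n (A n) (b n)) borel
              (\<lambda>x. (\<Sum>j<n. lam n j * (x j - (\<integral>y. y j \<partial>unifK m n (A n) (b n))))
                   / enorm n (proj n (ker_mat m n (Ahat m n (A n) (b n)))
                                   (lamhat m n (A n) (b n) (lam n)))))
           std_normal_distribution
       \<and> weak_conv_m
           (\<lambda>n. distr (unifK m n (A n) (b n)) borel
              (\<lambda>x. (\<Sum>j<n. lam n j * (x j - 1 / wvec m n (A n) (b n) j))
                   / enorm n (proj n (ker_mat m n (Ahat m n (A n) (b n)))
                                   (lamhat m n (A n) (b n) (lam n)))))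
           std_normal_distribution
       \<and> (\<forall>n>m.
            (enorm n (proj n (ker_mat m n (Ahat m n (A n) (b n))) (lamhat m n (A n) (b n) (lam n))))\<^sup>2
          = (enorm n (proj n (ker_mat m n (Atil m n (A n) (b n))) (lamhat m n (A n) (b n) (lam n))))\<^sup>2
          \<and> (enorm n (proj n (ker_mat m n (Atil m n (A n) (b n))) (lamhat m n (A n) (b n) (lam n))))\<^sup>2
          = (enorm n (lamhat m n (A n) (b n) (lam n)))\<^sup>2
            - (enorm m (matvec n (Ahat m n (A n) (b n)) (lamhat m n (A n) (b n) (lam n))))\<^sup>2)"
proof -
  define Q where "Q n = Ahat m n (A n) (b n)" for n
  define w where "w n = wvec m n (A n) (b n)" for n
  define l where "l n = lamhat m n (A n) (b n) (lam n)" for n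
  define U where "U n = unifK m n (A n) (b n)" for n
  define q where "q n = proj n (ker_mat m n (Q n)) (l n)" for n
  define \<sigma> where "\<sigma> n = enorm n (q n)" for n
  define h where "h n j = q n j / \<sigma> n" for n j
  define X where "X n x = (\<Sum>j<n. lam n j * (x j - 1 / w n j)) / \<sigma> n" for n and x :: "nat \<Rightarrow> real"
  have st: "standing m n (A n) (b n)" if "n > m" for n using assms(2) that by blast
  have q_pr: "q n = pr m n (A n) (b n) (lam n)" if "n > m" for n
    by (simp add: q_def Q_def l_def pr_def[OF st[OF that]])
  \<comment> \<open>\<open>s\<close> and \<open>c\<close> turn the liminf and limsup hypotheses into
    bounds on \<open>\<sigma> n\<close> and on the norm of \<open>l n\<close>, valid for all large
    \<open>n\<close>.\<close>
  obtain s where s: "0 < ereal s" "ereal s < liminf (\<lambda>n. ereal ((\<sigma> n)\<^sup>2))"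
    using ereal_dense2[OF assms(6)] unfolding \<sigma>_def q_def Q_def l_def by (elim exE conjE)
  obtain c where c: "limsup (\<lambda>n. ereal (enorm n (l n))) < ereal c"
    using ereal_dense2[OF assms(5)] unfolding l_def by (elim exE conjE)
  have "\<forall>\<^sub>F n in sequentially. n > m \<and> (\<sigma> n)\<^sup>2 > s \<and> enorm n (l n) < c"
    using eventually_gt_at_top[of m] less_LiminfD[OF s(2)] Limsup_lessD[OF c] by eventually_elim simp
  then obtain N0 where N0: "\<And>n. n \<ge> N0 \<Longrightarrow> n > m" "\<And>n. n \<ge> N0 \<Longrightarrow> (\<sigma> n)\<^sup>2 > s"
    "\<And>n. n \<ge> N0 \<Longrightarrow> enorm n (l n) < c" unfolding eventually_sequentially by blast
  define r where "r = sqrt s"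
  have r: "r > 0" using s by (simp add: r_def)
  have \<sigma>_ge: "\<sigma> n \<ge> r" if "n \<ge> N0" for n
    using N0(2)[OF that] unfolding r_def by (intro real_le_lsqrt) (auto simp: \<sigma>_def enorm_def sum_nonneg)
  define M where "M n = mat_max m n (Q n)" for n
  define V where "V n = vec_max n (l n)" for n
  \<comment> \<open>\<open>M n\<close> bounds the entries of \<open>Ahat\<close>; the quotient
    bounds those of \<open>h n\<close> by \<open>abs_pr_le\<close>, with \<open>c\<close> above the
    norm of \<open>l n\<close> and \<open>r\<close> below \<open>\<sigma> n\<close>.\<close>
  define e where "e n = M n + (V n + m * (c * M n)) / r" for n
  have e: "e \<longlonglongrightarrow> 0"
  proof -
    have "(\<lambda>n. M n + (V n + m * (c * M n)) / r) \<longlonglongrightarrow> 0 + (0 + m * (c * 0)) / r"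
      using assms(3,4) r unfolding M_def V_def Q_def l_def by (intro tendsto_intros) auto
    then show ?thesis by (simp add: e_def[abs_def])
  qed
  have ng: "near_gaussian m n (Q n) (h n) (e n)" if n: "n \<ge> N0" for n
  proof -
    have mn: "m < n" using N0(1)[OF n] .
    have \<sigma>: "\<sigma> n > 0" using \<sigma>_ge[OF n] r by linarith
    have c0: "c > 0" using N0(3)[OF n] by (rule order_le_less_trans[rotated]) (simp add: enorm_def sum_nonneg)
    have M0: "M n \<ge> 0"
      using mat_max_ge[of 0 m 0 n "Q n"] assms(1) mn unfolding M_def by simp
    have V0: "V n \<ge> 0" using vec_max_ge[of 0 n "l n"] mn unfolding V_def by simp
    have q_le: "\<bar>q n j\<bar> \<le> V n + m * (c * M n)" if j: "j < n" for j
    proof -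
      have "\<bar>q n j\<bar> \<le> V n + m * (enorm n (l n) * M n)"
        using abs_pr_le[OF st[OF mn] j, of "lam n"] unfolding q_pr[OF mn] V_def M_def l_def Q_def .
      also have "\<dots> \<le> V n + m * (c * M n)"
        using N0(3)[OF n] M0 by (intro add_left_mono mult_left_mono mult_right_mono) auto
      finally show ?thesis .
    qed
    show ?thesis
    proof
      show "1 \<le> m" by fact
      show "orthonormal m n (Q n)" unfolding Q_def by (rule Ahat_orthonormal[OF st[OF mn]])
      show "(\<Sum>j<n. Q n i j * (h n j)) = 0" if "i < m" for i
        using Ahat_pr[OF st[OF mn] that, of "lam n"] unfolding h_def q_pr[OF mn] Q_def
        by (simp add: sum_divide_distrib[symmetric])
      have "(\<Sum>j<n. (h n j)\<^sup>2) = (\<sigma> n)\<^sup>2 / (\<sigma> n)\<^sup>2"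
        unfolding h_def power_divide sum_divide_distrib[symmetric] \<sigma>_def enorm_sq ..
      then show "(\<Sum>j<n. (h n j)\<^sup>2) = 1" using \<sigma> by simp
      have quot: "0 \<le> (V n + m * (c * M n)) / r" using V0 M0 c0 r by simp
      show "\<bar>Q n i j\<bar> \<le> e n" if "i < m" "j < n" for i j
        using mat_max_ge[OF that, of "Q n"] quot by (simp add: e_def M_def)
      show "\<bar>h n j\<bar> \<le> e n" if "j < n" for j
      proof -
        have "\<bar>h n j\<bar> = \<bar>q n j\<bar> / \<sigma> n" using \<sigma> by (simp add: h_def)
        also have "\<dots> \<le> (V n + m * (c * M n)) / r"
          using q_le[OF that] \<sigma>_ge[OF n] r by (intro frac_le) auto
        finally show ?thesis using M0 by (simp add: e_def)
      qed
    qed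
  qed
  define J where "J z n = (\<integral>t. psi m n (Q n) (h n) z t \<partial>lebn m)" for z n
  define a where "a = complex_of_real (gauss_mass ^ m)"
  have a: "a \<noteq> 0"
    using integral_positive[OF integrable_exp_neg_sq[of "1/2"]] by (simp add: a_def)
  have J_int: "\<forall>\<^sub>F n in sequentially. integrable (lebn m) (psi m n (Q n) (h n) z)"
    and J_lim: "J z \<longlonglongrightarrow> exp (z\<^sup>2 / 2) * a" for z
  proof -
    have ng': "near_gaussian m (N + N0) (Q (N + N0)) (h (N + N0)) (e (N + N0))" for N
      by (rule ng) simp
    note lims = psi_integral_tendsto[OF ng' LIMSEQ_ignore_initial_segment[OF e]]
    from lims(1)[of z] show "\<forall>\<^sub>F n in sequentially. integrable (lebn m) (psi m n (Q n) (h n) z)"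
      by (subst (asm) eventually_sequentially_seg)
    have "(\<lambda>N. J z (N + N0)) \<longlonglongrightarrow> exp (z\<^sup>2 / 2) * a"
      unfolding J_def a_def by (rule lims(2))
    then show "J z \<longlonglongrightarrow> exp (z\<^sup>2 / 2) * a" by (rule LIMSEQ_offset)
  qed
  have J0_ne: "\<forall>\<^sub>F n in sequentially. J 0 n \<noteq> 0"
    using J_lim[of 0] by (rule tendsto_imp_eventually_ne) (use a in simp)
  \<comment> \<open>The conditions under which \<open>unifK_mgf\<close> makes \<open>U n\<close> a
    probability measure; they hold for all large \<open>n\<close>.\<close>
  have base: "\<forall>\<^sub>F n in sequentially. n \<ge> N0 \<and> integrable (lebn m) (psi m n (Q n) (h n) 0) \<and> J 0 n \<noteq> 0"
    using eventually_ge_at_top[of N0] J_int[of 0] J0_ne by eventually_elim simp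
  have U_prob: "prob_space (U n)" and U_K: "AE x in U n. x \<in> Kset m n (A n) (b n)"
    if "n \<ge> N0 \<and> integrable (lebn m) (psi m n (Q n) (h n) 0) \<and> J 0 n \<noteq> 0" for n
  proof -
    have st': "standing m n (A n) (b n)" using that by (intro st N0(1)) simp
    have psi0: "integrable (lebn m) (psi m n (Ahat m n (A n) (b n)) (h n) 0)"
      "(\<integral>t. psi m n (Ahat m n (A n) (b n)) (h n) 0 t \<partial>lebn m) \<noteq> 0"
      using that by (simp_all add: J_def Q_def)
    show "prob_space (U n)" unfolding U_def by (rule unifK_mgf(1)[OF st' psi0])
    show "AE x in U n. x \<in> Kset m n (A n) (b n)" unfolding U_def by (rule unifK_mgf(2)[OF st' psi0])
  qed
  have sets_U: "sets (U n) = sets (lebn n)" for n by (simp add: U_def unifK_def Let_def)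
  have X_meas: "X n \<in> borel_measurable (U n)" for n
    unfolding X_def[abs_def] measurable_cong_sets[OF sets_U refl] by measurable
  have "mgf_converges U X"
  proof
    show "\<forall>\<^sub>F n in sequentially. prob_space (U n) \<and> X n \<in> borel_measurable (U n)"
      using base by eventually_elim (use U_prob X_meas in blast)
    fix z :: complex
    have "(\<lambda>n. J z n / J 0 n) \<longlonglongrightarrow> (exp (z\<^sup>2 / 2) * a) / (exp (0\<^sup>2 / 2) * a)"
      by (intro tendsto_divide J_lim) (use a in simp)
    then have lim: "(\<lambda>n. J z n / J 0 n) \<longlonglongrightarrow> exp (z\<^sup>2 / 2)" using a by simp
    have small: "\<forall>\<^sub>F n in sequentially. norm z * e n < 1/2"
      by (rule order_tendstoD(2)[OF tendsto_mult_right_zero[OF e]]) simp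
    have "\<forall>\<^sub>F n in sequentially. J z n / J 0 n = (\<integral>x. exp (z * X n x) \<partial>U n)"
      using base J_int[of z] small
    proof eventually_elim
      case (elim n)
      then have n: "n \<ge> N0" by simp
      then have mn: "m < n" by (rule N0(1))
      interpret near_gaussian m n "Q n" "h n" "e n" by (rule ng[OF n])
      have Re: "\<bar>Re (z * complex_of_real (h n j))\<bar> \<le> 1/2" if "j < n" for j
      proof -
        have "\<bar>Re (z * complex_of_real (h n j))\<bar> \<le> norm (z * complex_of_real (h n j))" by (rule abs_Re_le_cmod)
        also have "\<dots> = norm z * \<bar>h n j\<bar>" by (simp only: norm_mult norm_of_real)
        also have "\<dots> \<le> norm z * e n" by (intro mult_left_mono h_le[OF that]) simp
        also have "\<dots> \<le> 1/2" using elim(3) by simp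
        finally show ?thesis .
      qed
      have "(\<integral>x. exp (z * (\<Sum>j<n. h n j * (w n j * x j - 1))) \<partial>U n) = J z n / J 0 n"
        unfolding J_def U_def w_def Q_def
        by (rule unifK_mgf(3)[OF st[OF mn] _ _ Re]) (use elim in \<open>simp_all add: Q_def J_def\<close>)
      \<comment> \<open>The two exponents agree on the polytope by \<open>weighted_sum_eq\<close>,
        hence almost everywhere, since \<open>U n\<close> lives on all of \<open>R^n\<close> but is
        concentrated on the polytope.\<close>
      also have "(\<integral>x. exp (z * (\<Sum>j<n. h n j * (w n j * x j - 1))) \<partial>U n) = (\<integral>x. exp (z * X n x) \<partial>U n)"
      proof (rule integral_cong_AE)
        show "(\<lambda>x. exp (z * (\<Sum>j<n. h n j * (w n j * x j - 1)))) \<in> borel_measurable (U n)"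
          unfolding measurable_cong_sets[OF sets_U refl] by measurable
        show "(\<lambda>x. exp (z * X n x)) \<in> borel_measurable (U n)" using X_meas[of n] by measurable
        show "AE x in U n. exp (z * (\<Sum>j<n. h n j * (w n j * x j - 1))) = exp (z * X n x)"
          using U_K[OF elim(1)]
        proof eventually_elim
          case (elim x)
          from weighted_sum_eq[OF st[OF mn] elim, of "lam n"]
          have "X n x = (\<Sum>j<n. q n j * (w n j * x j - 1)) / \<sigma> n"
            unfolding X_def q_pr[OF mn] w_def by simp
          then show ?case by (simp add: h_def sum_divide_distrib)
        qed
      qed
      finally show ?case ..
    qed
    from Lim_transform_eventually[OF lim this]
    show "(\<lambda>n. \<integral>x. exp (z * X n x) \<partial>U n) \<longlonglongrightarrow> exp (z\<^sup>2 / 2)" .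
  qed
  then interpret mgf_converges U X .
  \<comment> \<open>Centering at the true means amounts to subtracting from \<open>X n\<close> its
    own expectation: the terms \<open>1 / w n j\<close> cancel. The coordinates are integrable
    because the compact polytope bounds them.\<close>
  have centered: "\<forall>\<^sub>F n in sequentially.
      distr (U n) borel (\<lambda>x. (\<Sum>j<n. lam n j * (x j - (\<integral>y. y j \<partial>U n))) / \<sigma> n) =
      distr (U n) borel (\<lambda>x. X n x - (\<integral>y. X n y \<partial>U n))"
    using base
  proof eventually_elim
    case (elim n)
    then have mn: "m < n" using N0(1) by simp
    interpret prob_space "U n" by (rule U_prob[OF elim])
    have int: "integrable (U n) (\<lambda>x. x j)" if "j < n" for j
    proof -
      obtain c where c: "\<And>x. x \<in> Kset m n (A n) (b n) \<Longrightarrow> \<bar>x j\<bar> \<le> c"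
        using Kset_coordinate_bounded st[OF mn] unfolding standing_def by blast
      show ?thesis
      proof (rule integrable_const_bound)
        show "AE x in U n. norm (x j) \<le> c" using U_K[OF elim] by eventually_elim (simp add: c)
        show "(\<lambda>x. x j) \<in> borel_measurable (U n)"
          unfolding measurable_cong_sets[OF sets_U refl]
          using that measurable_component_singleton[of j "{..<n}" "\<lambda>_. lborel :: real measure"] by simp
      qed
    qed
    have EX: "(\<integral>y. X n y \<partial>U n) = (\<Sum>j<n. lam n j * ((\<integral>y. y j \<partial>U n) - 1 / w n j)) / \<sigma> n"
      using int prob_space by (simp add: X_def)
    have "X n x - (\<integral>y. X n y \<partial>U n) = (\<Sum>j<n. lam n j * (x j - (\<integral>y. y j \<partial>U n))) / \<sigma> n" for x
      unfolding EX unfolding X_def diff_divide_distrib[symmetric] sum_subtractf[symmetric]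
      by (simp add: algebra_simps)
    then show ?case by simp
  qed
  note defs = X_def[abs_def] \<sigma>_def q_def Q_def l_def U_def w_def
  show ?thesis
    using weak_conv_m_eventually[OF centered weak_conv_centered] weak_conv
    unfolding defs
    by (intro conjI allI impI)
       (assumption, assumption, simp_all add: ker_Ahat[OF st, symmetric] proj_kernel(2)[OF Ahat_orthonormal[OF st]])
qed

end
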